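(* Let $a>0$ and consider the boundary-value problem $$e_t(x,t)=a\,e_{xx}(x,t)-K\,e(\pi,t-\tau(t)),\qquad x\in[0,2\pi],\ t\ge 0,$$ $$e(0,t)=e(2\pi,t),\qquad e_x(0,t)=e_x(2\pi,t),$$ with time-varying delay $\tau(t)$ satisfying $\tau(t)\leq\tau_M$. Given positive scalars $\delta_0,\tau_M,K$ and $\delta_1$ satisfying $\delta_1<2\delta_0$, let there exist positive scalars $p_1,p_2,p_3,r,g$ and $s$ satisfying the linear matrix inequalities (LMIs) $$\delta_0p_3\leq p_2,\qquad \Phi\leq 0,\qquad \begin{bmatrix} r & s\\ s& r\end{bmatrix}\geq 0,$$ where $\Phi=\{\Phi_{ij}\}$ is the symmetric $5\times5$ matrix with $$\begin{aligned} \Phi_{11}&=g+2\delta_0p_1-e^{-2\delta_0\tau_M}r, & \Phi_{12}&=p_1-p_2,\\ \Phi_{13}&=e^{-2\delta_0\tau_M}s, & \Phi_{14}&=-p_2K+e^{-2\delta_0\tau_M}(r-s),\\ \Phi_{15}&=p_2K, & \Phi_{22}&=\tau_M^2r-2p_3,\\ \Phi_{24}&=-p_3K, & \Phi_{25}&=p_3K,\\ \Phi_{33}&=-g e^{-2\delta_0\tau_M}-e^{-2\delta_0\tau_M}r, & \Phi_{34}&=e^{-2\delta_0\tau_M}(r-s),\\ \Phi_{44}&=-2e^{-2\delta_0\tau_M}(r-s)-\delta_1p_1, & \Phi_{55}&=-\tfrac{\delta_1p_3a}{4}, \end{aligned}$$ and all other entries on or above the diagonal equal to zero. Then the system, initialized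 with $e(x,t)=e(x,0)$ for all $t<0$, where $e(\cdot,0)\in X$, is exponentially stable in the $\mathcal H^1$-norm with a decay rate $\delta$, where $\delta>0$ is the unique positive solution of $$\delta=\delta_0-\frac{\delta_1e^{2\delta\tau_M}}{2};$$ that is, $$\exists\,C>0:\quad \|e(\cdot,t)\|_{\mathcal H^1}\leq Ce^{-\delta t}\|e(\cdot,0)\|_{\mathcal H^1}.$$ Moreover, given any $\delta>0$ and $K>\delta_0$, the LMIs $\delta_0p_3\leq p_2$, $\Phi\leq 0$ and $\begin{bmatrix} r & s\\ s& r\end{bmatrix}\geq 0$ are always feasible for large enough $a$.
   Context: The unknown $e=e(x,t)\in\mathbb R^3$ is the error $e(x,t)=z(x,t)-\gamma(x)$ between the agents' continuum position $z$ and a closed $\mathcal C^2$ curve $\gamma:[0,2\pi]\to\mathbb R^3$; its components are decoupled, each satisfying the same scalar equation. The subscripts $t,x$ denote partial derivatives, and $a>0$, $K>0$ are control gains. The delay is $\tau(t)=t-t_k+\eta_k$ for $t\in[t_k,t_{k+1})$, where $t_k$ (with $t_0=0$) are the updating times of the controller and $\eta_k$ are network-induced delays; thus $t-\tau(t)=t_k-\eta_k$ on $[t_k,t_{k+1})$. The bound $\tau_M$, with $\tau(t)\le\tau_M$, is the sum of the maximum transmission interval and the maximum network-induced delay. $\mathcal L_2(0,2\pi)$ is the Hilbert space of square integrable functions. $\mathcal H^1(0,2\pi)$ is the Sobolev space of absolutely continuous functions with derivative in $\mathcal L_2(0,2\pi)$, with its usual norm $\|w\|_{\mathcal H^1}^2=\|w\|_{\mathcal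 L_2}^2+\|w_x\|_{\mathcal L_2}^2$ (summed over components for $\mathbb R^3$-valued functions). $X=\{w\in\mathcal H^1(0,2\pi)\mid w(0)=w(2\pi)\}$ (componentwise). For initial conditions $e(\cdot,0)\in X$ the boundary-value problem has a unique strong solution, and this is the solution considered. For symmetric matrices, $\Phi\le0$ (resp. $\ge0$) means negative (resp. positive) semidefinite. The LMIs are feasible if there exist positive scalars $p_1,p_2,p_3,r,g,s$ satisfying them.
   Formalization: In the "Moreover" part, feasibility for large a is claimed only for τ_M at most some threshold τ_0>0 depending on δ_0 and K (uniform in δ, δ_1): for arbitrary τ_M it fails, e.g. if Kτ_M≥3, Φ≤0 is infeasible for every a (test Φ with the vector (1,K,1,−1,0)). *)

theory Defs
  imports "HOL-Analysis.Analysis"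
begin

definition L2_on :: "'a::euclidean_space set \<Rightarrow> ('a \<Rightarrow> 'b::euclidean_space) \<Rightarrow> bool" where
  "L2_on S f \<longleftrightarrow>
     f \<in> borel_measurable (lebesgue_on S) \<and>
     integrable (lebesgue_on S) (\<lambda>x. (norm (f x))\<^sup>2)"

text \<open>The usual epsilon-delta definition; a finite family of non-overlapping closed
  subintervals is a division \<open>d\<close> of its own union, and \<open>Inf k\<close>, \<open>Sup k\<close> are the
  endpoints of the interval \<open>k\<close>.\<close>

definition abs_cont_on :: "real \<Rightarrow> real \<Rightarrow> (real \<Rightarrow> 'b::real_normed_vector) \<Rightarrow> bool" where
  "abs_cont_on a b f \<longleftrightarrow>
     (\<forall>\<epsilon>>0. \<exists>\<delta>>0. \<forall>d. d division_of (\<Union>d) \<and> \<Union>d \<subseteq> {a..b} \<and> (\<Sum>k\<in>d. Sup k - Inf k) < \<delta>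
        \<longrightarrow> (\<Sum>k\<in>d. norm (f (Sup k) - f (Inf k))) < \<epsilon>)"

text \<open>An absolutely continuous function is differentiable almost everywhere, so the second
  conjunct is no restriction; it only records that the \<open>vector_derivative\<close> in the third one
  is almost everywhere a genuine derivative.\<close>

definition H1_on :: "real \<Rightarrow> real \<Rightarrow> (real \<Rightarrow> 'b::euclidean_space) \<Rightarrow> bool" where
  "H1_on a b w \<longleftrightarrow>
     abs_cont_on a b w \<and>
     (AE x in lebesgue_on {a..b}. w differentiable (at x within {a..b})) \<and>
     L2_on {a..b} (\<lambda>x. vector_derivative w (at x within {a..b}))"

definition H1_norm :: "(real \<Rightarrow> 'b::euclidean_space) \<Rightarrow> real" where
  "H1_norm w = sqrt
     ((\<integral>x. (norm (w x))\<^sup>2 \<partial>lebesgue_on {0..2*pi}) +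
      (\<integral>x. (norm (vector_derivative w (at x within {0..2*pi})))\<^sup>2 \<partial>lebesgue_on {0..2*pi}))"

text \<open>An element of \<open>H\<^sup>2(0,2\<pi>)\<close> is continuously differentiable up to the boundary; the
  derivatives at the endpoints are one-sided.\<close>

definition H2 :: "(real \<Rightarrow> 'b::euclidean_space) \<Rightarrow> bool" where
  "H2 w \<longleftrightarrow>
     H1_on 0 (2*pi) w \<and>
     (\<forall>x\<in>{0..2*pi}. w differentiable (at x within {0..2*pi})) \<and>
     H1_on 0 (2*pi) (\<lambda>x. vector_derivative w (at x within {0..2*pi}))"

definition X_space :: "(real \<Rightarrow> real^3) set" where
  "X_space = {w. H1_on 0 (2*pi) w \<and> w 0 = w (2*pi)}"

definition network_delay :: "(real \<Rightarrow> real) \<Rightarrow> bool" where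
  "network_delay \<tau> \<longleftrightarrow>
     (\<exists>(tk :: nat \<Rightarrow> real) (\<eta> :: nat \<Rightarrow> real).
        tk 0 = 0 \<and> strict_mono tk \<and> filterlim tk at_top sequentially \<and>
        (\<forall>k. 0 \<le> \<eta> k) \<and>
        (\<forall>k. \<forall>t\<in>{tk k..<tk (Suc k)}. \<tau> t = t - tk k + \<eta> k))"

text \<open>Functions of space and time are curried, space first.\<close>

definition dx :: "(real \<Rightarrow> real \<Rightarrow> real^3) \<Rightarrow> real \<Rightarrow> real \<Rightarrow> real^3" where
  "dx e x t = vector_derivative (\<lambda>\<xi>. e \<xi> t) (at x within {0..2*pi})"

definition dt :: "(real \<Rightarrow> real \<Rightarrow> real^3) \<Rightarrow> real \<Rightarrow> real \<Rightarrow> real^3" where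
  "dt e x t = vector_derivative (\<lambda>s. e x s) (at t within {0..})"

text \<open>Strong solutions on \<open>[0,\<infinity>)\<close>, extended to negative times by the initial value:
  \<open>e \<in> C([0,\<infinity>); X_space)\<close>, \<open>e \<in> L\<^sup>2(0,T; H\<^sup>2)\<close> and \<open>e\<^sub>t \<in> L\<^sup>2(0,T; L\<^sup>2)\<close> for all \<open>T\<close>, with the
  boundary condition on \<open>e\<^sub>x\<close> for almost all \<open>t\<close> (the one on \<open>e\<close> is part of \<open>X_space\<close>) and the
  equation almost everywhere. A function in \<open>L\<^sup>2(0,T; L\<^sup>2)\<close> is a square integrable function
  on the rectangle; \<open>e\<^sub>t\<close> is the derivative of the absolutely continuous time slices.\<close>

definition strong_solution ::
    "real \<Rightarrow> real \<Rightarrow> (real \<Rightarrow> real) \<Rightarrow> (real \<Rightarrow> real \<Rightarrow> real^3) \<Rightarrow> bool" where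
  "strong_solution a K \<tau> e \<longleftrightarrow>
     (\<forall>t<0. \<forall>x\<in>{0..2*pi}. e x t = e x 0) \<and>
     (\<forall>t\<ge>0. (\<lambda>x. e x t) \<in> X_space) \<and>
     (\<forall>t\<ge>0. ((\<lambda>s. H1_norm (\<lambda>x. e x s - e x t)) \<longlongrightarrow> 0) (at t within {0..})) \<and>
     (AE t in lebesgue_on {0..}. H2 (\<lambda>x. e x t) \<and> dx e 0 t = dx e (2*pi) t) \<and>
     (\<forall>T>0. L2_on ({0..2*pi} \<times> {0..T}) (\<lambda>(x, t). e x t) \<and>
            L2_on ({0..2*pi} \<times> {0..T}) (\<lambda>(x, t). dx e x t) \<and>
            L2_on ({0..2*pi} \<times> {0..T}) (\<lambda>(x, t). dx (dx e) x t)) \<and>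
     (\<forall>T>0. (AE x in lebesgue_on {0..2*pi}. H1_on 0 T (\<lambda>t. e x t)) \<and>
            L2_on ({0..2*pi} \<times> {0..T}) (\<lambda>(x, t). dt e x t)) \<and>
     (AE (x, t) in lebesgue_on ({0..2*pi} \<times> {0..}).
        dt e x t = a *\<^sub>R dx (dx e) x t - K *\<^sub>R e pi (t - \<tau> t))"

definition pos_semidef :: "real^'n^'n \<Rightarrow> bool" where
  "pos_semidef A \<longleftrightarrow> transpose A = A \<and> (\<forall>v. 0 \<le> v \<bullet> (A *v v))"

definition neg_semidef :: "real^'n^'n \<Rightarrow> bool" where
  "neg_semidef A \<longleftrightarrow> transpose A = A \<and> (\<forall>v. v \<bullet> (A *v v) \<le> 0)"

definition Phi :: "real \<Rightarrow> real \<Rightarrow> real \<Rightarrow> real \<Rightarrow> real \<Rightarrow>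
    real \<Rightarrow> real \<Rightarrow> real \<Rightarrow> real \<Rightarrow> real \<Rightarrow> real \<Rightarrow> real^5^5" where
  "Phi a K \<delta>0 \<delta>1 \<tau>M p1 p2 p3 r g s =
    (let \<rho> = exp (- 2 * \<delta>0 * \<tau>M);
         \<Phi>11 = g + 2 * \<delta>0 * p1 - \<rho> * r;
         \<Phi>12 = p1 - p2;
         \<Phi>13 = \<rho> * s;
         \<Phi>14 = - p2 * K + \<rho> * (r - s);
         \<Phi>15 = p2 * K;
         \<Phi>22 = \<tau>M\<^sup>2 * r - 2 * p3;
         \<Phi>24 = - p3 * K;
         \<Phi>25 = p3 * K;
         \<Phi>33 = - g * \<rho> - \<rho> * r;
         \<Phi>34 = \<rho> * (r - s);
         \<Phi>44 = - 2 * \<rho> * (r - s) - \<delta>1 * p1;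
         \<Phi>55 = - (\<delta>1 * p3 * a / 4)
     in vector [vector [\<Phi>11, \<Phi>12, \<Phi>13, \<Phi>14, \<Phi>15],
                vector [\<Phi>12, \<Phi>22, 0,   \<Phi>24, \<Phi>25],
                vector [\<Phi>13, 0,   \<Phi>33, \<Phi>34, 0  ],
                vector [\<Phi>14, \<Phi>24, \<Phi>34, \<Phi>44, 0  ],
                vector [\<Phi>15, \<Phi>25, 0,   0,   \<Phi>55]])"

definition LMIs_feasible :: "real \<Rightarrow> real \<Rightarrow> real \<Rightarrow> real \<Rightarrow> real \<Rightarrow> bool" where
  "LMIs_feasible a K \<delta>0 \<delta>1 \<tau>M \<longleftrightarrow>
     (\<exists>p1>0. \<exists>p2>0. \<exists>p3>0. \<exists>r>0. \<exists>g>0. \<exists>s>0.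
        \<delta>0 * p3 \<le> p2 \<and>
        neg_semidef (Phi a K \<delta>0 \<delta>1 \<tau>M p1 p2 p3 r g s) \<and>
        pos_semidef (vector [vector [r, s], vector [s, r]] :: real^2^2))"

end

theory Submission
  imports Defs
begin

text \<open>The Lyapunov functional of the theorem is the energy \<open>N(t) = p1 \<parallel>e\<parallel>\<^sup>2 + p3 a \<parallel>e\<^sub>x\<parallel>\<^sup>2\<close> plus two
  history terms, with weights \<open>g\<close> and \<open>r\<close>. A strong solution is in \<open>H\<^sup>2\<close> only at almost every time, so
  \<open>N\<close> is not differentiated: it is convex, hence \<open>N(t) - N(s)\<close> is at most the pairing of its gradient
  at \<open>t\<close> with \<open>e(t) - e(s)\<close>, and averaging over \<open>s = t - h\<close> with \<open>h \<rightarrow> 0\<close> gives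
  \<open>N(T) - N(0) \<le> \<integral> \<langle>2 p1 e - 2 p3 a e\<^sub>x\<^sub>x, e\<^sub>t\<rangle> dt\<close>. Since \<open>\<Phi> \<le> 0\<close>, the integrand is bounded by
  \<open>\<delta>1 N(t - \<tau>(t))\<close> and terms whose weighted integrals over \<open>{0..T}\<close> telescope; these play the role of the
  history terms. Halanay's comparison argument then gives the decay.\<close>

section \<open>Feasibility of the matrix inequalities\<close>

text \<open>The coordinates of \<open>\<Phi>\<close> stand for the error, its time derivative, the
  error at the oldest time \<open>t - \<tau>M\<close>, the error at the delayed time, and the
  deviation of the latter from its value at \<open>pi\<close>. The equation is used with the
  multiplier \<open>2 * (p2 * e + p3 * e_t)\<close>, which trades \<open>e_xx\<close> for these
  quantities. Only the pairing of \<open>e\<close> with \<open>e_xx\<close> survives; integrated by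
  parts it gives \<open>- 2 * p2 * a\<close> times the squared norm of \<open>e_x\<close>, and
  \<open>\<delta>0 * p3 \<le> p2\<close> makes this pay for the growth
  \<open>2 * \<delta>0 * p3 * a\<close> demanded by the weight. The controller sees one point value
  only. The deviation from it is bounded by \<open>e_x\<close> through a Poincare inequality for
  functions vanishing at the midpoint; its constant \<open>4\<close> is the origin of the
  \<open>1 / 4\<close> in \<open>\<Phi>55\<close>. The delay jumps at updating times and the
  dissipation estimate becomes useful only after integration over \<open>{0..T}\<close>, so the
  comparison argument looks at the first time at which the energy meets an exponential barrier and
  contradicts the integrated inequality there.\<close>

lemma decay_rate_unique:
  fixes \<delta>0 \<delta>1 \<tau>M :: real
  assumes "\<delta>0 > 0" "\<delta>1 > 0" "\<tau>M > 0" "\<delta>1 < 2 * \<delta>0"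
  shows "\<exists>!\<delta>. \<delta> > 0 \<and> \<delta> = \<delta>0 - \<delta>1 * exp (2 * \<delta> * \<tau>M) / 2"
proof -
  define f where "f = (\<lambda>\<delta>. \<delta> + \<delta>1 * exp (2 * \<delta> * \<tau>M) / 2)"
  have mono: "f x < f y" if "x < y" for x y
  proof -
    have "exp (2 * x * \<tau>M) < exp (2 * y * \<tau>M)" using that assms by simp
    then have "\<delta>1 * exp (2 * x * \<tau>M) < \<delta>1 * exp (2 * y * \<tau>M)" using assms by simp
    with that show ?thesis by (simp add: f_def)
  qed
  \<comment> \<open>\<open>f 0\<close> equals \<open>\<delta>1 / 2\<close>, which
    \<open>\<delta>1 < 2 * \<delta>0\<close> puts strictly below \<open>\<delta>0\<close>; the same
    strictness excludes \<open>d = 0\<close> below.\<close>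
  have "f 0 \<le> \<delta>0" "\<delta>0 \<le> f \<delta>0" using assms by (auto simp: f_def)
  moreover have "continuous_on {0..\<delta>0} f" unfolding f_def by (intro continuous_intros) auto
  ultimately obtain d where d: "0 \<le> d" "f d = \<delta>0"
    using IVT'[of f 0 \<delta>0 \<delta>0] assms by auto
  have "d \<noteq> 0" using d assms by (auto simp: f_def)
  with d have "d > 0" by simp
  show ?thesis
  proof (rule ex1I[of _ d])
    show "d > 0 \<and> d = \<delta>0 - \<delta>1 * exp (2 * d * \<tau>M) / 2"
      using d \<open>d > 0\<close> by (simp add: f_def algebra_simps)
    fix y assume "y > 0 \<and> y = \<delta>0 - \<delta>1 * exp (2 * y * \<tau>M) / 2"
    then have "f y = f d" using d by (simp add: f_def)
    then show "y = d" using mono by (metis linorder_less_linear less_irrefl)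
  qed
qed

section \<open>Explicit coordinates for the matrix inequalities\<close>

lemma exhaust_5: "x = 1 \<or> x = 2 \<or> x = 3 \<or> x = 4 \<or> x = 5" for x :: 5
proof (induct x)
  case (of_int z)
  then have "z = 0 \<or> z = 1 \<or> z = 2 \<or> z = 3 \<or> z = 4" by fastforce
  then show ?case by auto
qed

lemma forall_5: "(\<forall>i::5. P i) \<longleftrightarrow> P 1 \<and> P 2 \<and> P 3 \<and> P 4 \<and> P 5"
  by (metis exhaust_5)

lemma UNIV_5: "UNIV = {1::5, 2, 3, 4, 5}"
  using exhaust_5 by auto

lemma sum_5: "sum f (UNIV :: 5 set) = f 1 + f 2 + f 3 + f 4 + f 5"
  unfolding UNIV_5 by (simp add: ac_simps)

lemma vector_5:
  fixes x1 :: "'a::zero"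
  shows "(vector [x1, x2, x3, x4, x5] :: 'a^5) $ 1 = x1"
    "(vector [x1, x2, x3, x4, x5] :: 'a^5) $ 2 = x2"
    "(vector [x1, x2, x3, x4, x5] :: 'a^5) $ 3 = x3"
    "(vector [x1, x2, x3, x4, x5] :: 'a^5) $ 4 = x4"
    "(vector [x1, x2, x3, x4, x5] :: 'a^5) $ 5 = x5"
  unfolding vector_def by simp_all

text \<open>All entries carrying \<open>\<rho> * r\<close> or \<open>\<rho> * s\<close> collapse
  into the quadratic form of the 2 by 2 matrix of the last inequality, evaluated at the increments
  \<open>v$1 - v$4\<close> and \<open>v$4 - v$3\<close>.\<close>

lemma quadratic_form_Phi:
  fixes v :: "real^5" and \<delta>0 \<tau>M :: real
  defines "\<rho> \<equiv> exp (- 2 * \<delta>0 * \<tau>M)"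
  shows "v \<bullet> (Phi a K \<delta>0 \<delta>1 \<tau>M p1 p2 p3 r g s *v v) =
    (g + 2 * \<delta>0 * p1) * (v$1)\<^sup>2 + 2 * (p1 - p2) * (v$1) * (v$2) - 2 * p2 * K * (v$1) * (v$4)
    + 2 * p2 * K * (v$1) * (v$5) + (\<tau>M\<^sup>2 * r - 2 * p3) * (v$2)\<^sup>2 - 2 * p3 * K * (v$2) * (v$4)
    + 2 * p3 * K * (v$2) * (v$5) - g * \<rho> * (v$3)\<^sup>2 - \<delta>1 * p1 * (v$4)\<^sup>2 - \<delta>1 * p3 * a / 4 * (v$5)\<^sup>2
    - \<rho> * (r * (v$1 - v$4)\<^sup>2 + r * (v$4 - v$3)\<^sup>2 + 2 * s * (v$1 - v$4) * (v$4 - v$3))"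
  unfolding Phi_def Let_def \<rho>_def[symmetric] inner_vec_def matrix_vector_mult_def
  by (simp add: sum_5 vector_5 power2_eq_square algebra_simps)

lemma symmetric_Phi: "transpose (Phi a K \<delta>0 \<delta>1 \<tau>M p1 p2 p3 r g s) = Phi a K \<delta>0 \<delta>1 \<tau>M p1 p2 p3 r g s"
  unfolding Phi_def Let_def transpose_def vec_eq_iff forall_5 by (simp add: vector_5)

text \<open>The eigenvalues are \<open>r + s\<close> and \<open>r - s\<close>, with eigenvectors
  \<open>(1, 1)\<close> and \<open>(1, -1)\<close>: testing on these gives one direction,
  diagonalising the form gives the other.\<close>

lemma pos_semidef_2:
  fixes r s :: real
  shows "pos_semidef (vector [vector [r, s], vector [s, r]] :: real^2^2) \<longleftrightarrow> \<bar>s\<bar> \<le> r"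
proof
  let ?A = "vector [vector [r, s], vector [s, r]] :: real^2^2"
  have form: "v \<bullet> (?A *v v) = r * (v$1)\<^sup>2 + r * (v$2)\<^sup>2 + 2 * s * (v$1) * (v$2)" for v :: "real^2"
    unfolding inner_vec_def matrix_vector_mult_def
    by (simp add: sum_2 power2_eq_square algebra_simps)
  {
    assume "pos_semidef ?A"
    then have "0 \<le> v \<bullet> (?A *v v)" for v by (simp add: pos_semidef_def)
    from this[of "vector [1, 1]"] this[of "vector [1, -1]"]
    show "\<bar>s\<bar> \<le> r" unfolding form by simp
  }
  assume sr: "\<bar>s\<bar> \<le> r"
  have "0 \<le> r * x\<^sup>2 + r * y\<^sup>2 + 2 * s * x * y" for x y :: real
  proof -
    have "0 \<le> r + s" "0 \<le> r - s" using sr by linarith+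
    then have "0 \<le> (r + s) * (x + y)\<^sup>2 + (r - s) * (x - y)\<^sup>2" by simp
    then show ?thesis by (simp add: power2_eq_square algebra_simps)
  qed
  then have "0 \<le> v \<bullet> (?A *v v)" for v unfolding form .
  moreover have "transpose ?A = ?A"
    by (simp add: vec_eq_iff forall_2 transpose_def)
  ultimately show "pos_semidef ?A" by (simp add: pos_semidef_def)
qed

lemma young:
  fixes x y c :: real
  assumes "c > 0"
  shows "2 * x * y \<le> c * x\<^sup>2 + y\<^sup>2 / c"
proof -
  have "0 \<le> (c * x - y)\<^sup>2 / c" using assms by simp
  also have "\<dots> = c * x\<^sup>2 + y\<^sup>2 / c - 2 * x * y"
    using assms by (simp add: power2_eq_square field_simps)
  finally show ?thesis by simp
qed

text \<open>The witnesses are \<open>p3 = 1\<close>, \<open>g = \<delta>0 * K\<close>,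
  \<open>r = R\<close>, \<open>s = R / 2\<close> and the \<open>p1\<close>, \<open>p2\<close> below.
  With \<open>v$4 = v$1 - \<alpha>\<close> substituted, the form is diagonal and negative in
  \<open>v$1\<close>, \<open>v$2\<close> up to products with \<open>\<alpha>\<close> and with
  \<open>v$5\<close>. The \<open>r\<close>-terms absorb the former; \<open>\<Phi>55\<close> absorbs
  the latter once \<open>a\<close> is large.\<close>

lemma LMIs_feasible_eventually:
  fixes \<delta>0 K :: real
  assumes \<delta>0: "\<delta>0 > 0" and K: "K > \<delta>0"
  shows "\<exists>\<tau>0>0. \<forall>\<tau>M \<delta>1 :: real. 0 < \<tau>M \<and> \<tau>M \<le> \<tau>0 \<and> 0 < \<delta>1 \<longrightarrow>
    (\<forall>\<^sub>F a in at_top. LMIs_feasible a K \<delta>0 \<delta>1 \<tau>M)"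
proof -
  \<comment> \<open>\<open>p2\<close> solves
    \<open>2 * \<delta>0 * (p2 + K) = 2 * p2 * K - 2 * \<delta>0 * K\<close>, which leaves
    \<open>- \<delta>0 * K\<close> as the coefficient of \<open>(v$1)\<^sup>2\<close>; it is
    positive because \<open>K > \<delta>0\<close>. The choice \<open>p1 = p2 + K\<close> cancels the
    product of \<open>v$1\<close> and \<open>v$2\<close>.\<close>
  define p2 where "p2 = 2 * \<delta>0 * K / (K - \<delta>0)"
  define p1 where "p1 = p2 + K"
  \<comment> \<open>\<open>L\<close> is the price of Young's inequality when the products with
    \<open>\<alpha>\<close> and those with \<open>v$5\<close> may each consume half of the negative
    diagonal terms. The factor \<open>6\<close> in \<open>R\<close> makes up for
    \<open>\<rho> \<ge> 1 / 3\<close> and for the half of the form kept in the bound for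
    \<open>\<alpha>\<close>.\<close>
  define L where "L = 2 * p2\<^sup>2 * K / \<delta>0 + 2 * K\<^sup>2"
  define R where "R = 6 * L"
  \<comment> \<open>The first bound yields \<open>\<rho> \<ge> exp (-1) \<ge> 1 / 3\<close>, the
    second \<open>\<tau>M\<^sup>2 * R \<le> 1\<close>.\<close>
  define \<tau>0 where "\<tau>0 = min (1 / (2 * \<delta>0)) (1 / sqrt R)"
  have Kp: "K > 0" using assms by simp
  have p2: "p2 > 0" using assms by (simp add: p2_def)
  have p2_ge: "\<delta>0 \<le> p2" using assms by (simp add: p2_def field_simps)
  have p1: "p1 > 0" using p2 Kp by (simp add: p1_def)
  have L: "L > 0" unfolding L_def using \<delta>0 Kp p2 by (intro add_pos_pos divide_pos_pos mult_pos_pos) auto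
  have R: "R > 0" using L by (simp add: R_def)
  have \<tau>0: "\<tau>0 > 0" using \<delta>0 R by (simp add: \<tau>0_def)
  have p2K: "p2 * (K - \<delta>0) = 2 * \<delta>0 * K" using assms by (simp add: p2_def)
  have feas: "LMIs_feasible a K \<delta>0 \<delta>1 \<tau>M"
    if \<tau>M: "0 < \<tau>M" "\<tau>M \<le> \<tau>0" and \<delta>1: "0 < \<delta>1" and a: "a \<ge> 4 * L / \<delta>1" for \<tau>M \<delta>1 a :: real
  proof -
    define \<rho> where "\<rho> = exp (- 2 * \<delta>0 * \<tau>M)"
    have "2 * \<delta>0 * \<tau>M \<le> 1" using \<tau>M \<delta>0 by (simp add: \<tau>0_def field_simps)
    then have "exp (-1) \<le> \<rho>" by (simp add: \<rho>_def)
    moreover have "1 / 3 \<le> exp (-1 :: real)"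
      using exp_le by (simp add: exp_minus field_simps)
    ultimately have \<rho>: "1 / 3 \<le> \<rho>" by linarith
    have "\<tau>M \<le> 1 / sqrt R" using \<tau>M by (simp add: \<tau>0_def)
    then have "\<tau>M\<^sup>2 \<le> (1 / sqrt R)\<^sup>2" using \<tau>M by (intro power_mono) auto
    then have \<tau>R: "\<tau>M\<^sup>2 * R \<le> 1" using R by (simp add: power_divide field_simps)
    have aL: "L \<le> \<delta>1 * a / 4" using a \<delta>1 by (simp add: field_simps)
    have "v \<bullet> (Phi a K \<delta>0 \<delta>1 \<tau>M p1 p2 1 R (\<delta>0 * K) (R / 2) *v v) \<le> 0" for v :: "real^5"
    proof -
      define \<alpha> where "\<alpha> = v$1 - v$4"
      define \<beta> where "\<beta> = v$4 - v$3"
      have LL: "2 * p2 * K * (v$1) * z + 2 * K * (v$2) * z \<le> (\<delta>0 * K * (v$1)\<^sup>2) / 2 + (v$2)\<^sup>2 / 2 + L * z\<^sup>2" for z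
      proof -
        have "2 * (v$1) * (p2 * K * z) \<le> \<delta>0 * K / 2 * (v$1)\<^sup>2 + (p2 * K * z)\<^sup>2 / (\<delta>0 * K / 2)"
          using \<delta>0 Kp by (intro young) auto
        moreover have "(p2 * K * z)\<^sup>2 / (\<delta>0 * K / 2) = 2 * p2\<^sup>2 * K / \<delta>0 * z\<^sup>2"
          using \<delta>0 Kp by (simp add: power2_eq_square field_simps)
        moreover have "2 * (v$2) * (K * z) \<le> 1 / 2 * (v$2)\<^sup>2 + (K * z)\<^sup>2 / (1 / 2)"
          by (intro young) auto
        ultimately show ?thesis by (simp add: L_def power_mult_distrib algebra_simps)
      qed
      \<comment> \<open>Half of the \<open>\<alpha>\<close> part is kept and the increment
        \<open>\<beta>\<close> towards the oldest time is given up.\<close>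
      have "R * \<alpha>\<^sup>2 + R * \<beta>\<^sup>2 + R * \<alpha> * \<beta> \<ge> R / 2 * \<alpha>\<^sup>2"
      proof -
        have "0 \<le> R / 2 * (\<alpha> + \<beta>)\<^sup>2 + R / 2 * \<beta>\<^sup>2" using R by auto
        then show ?thesis by (simp add: power2_eq_square algebra_simps)
      qed
      then have "\<rho> * (R * \<alpha>\<^sup>2 + R * \<beta>\<^sup>2 + R * \<alpha> * \<beta>) \<ge> \<rho> * (R / 2 * \<alpha>\<^sup>2)"
        using \<rho> by (intro mult_left_mono) auto
      moreover have "\<rho> * (R / 2 * \<alpha>\<^sup>2) \<ge> 1 / 3 * (R / 2 * \<alpha>\<^sup>2)" using \<rho> R by (intro mult_right_mono) auto
      ultimately have m1: "\<rho> * (R * \<alpha>\<^sup>2 + R * \<beta>\<^sup>2 + R * \<alpha> * \<beta>) \<ge> L * \<alpha>\<^sup>2" by (simp add: R_def)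
      have m2: "\<delta>1 * a / 4 * (v$5)\<^sup>2 \<ge> L * (v$5)\<^sup>2" using aL by (intro mult_right_mono) auto
      have m3: "(\<tau>M\<^sup>2 * R) * (v$2)\<^sup>2 \<le> 1 * (v$2)\<^sup>2" using \<tau>R by (intro mult_right_mono) auto
      have m4: "0 \<le> \<delta>0 * K * \<rho> * (v$3)\<^sup>2" "0 \<le> \<delta>1 * p1 * (v$4)\<^sup>2" using \<delta>0 Kp \<rho> \<delta>1 p1 by auto
      have p1': "2 * \<delta>0 * p1 = 2 * p2 * K - 2 * \<delta>0 * K"
        using p2K by (simp add: p1_def algebra_simps)
      \<comment> \<open>With every product treated as a single atom, the rest is linear
        arithmetic.\<close>
      have arith: "- A + B + C + T - 2 * y - q1 - q2 - z - R' \<le> 0"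
        if "B \<le> A / 2 + y / 2 + l" "C \<le> A / 2 + y / 2 + l'" "l \<le> R'" "l' \<le> z" "T \<le> 1 * y" "0 \<le> q1" "0 \<le> q2"
        for A B C T y q1 q2 z R' l l' :: real
        using that by linarith
      have "v \<bullet> (Phi a K \<delta>0 \<delta>1 \<tau>M p1 p2 1 R (\<delta>0 * K) (R / 2) *v v)
        = (\<delta>0 * K + 2 * \<delta>0 * p1 - 2 * p2 * K) * (v$1)\<^sup>2 + 2 * (p1 - p2 - K) * (v$1) * (v$2)
          + (2 * p2 * K * (v$1) * \<alpha> + 2 * K * (v$2) * \<alpha>)
          + (2 * p2 * K * (v$1) * (v$5) + 2 * K * (v$2) * (v$5)) + (\<tau>M\<^sup>2 * R) * (v$2)\<^sup>2 - 2 * (v$2)\<^sup>2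
          - \<delta>0 * K * \<rho> * (v$3)\<^sup>2 - \<delta>1 * p1 * (v$4)\<^sup>2 - \<delta>1 * a / 4 * (v$5)\<^sup>2
          - \<rho> * (R * \<alpha>\<^sup>2 + R * \<beta>\<^sup>2 + R * \<alpha> * \<beta>)"
        unfolding quadratic_form_Phi \<rho>_def[symmetric] \<alpha>_def \<beta>_def
        by (simp add: power2_eq_square algebra_simps)
      also have "\<dots> = - (\<delta>0 * K * (v$1)\<^sup>2)
          + (2 * p2 * K * (v$1) * \<alpha> + 2 * K * (v$2) * \<alpha>)
          + (2 * p2 * K * (v$1) * (v$5) + 2 * K * (v$2) * (v$5)) + (\<tau>M\<^sup>2 * R) * (v$2)\<^sup>2 - 2 * (v$2)\<^sup>2
          - \<delta>0 * K * \<rho> * (v$3)\<^sup>2 - \<delta>1 * p1 * (v$4)\<^sup>2 - \<delta>1 * a / 4 * (v$5)\<^sup>2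
          - \<rho> * (R * \<alpha>\<^sup>2 + R * \<beta>\<^sup>2 + R * \<alpha> * \<beta>)"
        unfolding p1' by (simp add: p1_def)
      also have "\<dots> \<le> 0" by (rule arith[OF LL[of \<alpha>] LL[of "v$5"] m1 m2 m3 m4])
      finally show ?thesis .
    qed
    then have "neg_semidef (Phi a K \<delta>0 \<delta>1 \<tau>M p1 p2 1 R (\<delta>0 * K) (R / 2))"
      by (simp add: neg_semidef_def symmetric_Phi)
    moreover have "pos_semidef (vector [vector [R, R / 2], vector [R / 2, R]] :: real^2^2)"
      using R by (simp add: pos_semidef_2)
    moreover have "\<delta>0 * 1 \<le> p2" "R / 2 > 0" "\<delta>0 * K > 0" "(1::real) > 0" using p2_ge R \<delta>0 Kp by simp_all
    ultimately show ?thesis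
      unfolding LMIs_feasible_def using p1 p2 R
      apply -
      apply (rule exI[of _ p1], rule conjI, assumption)
      apply (rule exI[of _ p2], rule conjI, assumption)
      apply (rule exI[of _ 1], rule conjI, assumption)
      apply (rule exI[of _ R], rule conjI, assumption)
      apply (rule exI[of _ "\<delta>0 * K"], rule conjI, assumption)
      apply (rule exI[of _ "R / 2"], rule conjI, assumption)
      apply (intro conjI; assumption)
      done
  qed
  show ?thesis
  proof (intro exI[of _ \<tau>0] conjI allI impI)
    fix \<tau>M \<delta>1 :: real assume "0 < \<tau>M \<and> \<tau>M \<le> \<tau>0 \<and> 0 < \<delta>1"
    then show "\<forall>\<^sub>F a in at_top. LMIs_feasible a K \<delta>0 \<delta>1 \<tau>M"
      using feas by (intro eventually_mono[OF eventually_ge_at_top[of "4 * L / \<delta>1"]]) blast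
  qed (rule \<tau>0)
qed

section \<open>Absolutely continuous functions\<close>

lemma abs_cont_onD_interval:
  assumes "abs_cont_on a b f" "\<epsilon> > 0"
  obtains \<delta> where "\<delta> > 0" "\<And>x y. \<lbrakk>x \<in> {a..b}; y \<in> {a..b}; \<bar>y - x\<bar> < \<delta>\<rbrakk> \<Longrightarrow> norm (f y - f x) < \<epsilon>"
proof -
  obtain \<delta> where \<delta>: "\<delta> > 0" and *: "\<And>d. \<lbrakk>d division_of (\<Union>d); \<Union>d \<subseteq> {a..b}; (\<Sum>k\<in>d. Sup k - Inf k) < \<delta>\<rbrakk>
      \<Longrightarrow> (\<Sum>k\<in>d. norm (f (Sup k) - f (Inf k))) < \<epsilon>"
    using assms unfolding abs_cont_on_def by meson
  have le: "norm (f y - f x) < \<epsilon>" if "x \<in> {a..b}" "y \<in> {a..b}" "y - x < \<delta>" "x \<le> y" for x y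
    using *[of "{{x..y}}"] that division_of_self[of x y] by simp
  have "norm (f y - f x) < \<epsilon>" if "x \<in> {a..b}" "y \<in> {a..b}" "\<bar>y - x\<bar> < \<delta>" for x y
    using le[of x y] le[of y x] that by (cases "x \<le> y") (auto simp: norm_minus_commute)
  then show ?thesis using \<delta> that by blast
qed

lemma abs_cont_on_imp_continuous_on: "abs_cont_on a b f \<Longrightarrow> continuous_on {a..b} f"
  unfolding continuous_on_iff dist_norm by (metis abs_cont_onD_interval real_norm_def)

lemma abs_cont_on_subinterval:
  assumes "abs_cont_on a b f" "{c..d} \<subseteq> {a..b}"
  shows "abs_cont_on c d f"
  using assms unfolding abs_cont_on_def by (meson subset_trans)

lemma division_Sup_Inf:
  fixes d :: "real set set"
  assumes "d division_of S" "S \<subseteq> {a..b}" "k \<in> d"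
  shows "Inf k \<le> Sup k" "Inf k \<in> {a..b}" "Sup k \<in> {a..b}"
proof -
  obtain u v where k: "k = cbox u v" "k \<noteq> {}" "k \<subseteq> S"
    using division_ofD(2,3,4)[OF assms(1,3)] by blast
  then have uv: "u \<le> v" "k = {u..v}" by auto
  then have "u \<in> k" "v \<in> k" by auto
  then have "u \<in> {a..b}" "v \<in> {a..b}" using k assms(2) by blast+
  then show "Inf k \<le> Sup k" "Inf k \<in> {a..b}" "Sup k \<in> {a..b}" using uv by auto
qed

text \<open>Common source of the closure properties below: Lipschitz functions, differences and
  bilinear products all have increments dominated by those of two absolutely continuous
  functions.\<close>

lemma abs_cont_on_dominated:
  assumes g: "abs_cont_on a b g" and h: "abs_cont_on a b h" and B: "B \<ge> 0"
    and f: "\<And>x y. \<lbrakk>x \<in> {a..b}; y \<in> {a..b}\<rbrakk> \<Longrightarrow> norm (f y - f x) \<le> B * norm (g y - g x) + B * norm (h y - h x)"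
  shows "abs_cont_on a b f"
  unfolding abs_cont_on_def
proof (intro allI impI)
  fix \<epsilon> :: real assume "\<epsilon> > 0"
  \<comment> \<open>The \<open>+ 1\<close> covers \<open>B = 0\<close> and leaves a margin of
    \<open>2 * \<eta>\<close>, so the final estimate is strict.\<close>
  define \<eta> where "\<eta> = \<epsilon> / (2 * (B + 1))"
  have \<eta>: "\<eta> > 0" using \<open>\<epsilon> > 0\<close> B by (simp add: \<eta>_def)
  obtain \<delta>g where \<delta>g: "\<delta>g > 0" and g: "\<And>d. \<lbrakk>d division_of (\<Union>d); \<Union>d \<subseteq> {a..b}; (\<Sum>k\<in>d. Sup k - Inf k) < \<delta>g\<rbrakk>
      \<Longrightarrow> (\<Sum>k\<in>d. norm (g (Sup k) - g (Inf k))) < \<eta>"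
    using g \<eta> unfolding abs_cont_on_def by meson
  obtain \<delta>h where \<delta>h: "\<delta>h > 0" and h: "\<And>d. \<lbrakk>d division_of (\<Union>d); \<Union>d \<subseteq> {a..b}; (\<Sum>k\<in>d. Sup k - Inf k) < \<delta>h\<rbrakk>
      \<Longrightarrow> (\<Sum>k\<in>d. norm (h (Sup k) - h (Inf k))) < \<eta>"
    using h \<eta> unfolding abs_cont_on_def by meson
  show "\<exists>\<delta>>0. \<forall>d. d division_of \<Union> d \<and> \<Union> d \<subseteq> {a..b} \<and> (\<Sum>k\<in>d. Sup k - Inf k) < \<delta> \<longrightarrow>
      (\<Sum>k\<in>d. norm (f (Sup k) - f (Inf k))) < \<epsilon>"
  proof (intro exI[of _ "min \<delta>g \<delta>h"] conjI allI impI)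
    fix d assume d: "d division_of \<Union> d \<and> \<Union> d \<subseteq> {a..b} \<and> (\<Sum>k\<in>d. Sup k - Inf k) < min \<delta>g \<delta>h"
    have "(\<Sum>k\<in>d. norm (f (Sup k) - f (Inf k))) \<le>
        (\<Sum>k\<in>d. B * norm (g (Sup k) - g (Inf k)) + B * norm (h (Sup k) - h (Inf k)))"
      using d by (intro sum_mono f division_Sup_Inf) auto
    also have "\<dots> = B * (\<Sum>k\<in>d. norm (g (Sup k) - g (Inf k))) + B * (\<Sum>k\<in>d. norm (h (Sup k) - h (Inf k)))"
      by (simp add: sum.distrib sum_distrib_left)
    also have "\<dots> \<le> B * \<eta> + B * \<eta>"
      using g[of d] h[of d] d B by (intro add_mono mult_left_mono) auto
    also have "\<dots> = 2 * (B + 1) * \<eta> - 2 * \<eta>" by (simp add: algebra_simps)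
    also have "2 * (B + 1) * \<eta> = \<epsilon>" using B by (simp add: \<eta>_def)
    finally have "(\<Sum>k\<in>d. norm (f (Sup k) - f (Inf k))) \<le> \<epsilon> - 2 * \<eta>" .
    also have "\<dots> < \<epsilon>" using \<eta> by simp
    finally show "(\<Sum>k\<in>d. norm (f (Sup k) - f (Inf k))) < \<epsilon>" .
  qed (use \<delta>g \<delta>h in auto)
qed

lemma abs_cont_on_id: "abs_cont_on a b (\<lambda>x::real. x)"
  unfolding abs_cont_on_def
proof (intro allI impI)
  fix \<epsilon> :: real assume "\<epsilon> > 0"
  have "(\<Sum>k\<in>d. norm (Sup k - Inf k)) < \<epsilon>" if "d division_of \<Union> d" "\<Union> d \<subseteq> {a..b}" "(\<Sum>k\<in>d. Sup k - Inf k) < \<epsilon>" for d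
  proof -
    have "(\<Sum>k\<in>d. norm (Sup k - Inf k)) = (\<Sum>k\<in>d. Sup k - Inf k)"
      using division_Sup_Inf[OF that(1,2)] by (intro sum.cong) auto
    with that show ?thesis by simp
  qed
  with \<open>\<epsilon> > 0\<close> show "\<exists>\<delta>>0. \<forall>d. d division_of \<Union> d \<and> \<Union> d \<subseteq> {a..b} \<and> (\<Sum>k\<in>d. Sup k - Inf k) < \<delta> \<longrightarrow>
      (\<Sum>k\<in>d. norm (Sup k - Inf k)) < \<epsilon>" by blast
qed

lemma abs_cont_on_lipschitz:
  fixes f :: "real \<Rightarrow> 'b::real_normed_vector"
  assumes "\<And>x y. \<lbrakk>x \<in> {a..b}; y \<in> {a..b}\<rbrakk> \<Longrightarrow> norm (f y - f x) \<le> B * \<bar>y - x\<bar>" "B \<ge> 0"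
  shows "abs_cont_on a b f"
proof (rule abs_cont_on_dominated[OF abs_cont_on_id abs_cont_on_id \<open>B \<ge> 0\<close>])
  fix x y assume "x \<in> {a..b}" "y \<in> {a..b}"
  with assms(1)[of x y] have "norm (f y - f x) \<le> B * norm (y - x)" by simp
  moreover have "0 \<le> B * norm (y - x)" using assms by simp
  ultimately show "norm (f y - f x) \<le> B * norm (y - x) + B * norm (y - x)" by linarith
qed

lemma abs_cont_on_C1:
  fixes f :: "real \<Rightarrow> real"
  assumes f: "\<And>x. x \<in> {a..b} \<Longrightarrow> (f has_real_derivative f' x) (at x within {a..b})"
    and f': "continuous_on {a..b} f'"
  shows "abs_cont_on a b f"
proof -
  have "bounded (f' ` {a..b})" using f' compact_continuous_image compact_imp_bounded by blast
  then obtain B where B: "\<And>x. x \<in> {a..b} \<Longrightarrow> norm (f' x) \<le> B" "B > 0"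
    unfolding bounded_pos by blast
  show ?thesis
  proof (rule abs_cont_on_lipschitz)
    fix x y assume "x \<in> {a..b}" "y \<in> {a..b}"
    then show "norm (f y - f x) \<le> B * \<bar>y - x\<bar>"
      using field_differentiable_bound[of "{a..b}" f f' B y x] f B by auto
  qed (use B in simp)
qed

lemma abs_cont_on_const: "abs_cont_on a b (\<lambda>x. c)"
  by (rule abs_cont_on_lipschitz[of _ _ _ 0]) auto

lemma abs_cont_on_diff:
  assumes "abs_cont_on a b g" "abs_cont_on a b h"
  shows "abs_cont_on a b (\<lambda>x. g x - h x)"
proof (rule abs_cont_on_dominated[OF assms, of 1])
  fix x y
  have "g y - h y - (g x - h x) = (g y - g x) - (h y - h x)" by simp
  then show "norm (g y - h y - (g x - h x)) \<le> 1 * norm (g y - g x) + 1 * norm (h y - h x)"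
    unfolding mult_1 using norm_triangle_ineq4[of "g y - g x" "h y - h x"] by metis
qed simp

lemma abs_cont_on_bilinear:
  fixes f :: "real \<Rightarrow> 'c::real_normed_vector" and g :: "real \<Rightarrow> 'd::real_normed_vector"
  assumes "bounded_bilinear p" and f: "abs_cont_on a b f" and g: "abs_cont_on a b g"
  shows "abs_cont_on a b (\<lambda>x. p (f x) (g x))"
proof -
  interpret bounded_bilinear p by fact
  obtain K where K: "\<And>u v. norm (p u v) \<le> norm u * norm v * K" "K \<ge> 0"
    using nonneg_bounded by blast
  have "bounded (f ` {a..b})" "bounded (g ` {a..b})"
    using abs_cont_on_imp_continuous_on[OF f] abs_cont_on_imp_continuous_on[OF g]
      compact_continuous_image compact_imp_bounded by blast+
  then obtain B C where B: "\<And>x. x \<in> {a..b} \<Longrightarrow> norm (f x) \<le> B" "B > 0"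
    and C: "\<And>x. x \<in> {a..b} \<Longrightarrow> norm (g x) \<le> C" "C > 0"
    unfolding bounded_pos by blast
  show ?thesis
  proof (rule abs_cont_on_dominated[OF f g, of "(B + C) * K"])
    fix x y assume xy: "x \<in> {a..b}" "y \<in> {a..b}"
    have "p (f y) (g y) - p (f x) (g x) = p (f y - f x) (g y) + p (f x) (g y - g x)"
      by (simp add: diff_left diff_right)
    then have "norm (p (f y) (g y) - p (f x) (g x)) \<le> norm (f y - f x) * norm (g y) * K + norm (f x) * norm (g y - g x) * K"
      by (smt (verit) K(1) norm_triangle_ineq)
    also have "\<dots> \<le> norm (f y - f x) * (B + C) * K + (B + C) * norm (g y - g x) * K"
    proof -
      have "norm (g y) \<le> B + C" "norm (f x) \<le> B + C" using B(1)[OF xy(1)] C(1)[OF xy(2)] B(2) C(2) by auto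
      then show ?thesis using K(2) by (intro add_mono mult_right_mono mult_left_mono) auto
    qed
    finally show "norm (p (f y) (g y) - p (f x) (g x)) \<le> (B + C) * K * norm (f y - f x) + (B + C) * K * norm (g y - g x)"
      by (simp add: algebra_simps)
  qed (use B C K in simp)
qed

text \<open>A gauge argument. Where the derivative exists, the usual straddle estimate applies.
  Intervals tagged in the exceptional null set \<open>N\<close> are forced into an open set of small
  measure, so their total length is small and absolute continuity bounds the sum of the increments
  of \<open>f\<close> over them.\<close>

theorem abs_cont_on_fundamental:
  fixes f :: "real \<Rightarrow> 'b::euclidean_space"
  assumes "a \<le> b" and ac: "abs_cont_on a b f"
    and deriv: "AE x in lebesgue_on {a..b}. (f has_vector_derivative g x) (at x within {a..b})"
  shows "(g has_integral (f b - f a)) {a..b}"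
proof -
  define N where "N = {x \<in> {a..b}. \<not> (f has_vector_derivative g x) (at x within {a..b})}"
  have "N \<in> null_sets (lebesgue_on {a..b})"
  proof -
    have "{x \<in> space (lebesgue_on {a..b}). \<not> (f has_vector_derivative g x) (at x within {a..b})} = N"
      by (auto simp: N_def)
    moreover obtain M where "M \<in> null_sets (lebesgue_on {a..b})" "N \<subseteq> M"
      using deriv unfolding eventually_ae_filter N_def by auto
    ultimately have "M \<in> null_sets lebesgue"
      by (simp add: null_sets_restrict_space)
    then have "N \<in> null_sets lebesgue" using \<open>N \<subseteq> M\<close>
      using null_sets_completion_subset by blast
    then show ?thesis by (auto simp: null_sets_restrict_space N_def)
  qed
  then have negN: "negligible N"
    by (simp add: negligible_iff_null_sets null_sets_restrict_space)
  \<comment> \<open>With value \<open>0\<close> on \<open>N\<close>, an interval tagged there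
    contributes nothing but the increment of \<open>f\<close>.\<close>
  define f' where "f' = (\<lambda>x. if x \<in> N then 0 else g x)"
  have "(f' has_integral (f b - f a)) {a..b}"
    unfolding has_integral_factor_content box_real[symmetric]
  proof safe
    fix e :: real
    assume "e > 0"
    show "\<exists>d. gauge d \<and> (\<forall>p. p tagged_division_of (cbox a b) \<and> d fine p \<longrightarrow>
      norm ((\<Sum>(x, k)\<in>p. measure lborel k *\<^sub>R f' x) - (f b - f a)) \<le> e * measure lborel (cbox a b))"
    proof (cases "a < b")
      \<comment> \<open>The error budget is proportional to \<open>b - a\<close>, hence zero here;
        in the other case it is positive and serves as the epsilon of absolute continuity.\<close>
      case False
      then have "a = b" using \<open>a \<le> b\<close> by simp
      have "norm ((\<Sum>(x, k)\<in>p. measure lborel k *\<^sub>R f' x) - (f b - f a)) \<le> e * measure lborel (cbox a b)"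
        if p: "p tagged_division_of (cbox a b)" for p
      proof -
        have "(\<Sum>(x, k)\<in>p. measure lborel k *\<^sub>R f' x) = 0"
          by (rule sum_content_null[OF _ p]) (use \<open>a = b\<close> in simp)
        then show ?thesis using \<open>a = b\<close> by simp
      qed
      then show ?thesis by (intro exI[of _ "\<lambda>x. ball x 1"]) (auto intro: gauge_ball)
    next
      case True
      define e2 where "e2 = e / 2"
      have "e2 > 0" using \<open>e > 0\<close> by (simp add: e2_def)
      have "\<forall>x. \<exists>d>0. x \<in> {a..b} - N \<longrightarrow>
         (\<forall>y\<in>{a..b}. norm (y-x) < d \<longrightarrow> norm (f y - f x - (y-x) *\<^sub>R f' x) \<le> e2 * norm (y-x))"
      proof
        fix x show "\<exists>d>0. x \<in> {a..b} - N \<longrightarrow>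
         (\<forall>y\<in>{a..b}. norm (y-x) < d \<longrightarrow> norm (f y - f x - (y-x) *\<^sub>R f' x) \<le> e2 * norm (y-x))"
        proof (cases "x \<in> {a..b} - N")
          case True
          then have "(f has_vector_derivative f' x) (at x within {a..b})" by (auto simp: f'_def N_def)
          then show ?thesis using \<open>e2 > 0\<close>
            unfolding has_vector_derivative_def has_derivative_within_alt by blast
        qed (auto intro: exI[of _ 1])
      qed
      then obtain d where d: "\<And>x. 0 < d x"
                 "\<And>x y. \<lbrakk>x \<in> {a..b} - N; y \<in> {a..b}; norm (y-x) < d x\<rbrakk>
                        \<Longrightarrow> norm (f y - f x - (y-x) *\<^sub>R f' x) \<le> e2 * norm (y-x)"
        by metis
      have "e2 * (b - a) > 0" using \<open>e2 > 0\<close> True by simp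
      then obtain \<delta> where "\<delta> > 0" and \<delta>: "\<And>d. \<lbrakk>d division_of (\<Union>d); \<Union>d \<subseteq> {a..b}; (\<Sum>k\<in>d. Sup k - Inf k) < \<delta>\<rbrakk>
          \<Longrightarrow> (\<Sum>k\<in>d. norm (f (Sup k) - f (Inf k))) < e2 * (b - a)"
        using ac unfolding abs_cont_on_def by meson
      obtain U where "open U" "N \<subseteq> U" "U - N \<in> lmeasurable" "emeasure lebesgue (U - N) < ennreal \<delta>"
        using sets_lebesgue_outer_open[of N \<delta>] \<open>\<delta> > 0\<close> negN negligible_imp_sets by blast
      have Um: "U \<in> lmeasurable" "measure lebesgue U < \<delta>"
      proof -
        have eq: "U = (U - N) \<union> N" using \<open>N \<subseteq> U\<close> by auto
        have "N \<in> lmeasurable" using negN by (simp add: negligible_imp_measurable)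
        then show "U \<in> lmeasurable"
          using \<open>U - N \<in> lmeasurable\<close> eq by (metis fmeasurable.Un)
        have "emeasure lebesgue ((U - N) \<union> N) = emeasure lebesgue (U - N)"
          using negN \<open>U - N \<in> lmeasurable\<close>
          by (intro emeasure_Un_null_set) (auto simp: negligible_iff_null_sets)
        with \<open>emeasure lebesgue (U - N) < ennreal \<delta>\<close> have "emeasure lebesgue U < ennreal \<delta>"
          using eq by simp
        with \<open>U \<in> lmeasurable\<close> show "measure lebesgue U < \<delta>"
          using \<open>\<delta> > 0\<close> by (simp add: emeasure_eq_measure2 ennreal_less_iff)
      qed
      \<comment> \<open>Good tags get the ball of the derivative estimate, bad tags the thin open
        set \<open>U\<close>. Each kind of tag may spend \<open>e2 * (b - a)\<close>, that is, half
        of the permitted error.\<close>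
      define \<gamma> where "\<gamma> = (\<lambda>x. if x \<in> N then U else ball x (d x))"
      show ?thesis
      proof (intro exI[of _ \<gamma>] conjI allI impI)
        show "gauge \<gamma>"
          unfolding gauge_def \<gamma>_def using \<open>open U\<close> \<open>N \<subseteq> U\<close> d(1) by auto
      next
        fix p
        assume "p tagged_division_of cbox a b \<and> \<gamma> fine p"
        then have ptag: "p tagged_division_of cbox a b" and finep: "\<gamma> fine p" by auto
        have ba: "b - a = (\<Sum>(x,K)\<in>p. Sup K - Inf K)" "f b - f a = (\<Sum>(x,K)\<in>p. f(Sup K) - f(Inf K))"
          using additive_tagged_division_1[where f= "\<lambda>x. x"] additive_tagged_division_1[where f= f]
            \<open>a \<le> b\<close> ptag by auto
        have finp: "finite p" using tagged_division_ofD(1)[OF ptag] .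
        define q where "q = {(x, K) \<in> p. x \<in> N}"
        have "q \<subseteq> p" by (auto simp: q_def)
        have interv: "\<exists>u v. K = {u..v} \<and> u \<le> v \<and> {u..v} \<subseteq> {a..b} \<and> x \<in> {u..v}" if xK: "(x, K) \<in> p" for x K
        proof -
          obtain u v where "K = cbox u v" using tagged_division_ofD(4)[OF ptag xK] by blast
          moreover have "x \<in> K" "K \<subseteq> cbox a b" using tagged_division_ofD(2,3)[OF ptag xK] by auto
          ultimately show ?thesis by (intro exI[of _ u] exI[of _ v]) auto
        qed
        have part: "q tagged_partial_division_of cbox a b"
          using ptag unfolding tagged_division_of_def
          by (rule conjE) (rule tagged_partial_division_subset[OF _ \<open>q \<subseteq> p\<close>])
        define D where "D = snd ` q"
        have D: "D division_of \<Union>D"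
          unfolding D_def using part by (rule partial_division_of_tagged_division)
        have ne: "K \<noteq> {}" if "K \<in> D" for K using division_ofD(3)[OF D that] .
        \<comment> \<open>Several tags can share a degenerate interval, so replacing the sum over
          tags by a sum over intervals requires zero contributions from intervals without interior.
          The guard supplies this for the empty set, whose \<open>Sup\<close> and \<open>Inf\<close>
          are unspecified.\<close>
        have "(\<Sum>(x,K)\<in>q. norm (f (Sup K) - f (Inf K))) = (\<Sum>(x,K)\<in>q. if K = {} then 0 else norm (f (Sup K) - f (Inf K)))"
          using ne by (intro sum.cong) (force simp: D_def)+
        also have "\<dots> = (\<Sum>k\<in>D. if k = {} then 0 else norm (f (Sup k) - f (Inf k)))"
          unfolding D_def
          by (rule sum.over_tagged_division_lemma[OF tagged_partial_division_of_Union_self[OF part]]) auto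
        also have "\<dots> = (\<Sum>k\<in>D. norm (f (Sup k) - f (Inf k)))"
          using ne by (intro sum.cong) auto
        finally have img: "(\<Sum>(x,K)\<in>q. norm (f (Sup K) - f (Inf K))) = (\<Sum>k\<in>D. norm (f (Sup k) - f (Inf k)))" .
        have "D \<subseteq> snd ` p" using \<open>q \<subseteq> p\<close> D_def by auto
        have DU: "\<Union>D \<subseteq> U"
        proof
          fix z assume "z \<in> \<Union>D"
          then obtain x K where "(x, K) \<in> q" "z \<in> K" by (auto simp: D_def)
          then have "(x, K) \<in> p" "x \<in> N" by (auto simp: q_def)
          with fineD[OF finep] have "K \<subseteq> U" unfolding \<gamma>_def by force
          with \<open>z \<in> K\<close> show "z \<in> U" by blast
        qed
        have Dab: "\<Union>D \<subseteq> {a..b}"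
        proof
          fix z assume "z \<in> \<Union>D"
          then obtain x K where "(x, K) \<in> p" "z \<in> K" using \<open>D \<subseteq> snd ` p\<close> by auto
          with interv[of x K] show "z \<in> {a..b}" by auto
        qed
        have "(\<Sum>k\<in>D. Sup k - Inf k) = (\<Sum>k\<in>D. measure lebesgue k)"
        proof (rule sum.cong[OF refl])
          fix k assume "k \<in> D"
          then obtain x where "(x, k) \<in> p" using \<open>D \<subseteq> snd ` p\<close> by auto
          from interv[OF this] obtain u v where "k = {u..v}" "u \<le> v" by blast
          then show "Sup k - Inf k = measure lebesgue k" by simp
        qed
        also have "\<dots> = measure lebesgue (\<Union>D)"
          using content_division[OF D] by simp
        also have "\<dots> \<le> measure lebesgue U"
          using DU Um(1) by (intro measure_mono_fmeasurable) (auto intro!: lmeasurable_division[OF D] fmeasurableD)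
        also have "\<dots> < \<delta>" by (rule Um)
        finally have "(\<Sum>k\<in>D. norm (f (Sup k) - f (Inf k))) < e2 * (b - a)"
          by (rule \<delta>[OF D Dab])
        then have bad: "(\<Sum>(x,K)\<in>q. norm (f (Sup K) - f (Inf K))) < e2 * (b - a)" unfolding img .
        have each: "norm (measure lborel K *\<^sub>R f' x - (f (Sup K) - f (Inf K))) \<le>
            e2 * (Sup K - Inf K) + (if x \<in> N then norm (f (Sup K) - f (Inf K)) else 0)"
          if xK: "(x, K) \<in> p" for x K
        proof -
          obtain u v where K: "K = {u..v}" and "u \<le> v" "{u..v} \<subseteq> {a..b}" "x \<in> {u..v}"
            using interv[OF xK] by blast
          have uv: "u \<in> {a..b}" "v \<in> {a..b}" "x \<in> {a..b}"
            using \<open>u \<le> v\<close> \<open>{u..v} \<subseteq> {a..b}\<close> \<open>x \<in> {u..v}\<close> by auto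
          show ?thesis
          proof (cases "x \<in> N")
            case True
            moreover have "0 \<le> e2 * (v - u)" using \<open>u \<le> v\<close> \<open>e2 > 0\<close> by simp
            ultimately show ?thesis using K \<open>u \<le> v\<close> by (simp add: f'_def norm_minus_commute)
          next
            case False
            have ball: "\<forall>y\<in>K. y \<in> ball x (d x)"
              using fineD[OF finep xK] False unfolding \<gamma>_def by auto
            then have du: "norm (u - x) < d x" "norm (v - x) < d x"
              using K \<open>u \<le> v\<close> by (auto simp: dist_real_def abs_minus_commute)
            have "norm ((v - u) *\<^sub>R f' x - (f v - f u)) = norm (f u - f x - (u - x) *\<^sub>R f' x - (f v - f x - (v - x) *\<^sub>R f' x))"
              by (auto simp: algebra_simps)
            also have "\<dots> \<le> norm (f u - f x - (u - x) *\<^sub>R f' x) + norm (f v - f x - (v - x) *\<^sub>R f' x)"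
              by (rule norm_triangle_ineq4)
            also have "\<dots> \<le> e2 * norm (u - x) + e2 * norm (v - x)"
              using du uv False by (intro add_mono d) auto
            also have "\<dots> = e2 * (v - u)"
              using \<open>x \<in> {u..v}\<close> by (simp add: algebra_simps)
            finally show ?thesis using K \<open>u \<le> v\<close> False by simp
          qed
        qed
        have "norm (\<Sum>(x, K) \<in> p. (measure lborel K *\<^sub>R f' x) - (f (Sup K) - f (Inf K)))
          \<le> (\<Sum>(x, K)\<in>p. e2 * (Sup K - Inf K) + (if x \<in> N then norm (f (Sup K) - f (Inf K)) else 0))"
        proof (rule sum_norm_le, safe)
          fix x K assume "(x, K) \<in> p"
          from each[OF this] show "norm (measure lborel K *\<^sub>R f' x - (f (Sup K) - f (Inf K))) \<le>
            e2 * (Sup K - Inf K) + (if x \<in> N then norm (f (Sup K) - f (Inf K)) else 0)" .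
        qed
        also have "\<dots> = e2 * (b - a) + (\<Sum>(x, K)\<in>p. if x \<in> N then norm (f (Sup K) - f (Inf K)) else 0)"
          unfolding ba(1) by (simp add: split_def sum.distrib sum_distrib_left)
        also have "(\<Sum>(x, K)\<in>p. if x \<in> N then norm (f (Sup K) - f (Inf K)) else 0) = (\<Sum>(x,K)\<in>q. norm (f (Sup K) - f (Inf K)))"
          unfolding q_def split_def using finp by (subst sum.inter_filter[symmetric]) (auto intro!: sum.cong)
        also have "e2 * (b - a) + \<dots> \<le> e * (b - a)"
          using bad by (simp add: e2_def)
        finally show "norm ((\<Sum>(x, k)\<in>p. measure lborel k *\<^sub>R f' x) - (f b - f a)) \<le> e * measure lborel (cbox a b)"
          using \<open>a \<le> b\<close> by (simp add: ba(2) split_def sum_subtractf)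
      qed
    qed
  qed
  then show ?thesis
    by (rule has_integral_spike[OF negN, rotated]) (auto simp: f'_def)
qed

section \<open>Square integrable functions and Fubini's theorem\<close>

text \<open>Passage from completed measure to \<open>lborel\<close>, where almost-everywhere
  statements on a product can be sliced.\<close>

lemma AE_lebesgue_on_iff:
  "S \<in> sets lebesgue \<Longrightarrow> (AE x in lebesgue_on S. P x) \<longleftrightarrow> (AE x in lborel. x \<in> S \<longrightarrow> P x)"
  by (subst AE_restrict_space_iff) (auto simp: AE_completion_iff)

lemma AE_lborel_pair_swap:
  assumes "AE z in (lborel :: (real \<times> real) measure). P z"
  shows "AE t in lborel. AE x in lborel. P (x, t)"
proof -
  have "AE z in lborel \<Otimes>\<^sub>M lborel. P z" using assms unfolding lborel_prod .
  then have "AE z in distr (lborel \<Otimes>\<^sub>M lborel) (lborel \<Otimes>\<^sub>M lborel) (\<lambda>(x, y). (y, x)). P z"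
    unfolding lborel_pair.distr_pair_swap[symmetric] .
  then have "AE z in lborel \<Otimes>\<^sub>M lborel. P (case z of (x, y) \<Rightarrow> (y, x))"
    by (rule AE_distrD[rotated]) (rule measurable_pair_swap')
  from lborel_pair.AE_pair[OF this] show ?thesis by simp
qed

lemma AE_lebesgue_on_Times:
  fixes A B :: "real set"
  assumes [simp]: "A \<in> sets borel" "B \<in> sets borel"
    and "AE z in lebesgue_on (A \<times> B). P z"
  shows "AE t in lebesgue_on B. AE x in lebesgue_on A. P (x, t)"
proof -
  have AB: "A \<times> B \<in> sets (borel :: (real \<times> real) measure)"
    using assms by (simp add: borel_prod[symmetric])
  then have "AE z in lborel. z \<in> A \<times> B \<longrightarrow> P z"
    using assms(3) by (simp add: AE_lebesgue_on_iff)
  from AE_lborel_pair_swap[OF this]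
  have "AE t in lborel. t \<in> B \<longrightarrow> (AE x in lborel. x \<in> A \<longrightarrow> P (x, t))"
    by eventually_elim (auto elim: eventually_mono)
  then show ?thesis by (simp add: AE_lebesgue_on_iff)
qed

lemma integrable_lborel_AE_lebesgue:
  fixes f g :: "'a::euclidean_space \<Rightarrow> real"
  assumes "AE x in lborel. f x = g x" "integrable lborel g"
  shows "integrable lebesgue f" "integral\<^sup>L lebesgue f = integral\<^sup>L lborel g"
proof -
  have g: "integrable lebesgue g" using assms integrable_completion[of g lborel] by auto
  have ae: "AE x in lebesgue. g x = f x" using assms(1) by (auto simp: AE_completion_iff elim: eventually_mono)
  have f: "f \<in> borel_measurable lebesgue"
    by (rule borel_measurable_AE[OF borel_measurable_integrable[OF g] ae])
  show "integrable lebesgue f"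
    using g f ae by (rule integrable_cong_AE_imp)
  have "integral\<^sup>L lebesgue f = integral\<^sup>L lebesgue g"
    using g ae f by (intro integral_cong_AE) (auto elim: eventually_mono)
  then show "integral\<^sup>L lebesgue f = integral\<^sup>L lborel g"
    using assms by (simp add: integral_completion)
qed

text \<open>Lebesgue measure on the plane is the completion of a product measure, so Fubini is
  applied to a representative \<open>g\<close> that is integrable for the product of the
  \<open>lborel\<close> measures. On almost every slice it agrees with \<open>f\<close>, which
  transfers integrability and the values of the integrals.\<close>

lemma lebesgue_Fubini_aux:
  fixes f :: "real \<times> real \<Rightarrow> real" and A B :: "real set"
  assumes [simp]: "A \<in> sets borel" "B \<in> sets borel"
    and g: "integrable (lborel \<Otimes>\<^sub>M lborel) g"
    and fg: "AE x in lborel. AE t in lborel. (if x \<in> A \<and> t \<in> B then f (x, t) else 0) = g (x, t)"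
  shows "AE x in lebesgue_on A. integrable (lebesgue_on B) (\<lambda>t. f (x, t))"
    and "integrable (lebesgue_on A) (\<lambda>x. \<integral>t. f (x, t) \<partial>lebesgue_on B)"
    and "(\<integral>x. (\<integral>t. f (x, t) \<partial>lebesgue_on B) \<partial>lebesgue_on A) = integral\<^sup>L (lborel \<Otimes>\<^sub>M lborel) g"
proof -
  have *: "AE x in lborel. x \<in> A \<longrightarrow> integrable (lebesgue_on B) (\<lambda>t. f (x, t)) \<and>
      (\<integral>t. f (x, t) \<partial>lebesgue_on B) = (\<integral>t. g (x, t) \<partial>lborel)"
    using fg lborel_pair.AE_integrable_fst'[OF g]
  proof eventually_elim
    case (elim x)
    show ?case
    proof
      assume "x \<in> A"
      with elim have "AE t in lborel. (if t \<in> B then f (x, t) else 0) = g (x, t)" by simp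
      from integrable_lborel_AE_lebesgue[OF this elim(2)]
      show "integrable (lebesgue_on B) (\<lambda>t. f (x, t)) \<and>
        (\<integral>t. f (x, t) \<partial>lebesgue_on B) = (\<integral>t. g (x, t) \<partial>lborel)"
        by (simp add: Lebesgue_Measure.integrable_restrict_UNIV Lebesgue_Measure.integral_restrict_UNIV)
    qed
  qed
  then show "AE x in lebesgue_on A. integrable (lebesgue_on B) (\<lambda>t. f (x, t))"
    by (auto simp: AE_lebesgue_on_iff elim: eventually_mono)
  have "AE x in lborel. (if x \<in> A then (\<integral>t. f (x, t) \<partial>lebesgue_on B) else 0) = (\<integral>t. g (x, t) \<partial>lborel)"
    using * fg
  proof eventually_elim
    case (elim x)
    show ?case
    proof (cases "x \<in> A")
      case False
      then have "AE t in lborel. 0 = g (x, t)" using elim(2) by simp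
      then have "AE t in lborel. g (x, t) = 0" by (auto elim: eventually_mono)
      then have "(\<integral>t. g (x, t) \<partial>lborel) = 0" by (rule integral_eq_zero_AE)
      then show ?thesis using False by simp
    qed (use elim in simp)
  qed
  from integrable_lborel_AE_lebesgue[OF this lborel_pair.integrable_fst'[OF g]]
  show "integrable (lebesgue_on A) (\<lambda>x. \<integral>t. f (x, t) \<partial>lebesgue_on B)"
    "(\<integral>x. (\<integral>t. f (x, t) \<partial>lebesgue_on B) \<partial>lebesgue_on A) = integral\<^sup>L (lborel \<Otimes>\<^sub>M lborel) g"
    by (simp_all add: Lebesgue_Measure.integrable_restrict_UNIV Lebesgue_Measure.integral_restrict_UNIV lborel_pair.integral_fst'[OF g])
qed

lemma lebesgue_Fubini:
  fixes f :: "real \<times> real \<Rightarrow> real" and A B :: "real set"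
  assumes [simp]: "A \<in> sets borel" "B \<in> sets borel"
    and f: "integrable (lebesgue_on (A \<times> B)) f"
  shows "AE x in lebesgue_on A. integrable (lebesgue_on B) (\<lambda>t. f (x, t))"
    and "AE t in lebesgue_on B. integrable (lebesgue_on A) (\<lambda>x. f (x, t))"
    and "integrable (lebesgue_on A) (\<lambda>x. \<integral>t. f (x, t) \<partial>lebesgue_on B)"
    and "integrable (lebesgue_on B) (\<lambda>t. \<integral>x. f (x, t) \<partial>lebesgue_on A)"
    and "(\<integral>x. (\<integral>t. f (x, t) \<partial>lebesgue_on B) \<partial>lebesgue_on A) = (\<integral>t. (\<integral>x. f (x, t) \<partial>lebesgue_on A) \<partial>lebesgue_on B)"
proof -
  have AB: "A \<times> B \<in> sets (borel :: (real \<times> real) measure)"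
    by (simp add: borel_prod[symmetric])
  define f0 where "f0 = (\<lambda>z. if z \<in> A \<times> B then f z else 0)"
  have f0: "integrable lebesgue f0"
    using f AB by (simp add: f0_def Lebesgue_Measure.integrable_restrict_UNIV)
  \<comment> \<open>A Borel representative of the zero extension; the almost-everywhere equality is
    then sliced in both variables to feed the auxiliary lemma twice.\<close>
  obtain g where g: "g \<in> borel_measurable lborel" and fg: "AE z in lborel. f0 z = g z"
    using completion_ex_borel_measurable_real[OF borel_measurable_integrable[OF f0]] by auto
  have "AE z in lebesgue. f0 z = g z" using fg by (simp add: AE_completion_iff)
  then have "integrable lebesgue g"
    using f0 g by (subst integrable_cong_AE[of g lebesgue f0]) (auto elim: eventually_mono intro: measurable_completion)
  then have gi: "integrable (lborel \<Otimes>\<^sub>M lborel) g"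
    using g integrable_completion[of g lborel] by (simp add: lborel_prod)
  have fg1: "AE x in lborel. AE t in lborel. (if x \<in> A \<and> t \<in> B then f (x, t) else 0) = g (x, t)"
    using lborel_pair.AE_pair[OF fg[folded lborel_prod]] unfolding f0_def by simp
  have fg2: "AE t in lborel. AE x in lborel. (if t \<in> B \<and> x \<in> A then f (x, t) else 0) = g (x, t)"
    using AE_lborel_pair_swap[OF fg] by (simp add: f0_def conj_commute)
  have gs: "integrable (lborel \<Otimes>\<^sub>M lborel) (\<lambda>(t, x). g (x, t))"
    using lborel_pair.integrable_product_swap[OF gi] .
  have eq: "integral\<^sup>L (lborel \<Otimes>\<^sub>M lborel) (\<lambda>(t, x). g (x, t)) = integral\<^sup>L (lborel \<Otimes>\<^sub>M lborel) g"
    using lborel_pair.integral_product_swap[of g] gi by simp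
  note 1 = lebesgue_Fubini_aux[OF assms(1,2) gi fg1]
  have fg2': "AE t in lborel. AE x in lborel. (if t \<in> B \<and> x \<in> A then (\<lambda>(t, x). f (x, t)) (t, x) else 0) = (\<lambda>(t, x). g (x, t)) (t, x)"
    using fg2 unfolding split_conv .
  note 2 = lebesgue_Fubini_aux[OF assms(2,1) gs fg2', unfolded split_conv]
  show "AE x in lebesgue_on A. integrable (lebesgue_on B) (\<lambda>t. f (x, t))"
    "AE t in lebesgue_on B. integrable (lebesgue_on A) (\<lambda>x. f (x, t))"
    "integrable (lebesgue_on A) (\<lambda>x. \<integral>t. f (x, t) \<partial>lebesgue_on B)"
    "integrable (lebesgue_on B) (\<lambda>t. \<integral>x. f (x, t) \<partial>lebesgue_on A)"
    using 1 2 by auto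
  show "(\<integral>x. (\<integral>t. f (x, t) \<partial>lebesgue_on B) \<partial>lebesgue_on A) = (\<integral>t. (\<integral>x. f (x, t) \<partial>lebesgue_on A) \<partial>lebesgue_on B)"
    using 1(3) 2(3) eq by simp
qed

lemma L2_on_inner:
  assumes "L2_on S f" "L2_on S g"
  shows "integrable (lebesgue_on S) (\<lambda>x. f x \<bullet> g x)"
proof (rule Bochner_Integration.integrable_bound)
  show "integrable (lebesgue_on S) (\<lambda>x. (norm (f x))\<^sup>2 + (norm (g x))\<^sup>2)"
    using assms by (auto simp: L2_on_def)
  show "(\<lambda>x. f x \<bullet> g x) \<in> borel_measurable (lebesgue_on S)"
    using assms by (auto simp: L2_on_def)
  have "norm (f x \<bullet> g x) \<le> norm ((norm (f x))\<^sup>2 + (norm (g x))\<^sup>2)" for x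
  proof -
    have "\<bar>f x \<bullet> g x\<bar> \<le> norm (f x) * norm (g x)" by (rule Cauchy_Schwarz_ineq2)
    also have "\<dots> \<le> (norm (f x))\<^sup>2 + (norm (g x))\<^sup>2"
      using sum_squares_bound[of "norm (f x)" "norm (g x)"]
        mult_nonneg_nonneg[OF norm_ge_zero[of "f x"] norm_ge_zero[of "g x"]] by linarith
    finally show ?thesis by simp
  qed
  then show "AE x in lebesgue_on S. norm (f x \<bullet> g x) \<le> norm ((norm (f x))\<^sup>2 + (norm (g x))\<^sup>2)" by simp
qed

text \<open>Variable coefficients accommodate exponential weights in time; constant ones give the
  vector space operations.\<close>

lemma L2_on_bounded_combination:
  fixes f g :: "'a::euclidean_space \<Rightarrow> 'b::euclidean_space"
  assumes "L2_on S f" "L2_on S g"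
    and c[measurable]: "c \<in> borel_measurable (lebesgue_on S)" and d[measurable]: "d \<in> borel_measurable (lebesgue_on S)"
    and B: "\<And>x. x \<in> S \<Longrightarrow> \<bar>c x\<bar> \<le> B" "\<And>x. x \<in> S \<Longrightarrow> \<bar>d x\<bar> \<le> B"
  shows "L2_on S (\<lambda>x. c x *\<^sub>R f x + d x *\<^sub>R g x)"
proof -
  have [measurable]: "f \<in> borel_measurable (lebesgue_on S)" "g \<in> borel_measurable (lebesgue_on S)"
    and i: "integrable (lebesgue_on S) (\<lambda>x. (norm (f x))\<^sup>2)" "integrable (lebesgue_on S) (\<lambda>x. (norm (g x))\<^sup>2)"
    using assms by (auto simp: L2_on_def)
  have "integrable (lebesgue_on S) (\<lambda>x. (norm (c x *\<^sub>R f x + d x *\<^sub>R g x))\<^sup>2)"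
  proof (rule Bochner_Integration.integrable_bound)
    show "integrable (lebesgue_on S) (\<lambda>x. 2 * B\<^sup>2 * (norm (f x))\<^sup>2 + 2 * B\<^sup>2 * (norm (g x))\<^sup>2)"
      using i by (intro Bochner_Integration.integrable_add integrable_mult_right)
    have "(norm (c x *\<^sub>R f x + d x *\<^sub>R g x))\<^sup>2 \<le> 2 * B\<^sup>2 * (norm (f x))\<^sup>2 + 2 * B\<^sup>2 * (norm (g x))\<^sup>2" if "x \<in> S" for x
    proof -
      have "norm (c x *\<^sub>R f x + d x *\<^sub>R g x) \<le> \<bar>c x\<bar> * norm (f x) + \<bar>d x\<bar> * norm (g x)"
        by (metis norm_scaleR norm_triangle_ineq)
      also have "\<dots> \<le> B * norm (f x) + B * norm (g x)" using B that by (intro add_mono mult_right_mono) auto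
      finally have "(norm (c x *\<^sub>R f x + d x *\<^sub>R g x))\<^sup>2 \<le> (B * norm (f x) + B * norm (g x))\<^sup>2"
        by (intro power_mono) auto
      also have "\<dots> \<le> 2 * (B * norm (f x))\<^sup>2 + 2 * (B * norm (g x))\<^sup>2"
        using zero_le_power2[of "B * norm (f x) - B * norm (g x)"] unfolding power2_diff power2_sum by simp
      finally show ?thesis by (simp add: power_mult_distrib)
    qed
    then show "AE x in lebesgue_on S. norm ((norm (c x *\<^sub>R f x + d x *\<^sub>R g x))\<^sup>2) \<le>
        norm (2 * B\<^sup>2 * (norm (f x))\<^sup>2 + 2 * B\<^sup>2 * (norm (g x))\<^sup>2)"
      by (intro AE_I2) simp
  qed measurable
  then show ?thesis by (simp add: L2_on_def)
qed

lemma L2_on_combination: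
  fixes f g :: "'a::euclidean_space \<Rightarrow> 'b::euclidean_space"
  assumes "L2_on S f" "L2_on S g"
  shows "L2_on S (\<lambda>x. c *\<^sub>R f x + d *\<^sub>R g x)"
  by (rule L2_on_bounded_combination[OF assms, of _ _ "max \<bar>c\<bar> \<bar>d\<bar>"]) auto

lemma L2_on_add: "L2_on S f \<Longrightarrow> L2_on S g \<Longrightarrow> L2_on S (\<lambda>x. f x + g x)"
  and L2_on_diff: "L2_on S f \<Longrightarrow> L2_on S g \<Longrightarrow> L2_on S (\<lambda>x. f x - g x)"
  and L2_on_scaleR: "L2_on S f \<Longrightarrow> L2_on S (\<lambda>x. c *\<^sub>R f x)"
  using L2_on_combination[of S f g 1 1] L2_on_combination[of S f g 1 "-1"] L2_on_combination[of S f f c 0] by simp_all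

lemma L2_on_continuous:
  fixes f :: "'a::euclidean_space \<Rightarrow> 'b::euclidean_space"
  assumes "compact S" "continuous_on S f"
  shows "L2_on S f"
proof -
  have S: "S \<in> sets lebesgue" using assms by (simp add: compact_imp_closed)
  have "continuous_on S (\<lambda>x. (norm (f x))\<^sup>2)" using assms by (intro continuous_intros)
  then have "set_integrable lborel S (\<lambda>x. (norm (f x))\<^sup>2)"
    using assms unfolding set_integrable_def by (intro borel_integrable_compact)
  then have "integrable (lebesgue_on S) (\<lambda>x. (norm (f x))\<^sup>2)"
    using S assms by (simp add: integrable_restrict_space set_integrable_def integrable_completion compact_imp_closed)
  then show ?thesis
    using S assms by (simp add: L2_on_def continuous_imp_measurable_on_sets_lebesgue)
qed

lemma L2_on_subset:
  assumes "L2_on S f" "T \<subseteq> S" "T \<in> sets lebesgue" "S \<in> sets lebesgue"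
  shows "L2_on T f"
  using assms set_integrable_subset[of lebesgue S "\<lambda>x. (norm (f x))\<^sup>2" T] unfolding L2_on_def set_integrable_def
  by (auto simp: integrable_restrict_space intro: measurable_restrict_mono)

lemma L2_on_imp_integrable:
  assumes "L2_on S f" "S \<in> lmeasurable"
  shows "integrable (lebesgue_on S) f"
proof (rule Bochner_Integration.integrable_bound)
  interpret finite_measure "lebesgue_on S" using assms by (intro finite_measure_lebesgue_on)
  show "integrable (lebesgue_on S) (\<lambda>x. 1 + (norm (f x))\<^sup>2)"
    using assms by (auto simp: L2_on_def)
  show "f \<in> borel_measurable (lebesgue_on S)" using assms by (auto simp: L2_on_def)
  have "norm (f x) \<le> norm (1 + (norm (f x))\<^sup>2)" for x
  proof -
    have "2 * norm (f x) \<le> 1 + (norm (f x))\<^sup>2"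
      using sum_squares_bound[of 1 "norm (f x)"] by simp
    then have "norm (f x) \<le> 1 + (norm (f x))\<^sup>2" using norm_ge_zero[of "f x"] by linarith
    then show ?thesis by simp
  qed
  then show "AE x in lebesgue_on S. norm (f x) \<le> norm (1 + (norm (f x))\<^sup>2)" by simp
qed

text \<open>Measurability of \<open>g\<close> comes for free from the completeness of Lebesgue
  measure.\<close>

lemma L2_on_cong_AE:
  assumes "L2_on S f" "AE x in lebesgue_on S. f x = g x" "S \<in> sets lebesgue"
  shows "L2_on S g"
proof -
  have ae: "AE x in lebesgue. (if x \<in> S then f x else 0) = (if x \<in> S then g x else 0)"
    using assms(2,3) by (auto simp: AE_restrict_space_iff elim: eventually_mono)
  have "(\<lambda>x. if x \<in> S then f x else 0) \<in> borel_measurable lebesgue"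
    using assms by (simp add: L2_on_def borel_measurable_if)
  then have g: "g \<in> borel_measurable (lebesgue_on S)"
    using borel_measurable_AE[OF _ ae] borel_measurable_if_D by blast
  have "integrable (lebesgue_on S) (\<lambda>x. (norm (g x))\<^sup>2)"
    using assms g unfolding L2_on_def
    by (subst integrable_cong_AE[where g = "\<lambda>x. (norm (f x))\<^sup>2"]) (auto elim: eventually_mono)
  then show ?thesis using g by (simp add: L2_on_def)
qed

lemma L2_on_slice:
  fixes f :: "real \<times> real \<Rightarrow> 'b::euclidean_space"
  assumes "L2_on ({a..b} \<times> {c..d}) f"
  shows "AE x in lebesgue_on {a..b}. L2_on {c..d} (\<lambda>t. f (x, t))"
proof -
  have lm: "{a..b} \<times> {c..d} \<in> lmeasurable"
    by (metis cbox_Pair_eq cbox_interval lmeasurable_cbox)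
  have f: "integrable (lebesgue_on ({a..b} \<times> {c..d})) f"
    using assms lm by (rule L2_on_imp_integrable)
  \<comment> \<open>Measurability of almost every slice is read off from integrability of its real
    components.\<close>
  have "AE x in lebesgue_on {a..b}. \<forall>i\<in>Basis. integrable (lebesgue_on {c..d}) (\<lambda>t. f (x, t) \<bullet> i)"
    by (intro AE_finite_allI lebesgue_Fubini(1)[where f = "\<lambda>z. f z \<bullet> i" for i]) (auto intro: f)
  moreover have "AE x in lebesgue_on {a..b}. integrable (lebesgue_on {c..d}) (\<lambda>t. (norm (f (x, t)))\<^sup>2)"
    using assms by (intro lebesgue_Fubini(1)[where f = "\<lambda>z. (norm (f z))\<^sup>2"]) (auto simp: L2_on_def)
  ultimately show ?thesis
  proof eventually_elim
    case (elim x)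
    have "(\<lambda>t. f (x, t)) \<in> borel_measurable (lebesgue_on {c..d})"
      using elim(1) by (subst borel_measurable_euclidean_space) (auto intro: borel_measurable_integrable)
    then show ?case using elim(2) by (simp add: L2_on_def)
  qed
qed

section \<open>Weak limits of difference quotients\<close>

text \<open>Nonnegativity of the variance: expand the integral of \<open>(f x - m)\<^sup>2\<close>
  with \<open>m\<close> the mean of \<open>f\<close>.\<close>

lemma integral_square_le:
  fixes f :: "real \<Rightarrow> real"
  assumes "a \<le> b" "f integrable_on {a..b}" "(\<lambda>x. (f x)\<^sup>2) integrable_on {a..b}"
  shows "(integral {a..b} f)\<^sup>2 \<le> (b - a) * integral {a..b} (\<lambda>x. (f x)\<^sup>2)"
proof (cases "a = b")
  case False
  with \<open>a \<le> b\<close> have ab: "a < b" by simp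
  define I where "I = integral {a..b} f"
  define m where "m = I / (b - a)"
  have I: "(f has_integral I) {a..b}" using assms(2) by (simp add: I_def integrable_integral)
  have J: "((\<lambda>x. (f x)\<^sup>2) has_integral integral {a..b} (\<lambda>x. (f x)\<^sup>2)) {a..b}"
    using assms(3) by (simp add: integrable_integral)
  have c: "((\<lambda>x. m\<^sup>2) has_integral (b - a) * m\<^sup>2) {a..b}"
    using has_integral_const_real[of "m\<^sup>2" a b] ab by simp
  have "((\<lambda>x. (f x)\<^sup>2 - (2 * m) * f x + m\<^sup>2) has_integral integral {a..b} (\<lambda>x. (f x)\<^sup>2) - (2 * m) * I + (b - a) * m\<^sup>2) {a..b}"
    by (intro has_integral_add has_integral_diff J c has_integral_mult_right I)
  moreover have "0 \<le> (f x)\<^sup>2 - (2 * m) * f x + m\<^sup>2" for x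
    using zero_le_power2[of "f x - m"] by (simp add: power2_diff algebra_simps)
  ultimately have "0 \<le> integral {a..b} (\<lambda>x. (f x)\<^sup>2) - (2 * m) * I + (b - a) * m\<^sup>2"
    by (rule has_integral_nonneg)
  also have "\<dots> = integral {a..b} (\<lambda>x. (f x)\<^sup>2) - I\<^sup>2 / (b - a)"
  proof -
    have "(b - a) * m = I" using ab by (simp add: m_def)
    moreover have "I\<^sup>2 / (b - a) = m * I" by (simp add: m_def power2_eq_square)
    ultimately show ?thesis by (simp add: power2_eq_square mult.assoc[symmetric])
  qed
  finally have "I\<^sup>2 / (b - a) \<le> integral {a..b} (\<lambda>x. (f x)\<^sup>2)" by simp
  then show ?thesis using ab unfolding I_def by (simp add: field_simps)
qed simp

lemma L2_on_Icc:
  fixes v :: "real \<Rightarrow> 'b::euclidean_space"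
  assumes "L2_on {a..b} v" "a \<le> c" "d \<le> b"
  shows "v absolutely_integrable_on {c..d}" "v integrable_on {c..d}"
    and "(\<lambda>x. norm (v x)) integrable_on {c..d}"
    and "(\<lambda>x. (norm (v x))\<^sup>2) integrable_on {c..d}"
proof -
  have v: "L2_on {c..d} v" using assms by (intro L2_on_subset[OF assms(1)]) auto
  then have "integrable (lebesgue_on {c..d}) v" by (intro L2_on_imp_integrable) auto
  then show ai: "v absolutely_integrable_on {c..d}"
    by (simp add: set_integrable_def integrable_restrict_space)
  then show "v integrable_on {c..d}" "(\<lambda>x. norm (v x)) integrable_on {c..d}"
    by (auto simp: absolutely_integrable_on_def)
  show "(\<lambda>x. (norm (v x))\<^sup>2) integrable_on {c..d}"
    using v by (intro integrable_on_lebesgue_on) (auto simp: L2_on_def)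
qed

text \<open>Fundamental theorem plus Cauchy-Schwarz. The integral of \<open>norm (v t)\<close> is
  kept as an intermediate quantity because it is additive over adjacent intervals.\<close>

lemma abs_cont_on_increment:
  fixes u v :: "real \<Rightarrow> 'b::euclidean_space"
  assumes ac: "abs_cont_on a b u"
    and der: "AE t in lebesgue_on {a..b}. (u has_vector_derivative v t) (at t within {a..b})"
    and v: "L2_on {a..b} v" and cd: "a \<le> c" "c \<le> d" "d \<le> b"
  shows "norm (u d - u c) \<le> integral {c..d} (\<lambda>t. norm (v t))"
    and "(integral {c..d} (\<lambda>t. norm (v t)))\<^sup>2 \<le> (d - c) * integral {c..d} (\<lambda>t. (norm (v t))\<^sup>2)"
    and "(norm (u d - u c))\<^sup>2 \<le> (d - c) * integral {c..d} (\<lambda>t. (norm (v t))\<^sup>2)"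
proof -
  have sub: "{c..d} \<subseteq> {a..b}" using cd by auto
  have "AE t in lebesgue_on {c..d}. (u has_vector_derivative v t) (at t within {c..d})"
    using der sub unfolding AE_lebesgue_on_iff[OF lmeasurable_interval(1)[THEN fmeasurableD]]
    by (auto elim!: eventually_mono intro: has_vector_derivative_within_subset)
  then have "(v has_integral (u d - u c)) {c..d}"
    using cd abs_cont_on_subinterval[OF ac sub] by (intro abs_cont_on_fundamental)
  then have "u d - u c = integral {c..d} v" by (simp add: integral_unique)
  then show 1: "norm (u d - u c) \<le> integral {c..d} (\<lambda>t. norm (v t))"
    using L2_on_Icc[OF v cd(1,3)] by (simp add: integral_norm_bound_integral)
  show 2: "(integral {c..d} (\<lambda>t. norm (v t)))\<^sup>2 \<le> (d - c) * integral {c..d} (\<lambda>t. (norm (v t))\<^sup>2)"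
    using cd L2_on_Icc[OF v cd(1,3)] by (intro integral_square_le) auto
  have "(norm (u d - u c))\<^sup>2 \<le> (integral {c..d} (\<lambda>t. norm (v t)))\<^sup>2"
    using 1 by (intro power_mono) auto
  with 2 show "(norm (u d - u c))\<^sup>2 \<le> (d - c) * integral {c..d} (\<lambda>t. (norm (v t))\<^sup>2)" by simp
qed

text \<open>After the shift the common part cancels and two end pieces of length \<open>h\<close>
  remain. This identity does the work that differentiation of a history functional would do.\<close>

lemma integral_minus_delayed:
  fixes f :: "real \<Rightarrow> real"
  assumes f: "continuous_on {-h..T} f" and "0 \<le> h" "0 \<le> T"
  shows "integral {0..T} (\<lambda>t. f t - f (t - h)) = integral {T-h..T} f - integral {-h..0} f"
proof -
  have int: "f integrable_on {c..d}" if "-h \<le> c" "d \<le> T" for c d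
    using that by (intro integrable_continuous_real continuous_on_subset[OF f]) auto
  have "integral {0..T} (f \<circ> (\<lambda>t. t + (-h))) = integral {0+(-h)..T+(-h)} f"
    using assms by (intro integral_shift continuous_on_subset[OF f]) auto
  then have shift: "integral {0..T} (\<lambda>t. f (t - h)) = integral {-h..T-h} f"
    by (simp add: o_def)
  have "continuous_on {0..T} (\<lambda>t. f (t - h))"
    using \<open>0 \<le> h\<close> by (intro continuous_on_compose2[OF f] continuous_intros) auto
  then have "integral {0..T} (\<lambda>t. f t - f (t - h)) = integral {0..T} f - integral {0..T} (\<lambda>t. f (t - h))"
    using assms by (intro integral_diff int integrable_continuous_real) auto
  moreover have "integral {-h..0} f + integral {0..T} f = integral {-h..T} f"
    using assms by (intro Henstock_Kurzweil_Integration.integral_combine int) auto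
  moreover have "integral {-h..T-h} f + integral {T-h..T} f = integral {-h..T} f"
    using assms by (intro Henstock_Kurzweil_Integration.integral_combine int) auto
  ultimately show ?thesis using shift by simp
qed

text \<open>Clipping at \<open>0\<close> models the constant extension of the initial state to
  negative times.\<close>

lemma continuous_on_clip:
  assumes "continuous_on {0..T} f" "0 \<le> T"
  shows "continuous_on {c..T} (\<lambda>s. f (max 0 (s::real)))"
  by (rule continuous_on_compose2[OF assms(1)]) (use assms(2) in \<open>auto intro!: continuous_intros\<close>)

lemma continuous_on_delay:
  assumes "continuous_on {0..T} f" "0 \<le> h" "0 \<le> T"
  shows "continuous_on {0..T} (\<lambda>s. f (max 0 (s - h :: real)))"
  by (rule continuous_on_compose2[OF assms(1)]) (use assms(2,3) in \<open>auto intro!: continuous_intros\<close>)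

text \<open>Of the two end pieces, the one before time \<open>0\<close> vanishes since
  \<open>P 0 = 0\<close>, and the one before \<open>T\<close> is at most \<open>h * P T\<close> by
  monotonicity. It is used with \<open>P\<close> a primitive of a squared norm.\<close>

lemma integral_increment_le:
  fixes P :: "real \<Rightarrow> real"
  assumes P: "continuous_on {0..T} P" "mono_on {0..T} P" "P 0 = 0" and "0 \<le> h" "0 \<le> T"
  shows "integral {0..T} (\<lambda>t. P t - P (max 0 (t - h))) \<le> h * P T"
proof -
  define f where "f = (\<lambda>s. P (max 0 s))"
  have f: "continuous_on {-h..T} f" unfolding f_def using P \<open>0 \<le> T\<close> by (intro continuous_on_clip)
  have le: "f s \<le> P T" if "s \<le> T" for s
    unfolding f_def using that \<open>0 \<le> T\<close> by (intro mono_onD[OF P(2)]) auto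
  have "integral {0..T} (\<lambda>t. P t - P (max 0 (t - h))) = integral {0..T} (\<lambda>t. f t - f (t - h))"
    by (intro integral_cong) (auto simp: f_def)
  also have "\<dots> = integral {T-h..T} f - integral {-h..0} f"
    using f assms by (intro integral_minus_delayed)
  also have "integral {-h..0} f = integral {-h..0} (\<lambda>s. 0)"
    using P by (intro integral_cong) (auto simp: f_def)
  also have "integral {T-h..T} f \<le> integral {T-h..T} (\<lambda>s. P T)"
    using \<open>0 \<le> T\<close> by (intro integral_le integrable_continuous_real continuous_on_subset[OF f] le continuous_intros) auto
  also have "integral {T-h..T} (\<lambda>s. P T) = h * P T" using \<open>0 \<le> h\<close> by simp
  finally show ?thesis by simp
qed

lemma average_tendsto:
  fixes f :: "real \<Rightarrow> real"
  assumes f: "continuous_on {c..T} f" and "c < T"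
  shows "(\<lambda>n. real (Suc n) * integral {T - 1 / real (Suc n)..T} f) \<longlonglongrightarrow> f T"
proof (rule LIMSEQ_I)
  fix \<epsilon> :: real assume "\<epsilon> > 0"
  then obtain d where "d > 0" and d: "\<And>s. \<lbrakk>s \<in> {c..T}; dist s T < d\<rbrakk> \<Longrightarrow> dist (f s) (f T) < \<epsilon> / 2"
    using f \<open>c < T\<close> unfolding continuous_on_iff by (metis atLeastAtMost_iff less_eq_real_def order_refl half_gt_zero)
  obtain N where N: "inverse (real (Suc N)) < min d (T - c)"
    using reals_Archimedean[of "min d (T - c)"] \<open>d > 0\<close> \<open>c < T\<close> by auto
  show "\<exists>no. \<forall>n\<ge>no. norm (real (Suc n) * integral {T - 1 / real (Suc n)..T} f - f T) < \<epsilon>"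
  proof (intro exI[of _ N] allI impI)
    fix n assume "n \<ge> N"
    define h where "h = 1 / real (Suc n)"
    have "h \<le> inverse (real (Suc N))" using \<open>n \<ge> N\<close> by (simp add: h_def field_simps)
    then have h: "0 < h" "h < d" "T - h \<ge> c" using N by (auto simp: h_def)
    have cf: "continuous_on {T-h..T} f" using h by (intro continuous_on_subset[OF f]) auto
    have "norm (integral {T-h..T} (\<lambda>s. f s - f T)) \<le> \<epsilon> / 2 * (T - (T - h))"
    proof (rule integral_bound)
      show "continuous_on {T-h..T} (\<lambda>s. f s - f T)" using cf by (intro continuous_intros)
      fix s assume "s \<in> {T-h..T}"
      then show "norm (f s - f T) \<le> \<epsilon> / 2" using d[of s] h by (auto simp: dist_real_def)
    qed (use h in auto)
    moreover have "integral {T-h..T} (\<lambda>s. f s - f T) = integral {T-h..T} f - h * f T"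
      using cf h by (subst integral_diff) (auto intro: integrable_continuous_real)
    ultimately have "\<bar>integral {T-h..T} f - h * f T\<bar> \<le> \<epsilon> / 2 * h" by simp
    then have "\<bar>integral {T-h..T} f - h * f T\<bar> / h \<le> \<epsilon> / 2" using h by (simp add: field_simps)
    moreover have "\<bar>integral {T-h..T} f - h * f T\<bar> / h = \<bar>(integral {T-h..T} f - h * f T) / h\<bar>" using h by (simp add: abs_divide)
    moreover have "(integral {T-h..T} f - h * f T) / h = real (Suc n) * integral {T-h..T} f - f T"
      using h by (simp add: h_def field_simps)
    ultimately show "norm (real (Suc n) * integral {T - 1 / real (Suc n)..T} f - f T) < \<epsilon>"
      using \<open>\<epsilon> > 0\<close> unfolding h_def[symmetric] by simp
  qed
qed

section \<open>Weak convergence of backward difference quotients\<close>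

lemma L2_on_norm_add:
  assumes "L2_on S f" "L2_on S g"
  shows "(\<integral>x. (norm (f x + g x))\<^sup>2 \<partial>lebesgue_on S) =
    (\<integral>x. (norm (f x))\<^sup>2 \<partial>lebesgue_on S) + 2 * (\<integral>x. f x \<bullet> g x \<partial>lebesgue_on S) + (\<integral>x. (norm (g x))\<^sup>2 \<partial>lebesgue_on S)"
proof -
  have eq: "(norm (f x + g x))\<^sup>2 = (norm (f x))\<^sup>2 + 2 * (f x \<bullet> g x) + (norm (g x))\<^sup>2" for x
    by (simp add: power2_norm_eq_inner inner_add_left inner_add_right inner_commute)
  show ?thesis
    unfolding eq using assms L2_on_inner[OF assms] by (simp add: L2_on_def)
qed

lemma L2_on_inner_bound:
  assumes "L2_on S f" "L2_on S g"
  shows "2 * \<bar>\<integral>x. f x \<bullet> g x \<partial>lebesgue_on S\<bar> \<le>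
    (\<integral>x. (norm (f x))\<^sup>2 \<partial>lebesgue_on S) + (\<integral>x. (norm (g x))\<^sup>2 \<partial>lebesgue_on S)"
proof -
  have "0 \<le> (\<integral>x. (norm (f x + g x))\<^sup>2 \<partial>lebesgue_on S)" by simp
  moreover have "0 \<le> (\<integral>x. (norm (f x + (-1) *\<^sub>R g x))\<^sup>2 \<partial>lebesgue_on S)" by simp
  ultimately show ?thesis
    unfolding L2_on_norm_add[OF assms] L2_on_norm_add[OF assms(1) L2_on_scaleR[OF assms(2)]] by simp
qed

text \<open>Fatou's lemma for \<open>\<bar>\<phi> + q\<^sub>n\<bar>\<^sup>2\<close>: the square terms are controlled by the norm bound, so only
  the cross term is left.\<close>

lemma weak_liminf:
  fixes q :: "nat \<Rightarrow> 'a::euclidean_space \<Rightarrow> 'b::euclidean_space"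
  assumes q: "\<And>n. L2_on S (q n)" and v: "L2_on S v" and \<phi>: "L2_on S \<phi>"
    and lim: "AE x in lebesgue_on S. (\<lambda>n. q n x) \<longlonglongrightarrow> v x"
    and le: "\<And>n. (\<integral>x. (norm (q n x))\<^sup>2 \<partial>lebesgue_on S) \<le> (\<integral>x. (norm (v x))\<^sup>2 \<partial>lebesgue_on S)"
    and "\<epsilon> > 0"
  shows "\<forall>\<^sub>F n in sequentially. (\<integral>x. \<phi> x \<bullet> q n x \<partial>lebesgue_on S) > (\<integral>x. \<phi> x \<bullet> v x \<partial>lebesgue_on S) - \<epsilon>"
proof -
  let ?M = "lebesgue_on S"
  define I where "I = (\<integral>x. (norm (\<phi> x + v x))\<^sup>2 \<partial>?M)"
  define In where "In = (\<lambda>n. \<integral>x. (norm (\<phi> x + q n x))\<^sup>2 \<partial>?M)"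
  have meas[measurable]: "\<phi> \<in> borel_measurable ?M" "v \<in> borel_measurable ?M" "\<And>n. q n \<in> borel_measurable ?M"
    using q v \<phi> by (auto simp: L2_on_def)
  have nn: "(\<integral>\<^sup>+x. ennreal ((norm (\<phi> x + f x))\<^sup>2) \<partial>?M) = ennreal (\<integral>x. (norm (\<phi> x + f x))\<^sup>2 \<partial>?M)"
    if "L2_on S f" for f
    using L2_on_add[OF \<phi> that] by (intro nn_integral_eq_integral) (auto simp: L2_on_def)
  have "ennreal I = (\<integral>\<^sup>+x. ennreal ((norm (\<phi> x + v x))\<^sup>2) \<partial>?M)" using nn[OF v] by (simp add: I_def)
  also have "\<dots> = (\<integral>\<^sup>+x. liminf (\<lambda>n. ennreal ((norm (\<phi> x + q n x))\<^sup>2)) \<partial>?M)"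
  proof (rule nn_integral_cong_AE, use lim in eventually_elim)
    case (elim x)
    then have "(\<lambda>n. ennreal ((norm (\<phi> x + q n x))\<^sup>2)) \<longlonglongrightarrow> ennreal ((norm (\<phi> x + v x))\<^sup>2)"
      by (intro tendsto_intros tendsto_ennrealI)
    from lim_imp_Liminf[OF trivial_limit_sequentially this, symmetric] show ?case .
  qed
  also have "\<dots> \<le> liminf (\<lambda>n. \<integral>\<^sup>+x. ennreal ((norm (\<phi> x + q n x))\<^sup>2) \<partial>?M)"
    by (intro nn_integral_liminf) measurable
  also have "\<dots> = liminf (\<lambda>n. ennreal (In n))" using nn[OF q] by (simp add: In_def)
  finally have fatou: "ennreal I \<le> liminf (\<lambda>n. ennreal (In n))" .
  have "\<forall>\<^sub>F n in sequentially. I - \<epsilon> < In n"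
  \<comment> \<open>\<open>ennreal\<close> truncates at \<open>0\<close>, so a negative threshold is
    treated directly.\<close>
  proof (cases "I - \<epsilon> < 0")
    case True
    have "0 \<le> In n" for n by (simp add: In_def)
    then show ?thesis using True by (intro always_eventually allI) (meson less_le_trans)
  next
    case False
    then have "ennreal (I - \<epsilon>) < ennreal I" using \<open>\<epsilon> > 0\<close> by (intro ennreal_lessI) auto
    then have "\<forall>\<^sub>F n in sequentially. ennreal (I - \<epsilon>) < ennreal (In n)"
      using fatou by (simp add: le_Liminf_iff)
    then show ?thesis using False by (auto elim!: eventually_mono simp: ennreal_less_iff)
  qed
  then show ?thesis
  proof eventually_elim
    case (elim n)
    have "In n \<le> (\<integral>x. (norm (\<phi> x))\<^sup>2 \<partial>?M) + 2 * (\<integral>x. \<phi> x \<bullet> q n x \<partial>?M) + (\<integral>x. (norm (v x))\<^sup>2 \<partial>?M)"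
      unfolding In_def L2_on_norm_add[OF \<phi> q] using le[of n] by simp
    with elim \<open>\<epsilon> > 0\<close> show ?case unfolding I_def L2_on_norm_add[OF \<phi> v] by linarith
  qed
qed

text \<open>The lower bound for the limit, applied to \<open>\<phi>\<close> and to
  \<open>- \<phi>\<close>, is two-sided.\<close>

lemma weak_limit:
  fixes q :: "nat \<Rightarrow> 'a::euclidean_space \<Rightarrow> 'b::euclidean_space"
  assumes q: "\<And>n. L2_on S (q n)" and v: "L2_on S v" and \<phi>: "L2_on S \<phi>"
    and lim: "AE x in lebesgue_on S. (\<lambda>n. q n x) \<longlonglongrightarrow> v x"
    and le: "\<And>n. (\<integral>x. (norm (q n x))\<^sup>2 \<partial>lebesgue_on S) \<le> (\<integral>x. (norm (v x))\<^sup>2 \<partial>lebesgue_on S)"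
  shows "(\<lambda>n. \<integral>x. \<phi> x \<bullet> q n x \<partial>lebesgue_on S) \<longlonglongrightarrow> (\<integral>x. \<phi> x \<bullet> v x \<partial>lebesgue_on S)"
proof (rule tendstoI)
  fix \<epsilon> :: real assume "\<epsilon> > 0"
  have neg: "L2_on S (\<lambda>x. - \<phi> x)" using L2_on_scaleR[OF \<phi>, of "-1"] by simp
  show "\<forall>\<^sub>F n in sequentially. dist (\<integral>x. \<phi> x \<bullet> q n x \<partial>lebesgue_on S) (\<integral>x. \<phi> x \<bullet> v x \<partial>lebesgue_on S) < \<epsilon>"
    using weak_liminf[OF q v \<phi> lim le \<open>\<epsilon> > 0\<close>] weak_liminf[OF q v neg lim le \<open>\<epsilon> > 0\<close>]
    by eventually_elim (auto simp: dist_real_def abs_less_iff)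
qed

text \<open>Weak convergence needs two inputs: pointwise convergence, which holds wherever
  \<open>u\<close> has a derivative, and the fact that no quotient exceeds the derivative in the
  square norm. The latter is Cauchy-Schwarz on each window followed by telescoping.\<close>

lemma backward_quotient_weak_limit:
  fixes u v \<phi> :: "real \<Rightarrow> 'b::euclidean_space"
  defines "q \<equiv> \<lambda>n t. real (Suc n) *\<^sub>R (u t - u (max 0 (t - 1 / real (Suc n))))"
  assumes T: "0 < T" and ac: "abs_cont_on 0 T u"
    and der: "AE t in lebesgue_on {0..T}. (u has_vector_derivative v t) (at t within {0..T})"
    and v: "L2_on {0..T} v" and \<phi>: "L2_on {0..T} \<phi>"
  shows "L2_on {0..T} (q n)"
    and "(\<integral>t. (norm (q n t))\<^sup>2 \<partial>lebesgue_on {0..T}) \<le> (\<integral>t. (norm (v t))\<^sup>2 \<partial>lebesgue_on {0..T})"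
    and "(\<lambda>n. \<integral>t. \<phi> t \<bullet> q n t \<partial>lebesgue_on {0..T}) \<longlonglongrightarrow> (\<integral>t. \<phi> t \<bullet> v t \<partial>lebesgue_on {0..T})"
proof -
  have cu: "continuous_on {0..T} u" using ac by (rule abs_cont_on_imp_continuous_on)
  have cq: "continuous_on {0..T} (q n)" for n
    unfolding q_def using T by (intro continuous_intros cu continuous_on_delay) auto
  show q: "L2_on {0..T} (q n)" for n
    using cq by (intro L2_on_continuous) auto
  \<comment> \<open>In terms of this primitive the squared quotient at \<open>t\<close> is at most
    \<open>real (Suc n) * (P t - P (max 0 (t - h)))\<close>, whose integral over
    \<open>{0..T}\<close> is at most \<open>P T\<close>.\<close>
  define P where "P = (\<lambda>t. integral {0..t} (\<lambda>s. (norm (v s))\<^sup>2))"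
  have iv: "(\<lambda>s. (norm (v s))\<^sup>2) integrable_on {c..d}" if "0 \<le> c" "d \<le> T" for c d
    using L2_on_Icc(4)[OF v] that by auto
  have Pdiff: "P t - P s = integral {s..t} (\<lambda>s. (norm (v s))\<^sup>2)" if "0 \<le> s" "s \<le> t" "t \<le> T" for s t
    using Henstock_Kurzweil_Integration.integral_combine[of 0 s t, OF that(1,2) iv] that by (simp add: P_def)
  have Pmono: "mono_on {0..T} P"
  proof (rule mono_onI)
    fix s t assume "s \<in> {0..T}" "t \<in> {0..T}" "s \<le> t"
    then have "0 \<le> P t - P s" using iv by (subst Pdiff) (auto intro!: integral_nonneg)
    then show "P s \<le> P t" by simp
  qed
  have Pcont: "continuous_on {0..T} P"
    unfolding P_def by (rule indefinite_integral_continuous_1) (use iv T in auto)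
  show le: "(\<integral>t. (norm (q n t))\<^sup>2 \<partial>lebesgue_on {0..T}) \<le> (\<integral>t. (norm (v t))\<^sup>2 \<partial>lebesgue_on {0..T})" for n
  proof -
    define h where "h = 1 / real (Suc n)"
    have h: "h > 0" "real (Suc n) * h = 1" by (auto simp: h_def)
    have cP: "continuous_on {0..T} (\<lambda>t. P t - P (max 0 (t - h)))"
      using h T by (intro continuous_intros Pcont continuous_on_delay) auto
    have "(\<integral>t. (norm (q n t))\<^sup>2 \<partial>lebesgue_on {0..T}) = integral {0..T} (\<lambda>t. (norm (q n t))\<^sup>2)"
      using q by (intro lebesgue_integral_eq_integral) (auto simp: L2_on_def)
    also have "\<dots> \<le> integral {0..T} (\<lambda>t. real (Suc n) * (P t - P (max 0 (t - h))))"
    proof (rule integral_le)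
      show "(\<lambda>t. (norm (q n t))\<^sup>2) integrable_on {0..T}"
        using L2_on_Icc(4)[OF q] by auto
      show "(\<lambda>t. real (Suc n) * (P t - P (max 0 (t - h)))) integrable_on {0..T}"
        by (intro integrable_continuous_real continuous_on_mult_left cP)
      fix t assume t: "t \<in> {0..T}"
      define s where "s = max 0 (t - h)"
      have s: "0 \<le> s" "s \<le> t" "t - s \<le> h" using t h by (auto simp: s_def)
      have "(norm (u t - u s))\<^sup>2 \<le> (t - s) * (P t - P s)"
        using abs_cont_on_increment(3)[OF ac der v, of s t] s t by (simp add: Pdiff)
      also have "\<dots> \<le> h * (P t - P s)"
        using s t mono_onD[OF Pmono, of s t] by (intro mult_right_mono) auto
      finally have "(real (Suc n))\<^sup>2 * (norm (u t - u s))\<^sup>2 \<le> (real (Suc n))\<^sup>2 * (h * (P t - P s))"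
        by (intro mult_left_mono) auto
      also have "\<dots> = real (Suc n) * (P t - P s)"
        using h by (simp add: power2_eq_square)
      finally show "(norm (q n t))\<^sup>2 \<le> real (Suc n) * (P t - P (max 0 (t - h)))"
        unfolding q_def h_def[symmetric] s_def[symmetric] by (simp add: power_mult_distrib)
    qed
    also have "\<dots> = real (Suc n) * integral {0..T} (\<lambda>t. P t - P (max 0 (t - h)))" by simp
    also have "\<dots> \<le> real (Suc n) * (h * P T)"
      using h T Pcont Pmono by (intro mult_left_mono integral_increment_le) (auto simp: P_def)
    also have "\<dots> = P T" using h by simp
    also have "\<dots> = (\<integral>t. (norm (v t))\<^sup>2 \<partial>lebesgue_on {0..T})"
      unfolding P_def using v by (intro lebesgue_integral_eq_integral[symmetric]) (auto simp: L2_on_def)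
    finally show ?thesis .
  qed
  \<comment> \<open>At a positive time the clipping is eventually inactive and the backward quotient
    is a genuine one.\<close>
  have "AE t in lebesgue_on {0..T}. t \<noteq> 0"
    by (simp add: AE_lebesgue_on_iff) (use AE_lborel_singleton[of 0] in \<open>auto elim: eventually_mono\<close>)
  with der have "AE t in lebesgue_on {0..T}. t \<in> {0..T} \<longrightarrow> (\<lambda>n. q n t) \<longlonglongrightarrow> v t"
  proof eventually_elim
    case (elim t)
    show ?case
    proof
      assume t: "t \<in> {0..T}"
      with elim have "t > 0" by simp
      have quot: "((\<lambda>y. (1 / norm (y - t)) *\<^sub>R (u y - (u t + (y - t) *\<^sub>R v t))) \<longlongrightarrow> 0) (at t within {0..T})"
        using elim(1) unfolding has_vector_derivative_def has_derivative_within by blast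
      have "filterlim (\<lambda>n. t - 1 / real (Suc n)) (at t within {0..T}) sequentially"
      proof -
        have "(\<lambda>n. t - 1 / real (Suc n)) \<longlonglongrightarrow> t - 0"
          using LIMSEQ_inverse_real_of_nat by (intro tendsto_diff) (simp_all add: inverse_eq_divide)
        moreover have "\<forall>\<^sub>F n in sequentially. 1 / real (Suc n) < t"
          using LIMSEQ_inverse_real_of_nat \<open>t > 0\<close> by (auto simp: inverse_eq_divide dest: order_tendstoD)
        then have "\<forall>\<^sub>F n in sequentially. t - 1 / real (Suc n) \<in> {0..T} \<and> t - 1 / real (Suc n) \<noteq> t"
        proof eventually_elim
          case (elim n)
          have "t - h \<in> {0..T} \<and> t - h \<noteq> t" if "0 < h" "h < t" for h using t that by auto
          from this[OF _ elim] show ?case by simp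
        qed
        ultimately show ?thesis by (simp add: filterlim_at)
      qed
      \<comment> \<open>\<open>t\<close> is approached from the left, so subtracting the normalised
        remainder from \<open>v t\<close> reproduces the backward quotient exactly.\<close>
      from filterlim_compose[OF quot this]
      have "(\<lambda>n. v t - (1 / norm (t - 1 / real (Suc n) - t)) *\<^sub>R
          (u (t - 1 / real (Suc n)) - (u t + (t - 1 / real (Suc n) - t) *\<^sub>R v t))) \<longlonglongrightarrow> v t - 0"
        by (intro tendsto_diff tendsto_const)
      moreover have "\<forall>\<^sub>F n in sequentially. 1 / real (Suc n) < t"
        using LIMSEQ_inverse_real_of_nat \<open>t > 0\<close> by (auto simp: inverse_eq_divide dest: order_tendstoD)
      then have "\<forall>\<^sub>F n in sequentially. v t - (1 / norm (t - 1 / real (Suc n) - t)) *\<^sub>R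
          (u (t - 1 / real (Suc n)) - (u t + (t - 1 / real (Suc n) - t) *\<^sub>R v t)) = q n t"
      proof eventually_elim
        case (elim n)
        define h where "h = 1 / real (Suc n)"
        have h: "h > 0" "h < t" "real (Suc n) = 1 / h" using elim by (auto simp: h_def)
        show ?case
          unfolding q_def h_def[symmetric] h(3) using h(1,2)
          by (simp add: scaleR_right_diff_distrib scaleR_add_right)
      qed
      ultimately have "(\<lambda>n. q n t) \<longlonglongrightarrow> v t - 0" by (rule Lim_transform_eventually)
      then show "(\<lambda>n. q n t) \<longlonglongrightarrow> v t" by simp
    qed
  qed
  then have lim: "AE t in lebesgue_on {0..T}. (\<lambda>n. q n t) \<longlonglongrightarrow> v t"
    by (auto simp: AE_lebesgue_on_iff elim: eventually_mono)
  show "(\<lambda>n. \<integral>t. \<phi> t \<bullet> q n t \<partial>lebesgue_on {0..T}) \<longlonglongrightarrow> (\<integral>t. \<phi> t \<bullet> v t \<partial>lebesgue_on {0..T})"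
    by (rule weak_limit[OF q v \<phi> lim le])
qed

text \<open>The hypothesis \<open>ineq\<close> is what convexity of \<open>N\<close> as a function of \<open>u\<close> gives at times where \<open>\<phi>\<close> is
  its gradient. It is only needed at almost every upper time, so no chain rule for \<open>N\<close> is used.\<close>

lemma convex_energy_increment:
  fixes u v \<phi> :: "real \<Rightarrow> real \<Rightarrow> 'b::euclidean_space" and N :: "real \<Rightarrow> real"
  assumes T: "0 < T"
    and u: "continuous_on ({a..b} \<times> {0..T}) (\<lambda>(x, t). u x t)"
    and ac: "AE x in lebesgue_on {a..b}. abs_cont_on 0 T (u x) \<and>
      (AE t in lebesgue_on {0..T}. (u x has_vector_derivative v x t) (at t within {0..T}))"
    and v: "L2_on ({a..b} \<times> {0..T}) (\<lambda>(x, t). v x t)"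
    and \<phi>: "L2_on ({a..b} \<times> {0..T}) (\<lambda>(x, t). \<phi> x t)"
    and N: "continuous_on {0..T} N"
    and ineq: "AE t in lebesgue_on {0..T}. \<forall>s\<in>{0..t}.
      N t - N s \<le> (\<integral>x. \<phi> x t \<bullet> (u x t - u x s) \<partial>lebesgue_on {a..b})"
  shows "N T - N 0 \<le> (\<integral>x. (\<integral>t. \<phi> x t \<bullet> v x t \<partial>lebesgue_on {0..T}) \<partial>lebesgue_on {a..b})"
proof -
  let ?A = "{a..b}" and ?B = "{0..T}"
  define q where "q = (\<lambda>n x t. real (Suc n) *\<^sub>R (u x t - u x (max 0 (t - 1 / real (Suc n)))))"
  have comp: "compact (?A \<times> ?B)" by (intro compact_Times) auto
  have q: "L2_on (?A \<times> ?B) (\<lambda>(x, t). q n x t)" for n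
  proof (rule L2_on_continuous[OF comp])
    have "continuous_on (?A \<times> ?B) (\<lambda>z. (\<lambda>(x, t). u x t) (fst z, max 0 (snd z - 1 / real (Suc n))))"
    proof (rule continuous_on_compose2[OF u])
      show "(\<lambda>z. (fst z, max 0 (snd z - 1 / real (Suc n)))) ` (?A \<times> ?B) \<subseteq> ?A \<times> ?B"
      proof
        fix w assume "w \<in> (\<lambda>z. (fst z, max 0 (snd z - 1 / real (Suc n)))) ` (?A \<times> ?B)"
        then obtain x t where "x \<in> ?A" "t \<in> ?B" "w = (x, max 0 (t - 1 / real (Suc n)))" by auto
        moreover have "max 0 (t - h) \<in> ?B" if "0 \<le> h" "t \<in> ?B" for h using that T by auto
        from this[of "1 / real (Suc n)"] \<open>t \<in> ?B\<close> have "max 0 (t - 1 / real (Suc n)) \<in> ?B" by simp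
        ultimately show "w \<in> ?A \<times> ?B" by blast
      qed
    qed (intro continuous_intros)
    with u show "continuous_on (?A \<times> ?B) (\<lambda>(x, t). q n x t)"
      unfolding q_def split_def by (intro continuous_intros) simp_all
  qed
  have \<phi>q: "integrable (lebesgue_on (?A \<times> ?B)) (\<lambda>z. (\<lambda>(x, t). \<phi> x t) z \<bullet> (\<lambda>(x, t). q n x t) z)" for n
    by (intro L2_on_inner \<phi> q)
  have \<phi>v: "integrable (lebesgue_on (?A \<times> ?B)) (\<lambda>z. (\<lambda>(x, t). \<phi> x t) z \<bullet> (\<lambda>(x, t). v x t) z)"
    by (intro L2_on_inner \<phi> v)
  define J where "J = (\<lambda>n x. \<integral>t. \<phi> x t \<bullet> q n x t \<partial>lebesgue_on ?B)"
  \<comment> \<open>A dominating function independent of \<open>n\<close>: the pairing is bounded by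
    the sum of the two square norms, and that of the quotient by that of \<open>v\<close>.\<close>
  define G where "G = (\<lambda>x. (\<integral>t. (norm (\<phi> x t))\<^sup>2 \<partial>lebesgue_on ?B) + (\<integral>t. (norm (v x t))\<^sup>2 \<partial>lebesgue_on ?B))"
  have G: "integrable (lebesgue_on ?A) G"
    unfolding G_def
    using lebesgue_Fubini(3)[of ?A ?B "\<lambda>z. (norm ((\<lambda>(x, t). \<phi> x t) z))\<^sup>2"]
      lebesgue_Fubini(3)[of ?A ?B "\<lambda>z. (norm ((\<lambda>(x, t). v x t) z))\<^sup>2"] \<phi> v
    by (intro Bochner_Integration.integrable_add) (auto simp: L2_on_def)
  have slices: "AE x in lebesgue_on ?A. L2_on ?B (\<phi> x) \<and> L2_on ?B (v x)"
    using L2_on_slice[OF \<phi>] L2_on_slice[OF v] by eventually_elim auto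
  have "(\<lambda>n. \<integral>x. J n x \<partial>lebesgue_on ?A) \<longlonglongrightarrow> (\<integral>x. (\<integral>t. \<phi> x t \<bullet> v x t \<partial>lebesgue_on ?B) \<partial>lebesgue_on ?A)"
  proof (rule integral_dominated_convergence)
    show "(\<lambda>x. \<integral>t. \<phi> x t \<bullet> v x t \<partial>lebesgue_on ?B) \<in> borel_measurable (lebesgue_on ?A)"
      using lebesgue_Fubini(3)[OF _ _ \<phi>v] by (auto intro: borel_measurable_integrable)
    show "J n \<in> borel_measurable (lebesgue_on ?A)" for n
      using lebesgue_Fubini(3)[OF _ _ \<phi>q[of n]] by (auto simp: J_def intro: borel_measurable_integrable)
    show "integrable (lebesgue_on ?A) G" by (rule G)
    show "AE x in lebesgue_on ?A. (\<lambda>n. J n x) \<longlonglongrightarrow> (\<integral>t. \<phi> x t \<bullet> v x t \<partial>lebesgue_on ?B)"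
      using slices ac
    proof eventually_elim
      case (elim x)
      then show ?case
        unfolding J_def q_def using backward_quotient_weak_limit(3)[OF T] by blast
    qed
    show "AE x in lebesgue_on ?A. norm (J n x) \<le> G x" for n
      using slices ac
    proof eventually_elim
      case (elim x)
      have qx: "L2_on ?B (q n x)"
        unfolding q_def using elim backward_quotient_weak_limit(1)[OF T] by blast
      have "2 * \<bar>J n x\<bar> \<le> (\<integral>t. (norm (\<phi> x t))\<^sup>2 \<partial>lebesgue_on ?B) + (\<integral>t. (norm (q n x t))\<^sup>2 \<partial>lebesgue_on ?B)"
        unfolding J_def using elim qx by (intro L2_on_inner_bound) auto
      also have "(\<integral>t. (norm (q n x t))\<^sup>2 \<partial>lebesgue_on ?B) \<le> (\<integral>t. (norm (v x t))\<^sup>2 \<partial>lebesgue_on ?B)"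
        unfolding q_def using elim backward_quotient_weak_limit(2)[OF T] by blast
      finally have "2 * \<bar>J n x\<bar> \<le> G x" by (simp add: G_def)
      then show ?case by simp
    qed
  qed
  \<comment> \<open>For the clipped extension the left end piece contributes exactly
    \<open>N 0\<close> after scaling; the right one is the mean of \<open>N\<close> over the last
    window and tends to \<open>N T\<close> by continuity.\<close>
  moreover have "(\<lambda>n. real (Suc n) * integral ?B (\<lambda>t. N t - N (max 0 (t - 1 / real (Suc n))))) \<longlonglongrightarrow> N T - N 0"
  proof -
    have cN: "continuous_on {-1..T} (\<lambda>s. N (max 0 s))" using N T by (intro continuous_on_clip) auto
    have "real (Suc n) * integral ?B (\<lambda>t. N t - N (max 0 (t - 1 / real (Suc n)))) =
        real (Suc n) * integral {T - 1 / real (Suc n)..T} (\<lambda>s. N (max 0 s)) - N 0" for n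
    proof -
      define h where "h = 1 / real (Suc n)"
      have h: "0 < h" "h \<le> 1" "real (Suc n) = 1 / h" by (auto simp: h_def field_simps)
      have "integral ?B (\<lambda>t. N t - N (max 0 (t - h))) = integral ?B (\<lambda>t. N (max 0 t) - N (max 0 (t - h)))"
        by (intro integral_cong) auto
      also have "\<dots> = integral {T-h..T} (\<lambda>s. N (max 0 s)) - integral {-h..0} (\<lambda>s. N (max 0 s))"
        using h T by (intro integral_minus_delayed continuous_on_subset[OF cN]) auto
      also have "integral {-h..0} (\<lambda>s. N (max 0 s)) = integral {-h..0} (\<lambda>s. N 0)"
        by (intro integral_cong) auto
      also have "\<dots> = h * N 0" using h by simp
      finally show ?thesis using h(1) unfolding h_def[symmetric] h(3) by (simp add: field_simps)
    qed
    moreover have "(\<lambda>n. real (Suc n) * integral {T - 1 / real (Suc n)..T} (\<lambda>s. N (max 0 s)) - N 0) \<longlonglongrightarrow> N (max 0 T) - N 0"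
      using T by (intro tendsto_diff tendsto_const average_tendsto[OF cN]) auto
    ultimately show ?thesis using T by simp
  qed
  \<comment> \<open>The convexity inequality concerns fixed times, so the space integral is taken
    first here; Fubini then turns the bound into the integral of \<open>J n\<close>, for which the
    limit is known.\<close>
  moreover have "real (Suc n) * integral ?B (\<lambda>t. N t - N (max 0 (t - 1 / real (Suc n)))) \<le> (\<integral>x. J n x \<partial>lebesgue_on ?A)" for n
  proof -
    define h where "h = 1 / real (Suc n)"
    have h: "0 < h" by (simp add: h_def)
    have cN: "continuous_on ?B (\<lambda>t. real (Suc n) * (N t - N (max 0 (t - h))))"
      using h T N by (intro continuous_intros continuous_on_delay) auto
    have iN: "integrable (lebesgue_on ?B) (\<lambda>t. real (Suc n) * (N t - N (max 0 (t - h))))"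
      using L2_on_imp_integrable[OF L2_on_continuous[OF _ cN]] by auto
    have "real (Suc n) * integral ?B (\<lambda>t. N t - N (max 0 (t - h))) = integral ?B (\<lambda>t. real (Suc n) * (N t - N (max 0 (t - h))))"
      by simp
    also have "\<dots> = (\<integral>t. real (Suc n) * (N t - N (max 0 (t - h))) \<partial>lebesgue_on ?B)"
      by (intro lebesgue_integral_eq_integral[symmetric] iN) auto
    also have "\<dots> \<le> (\<integral>t. (\<integral>x. \<phi> x t \<bullet> q n x t \<partial>lebesgue_on ?A) \<partial>lebesgue_on ?B)"
    proof (rule integral_mono_AE[OF iN])
      show "integrable (lebesgue_on ?B) (\<lambda>t. \<integral>x. \<phi> x t \<bullet> q n x t \<partial>lebesgue_on ?A)"
        using lebesgue_Fubini(4)[OF _ _ \<phi>q[of n]] by auto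
      show "AE t in lebesgue_on ?B. real (Suc n) * (N t - N (max 0 (t - h))) \<le> (\<integral>x. \<phi> x t \<bullet> q n x t \<partial>lebesgue_on ?A)"
      proof (rule lebesgue_on_mono[OF ineq])
        fix t assume t: "t \<in> ?B" and *: "\<forall>s\<in>{0..t}. N t - N s \<le> (\<integral>x. \<phi> x t \<bullet> (u x t - u x s) \<partial>lebesgue_on ?A)"
        have "max 0 (t - h) \<in> {0..t}" using t h by auto
        with * have "N t - N (max 0 (t - h)) \<le> (\<integral>x. \<phi> x t \<bullet> (u x t - u x (max 0 (t - h))) \<partial>lebesgue_on ?A)" by blast
        then have "real (Suc n) * (N t - N (max 0 (t - h))) \<le> real (Suc n) * (\<integral>x. \<phi> x t \<bullet> (u x t - u x (max 0 (t - h))) \<partial>lebesgue_on ?A)"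
          by (intro mult_left_mono) auto
        then show "real (Suc n) * (N t - N (max 0 (t - h))) \<le> (\<integral>x. \<phi> x t \<bullet> q n x t \<partial>lebesgue_on ?A)"
          by (simp add: q_def h_def)
      qed
    qed
    also have "\<dots> = (\<integral>x. J n x \<partial>lebesgue_on ?A)"
      using lebesgue_Fubini(5)[OF _ _ \<phi>q[of n]] by (simp add: J_def)
    finally show ?thesis by (simp add: h_def)
  qed
  ultimately show ?thesis by (intro LIMSEQ_le) auto
qed

section \<open>Sobolev functions on an interval\<close>

lemma H1_on_has_vector_derivative:
  assumes "H1_on a b w"
  shows "AE x in lebesgue_on {a..b}. (w has_vector_derivative vector_derivative w (at x within {a..b})) (at x within {a..b})"
  using assms unfolding H1_on_def by (simp add: vector_derivative_works)

lemma H1_on_diff: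
  fixes y z :: "real \<Rightarrow> 'b::euclidean_space"
  assumes y: "H1_on a b y" and z: "H1_on a b z" and "a < b"
  shows "H1_on a b (\<lambda>x. y x - z x)"
    and "AE x in lebesgue_on {a..b}. vector_derivative (\<lambda>x. y x - z x) (at x within {a..b}) =
      vector_derivative y (at x within {a..b}) - vector_derivative z (at x within {a..b})"
proof -
  have *: "AE x in lebesgue_on {a..b}. x \<in> {a..b} \<longrightarrow> ((\<lambda>x. y x - z x) has_vector_derivative
      vector_derivative y (at x within {a..b}) - vector_derivative z (at x within {a..b})) (at x within {a..b})"
    using H1_on_has_vector_derivative[OF y] H1_on_has_vector_derivative[OF z]
    by eventually_elim (auto intro: has_vector_derivative_diff)
  show ae: "AE x in lebesgue_on {a..b}. vector_derivative (\<lambda>x. y x - z x) (at x within {a..b}) =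
      vector_derivative y (at x within {a..b}) - vector_derivative z (at x within {a..b})"
    by (rule lebesgue_on_mono[OF *]) (use \<open>a < b\<close> vector_derivative_within_cbox in fastforce)
  have ae': "AE x in lebesgue_on {a..b}. vector_derivative y (at x within {a..b}) - vector_derivative z (at x within {a..b}) =
     vector_derivative (\<lambda>x. y x - z x) (at x within {a..b})"
    using ae by eventually_elim simp
  have "AE x in lebesgue_on {a..b}. (\<lambda>x. y x - z x) differentiable (at x within {a..b})"
    by (rule lebesgue_on_mono[OF *]) (use differentiableI_vector in blast)
  moreover have "L2_on {a..b} (\<lambda>x. vector_derivative (\<lambda>x. y x - z x) (at x within {a..b}))"
    using y z by (intro L2_on_cong_AE[OF L2_on_diff ae']) (auto simp: H1_on_def)
  ultimately show "H1_on a b (\<lambda>x. y x - z x)"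
    using y z by (auto simp: H1_on_def intro: abs_cont_on_diff)
qed

lemma H1_on_L2: "H1_on a b w \<Longrightarrow> L2_on {a..b} w"
  and H1_on_L2_deriv: "H1_on a b w \<Longrightarrow> L2_on {a..b} (\<lambda>x. vector_derivative w (at x within {a..b}))"
  and H1_on_continuous: "H1_on a b w \<Longrightarrow> continuous_on {a..b} w"
  by (auto simp: H1_on_def intro: L2_on_continuous abs_cont_on_imp_continuous_on)

lemma H1_norm_squared:
  "(H1_norm w)\<^sup>2 = (\<integral>x. (norm (w x))\<^sup>2 \<partial>lebesgue_on {0..2*pi}) +
      (\<integral>x. (norm (vector_derivative w (at x within {0..2*pi})))\<^sup>2 \<partial>lebesgue_on {0..2*pi})"
  by (simp add: H1_norm_def)

text \<open>The inner product of the two functions is absolutely continuous, and periodicity equates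
  its end values.\<close>

lemma H1_on_integral_by_parts:
  fixes y z :: "real \<Rightarrow> 'b::euclidean_space"
  assumes y: "H1_on a b y" and z: "H1_on a b z" and "a \<le> b" and "y a = y b" "z a = z b"
  shows "(\<integral>x. vector_derivative y (at x within {a..b}) \<bullet> z x \<partial>lebesgue_on {a..b}) =
     - (\<integral>x. y x \<bullet> vector_derivative z (at x within {a..b}) \<partial>lebesgue_on {a..b})"
proof -
  let ?y' = "\<lambda>x. vector_derivative y (at x within {a..b})"
  let ?z' = "\<lambda>x. vector_derivative z (at x within {a..b})"
  have "AE x in lebesgue_on {a..b}. ((\<lambda>x. y x \<bullet> z x) has_vector_derivative (y x \<bullet> ?z' x + ?y' x \<bullet> z x)) (at x within {a..b})"
    using H1_on_has_vector_derivative[OF y] H1_on_has_vector_derivative[OF z]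
    by eventually_elim (rule bounded_bilinear.has_vector_derivative[OF bounded_bilinear_inner])
  moreover have "abs_cont_on a b (\<lambda>x. y x \<bullet> z x)"
    using y z by (intro abs_cont_on_bilinear[OF bounded_bilinear_inner]) (auto simp: H1_on_def)
  ultimately have "((\<lambda>x. y x \<bullet> ?z' x + ?y' x \<bullet> z x) has_integral (y b \<bullet> z b - y a \<bullet> z a)) {a..b}"
    using \<open>a \<le> b\<close> by (intro abs_cont_on_fundamental)
  then have 0: "integral {a..b} (\<lambda>x. y x \<bullet> ?z' x + ?y' x \<bullet> z x) = 0"
    using assms by (simp add: integral_unique)
  have i: "integrable (lebesgue_on {a..b}) (\<lambda>x. y x \<bullet> ?z' x)" "integrable (lebesgue_on {a..b}) (\<lambda>x. ?y' x \<bullet> z x)"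
    using y z by (auto intro!: L2_on_inner H1_on_L2 H1_on_L2_deriv)
  have "(\<integral>x. y x \<bullet> ?z' x + ?y' x \<bullet> z x \<partial>lebesgue_on {a..b}) = 0"
    using i by (subst lebesgue_integral_eq_integral) (auto simp: 0)
  then show ?thesis using i by simp
qed

text \<open>Average \<open>(norm (w x))\<^sup>2 \<le> 2 * (norm (w y))\<^sup>2 + 2 * (norm (w x - w
  y))\<^sup>2\<close> over \<open>y\<close>, the oscillation being controlled by Cauchy-Schwarz on a
  length of at most \<open>2 * pi\<close>. This turns convergence in the H1 norm into uniform
  convergence.\<close>

lemma H1_sup_bound:
  fixes w :: "real \<Rightarrow> 'b::euclidean_space"
  assumes w: "H1_on 0 (2*pi) w" and x: "x \<in> {0..2*pi}"
  shows "(norm (w x))\<^sup>2 \<le> (1 / pi + 4 * pi) * (H1_norm w)\<^sup>2"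
proof -
  let ?S = "{0..2*pi}"
  let ?w' = "\<lambda>x. vector_derivative w (at x within ?S)"
  define E where "E = (\<integral>x. (norm (w x))\<^sup>2 \<partial>lebesgue_on ?S)"
  define D where "D = (\<integral>x. (norm (?w' x))\<^sup>2 \<partial>lebesgue_on ?S)"
  have pos: "E \<ge> 0" "D \<ge> 0" by (auto simp: E_def D_def)
  have L2: "L2_on ?S w" "L2_on ?S ?w'" using w by (auto intro: H1_on_L2 H1_on_L2_deriv)
  have ED: "(H1_norm w)\<^sup>2 = E + D" by (simp add: H1_norm_squared E_def D_def)
  have D': "D = integral ?S (\<lambda>x. (norm (?w' x))\<^sup>2)"
    unfolding D_def using L2 by (intro lebesgue_integral_eq_integral) (auto simp: L2_on_def)
  have osc: "(norm (w d - w c))\<^sup>2 \<le> 2 * pi * D" if "0 \<le> c" "c \<le> d" "d \<le> 2 * pi" for c d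
  proof -
    have "(norm (w d - w c))\<^sup>2 \<le> (d - c) * integral {c..d} (\<lambda>x. (norm (?w' x))\<^sup>2)"
      using w H1_on_has_vector_derivative[OF w] L2 that
      by (intro abs_cont_on_increment(3)[of 0 "2*pi"]) (auto simp: H1_on_def)
    also have "\<dots> \<le> 2 * pi * D"
      unfolding D' using that L2_on_Icc(4)[OF L2(2)]
      by (intro mult_mono integral_subset_le) (auto intro: integral_nonneg)
    finally show ?thesis .
  qed
  have osc': "(norm (w x - w y))\<^sup>2 \<le> 2 * pi * D" if "y \<in> ?S" for y
    using osc[of y x] osc[of x y] x that by (cases "y \<le> x") (auto simp: norm_minus_commute)
  have pt: "(norm (w x))\<^sup>2 \<le> 2 * (norm (w y))\<^sup>2 + 4 * pi * D" if "y \<in> ?S" for y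
  proof -
    have "norm (w x) \<le> norm (w y) + norm (w x - w y)" by (metis add.commute norm_triangle_sub)
    then have "(norm (w x))\<^sup>2 \<le> (norm (w y) + norm (w x - w y))\<^sup>2" by (intro power_mono) auto
    also have "\<dots> \<le> 2 * (norm (w y))\<^sup>2 + 2 * (norm (w x - w y))\<^sup>2"
      using zero_le_power2[of "norm (w y) - norm (w x - w y)"] unfolding power2_diff power2_sum by simp
    finally show ?thesis using osc'[OF that] by simp
  qed
  have "integral ?S (\<lambda>y. (norm (w x))\<^sup>2) \<le> integral ?S (\<lambda>y. 2 * (norm (w y))\<^sup>2 + 4 * pi * D)"
    using pt H1_on_continuous[OF w] by (intro integral_le integrable_continuous_real continuous_intros) auto
  also have "\<dots> = 2 * integral ?S (\<lambda>y. (norm (w y))\<^sup>2) + 2 * pi * (4 * pi * D)"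
    using L2_on_Icc(4)[OF L2(1)] by (subst integral_add) auto
  also have "integral ?S (\<lambda>y. (norm (w y))\<^sup>2) = E"
    unfolding E_def using L2 by (intro lebesgue_integral_eq_integral[symmetric]) (auto simp: L2_on_def)
  finally have "2 * pi * (norm (w x))\<^sup>2 \<le> 2 * E + 2 * pi * (4 * pi * D)" by simp
  then have "(norm (w x))\<^sup>2 \<le> E / pi + 4 * pi * D" by (simp add: field_simps)
  also have "\<dots> \<le> (1 / pi + 4 * pi) * (E + D)"
  proof -
    have "0 \<le> 4 * pi * E" "0 \<le> D / pi" using pos by auto
    then show ?thesis by (simp add: algebra_simps add_divide_distrib)
  qed
  finally show ?thesis by (simp add: ED)
qed

text \<open>Expanding around \<open>g\<close>, the cross term is split by a weighted Young
  inequality, so that a small multiple of the fixed norm of \<open>g\<close> and a large multiple of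
  the vanishing distance appear.\<close>

lemma L2_norm_tendsto:
  assumes f: "\<forall>\<^sub>F s in F. L2_on S (f s)" and g: "L2_on S g"
    and lim: "((\<lambda>s. \<integral>x. (norm (f s x - g x))\<^sup>2 \<partial>lebesgue_on S) \<longlongrightarrow> 0) F"
  shows "((\<lambda>s. \<integral>x. (norm (f s x))\<^sup>2 \<partial>lebesgue_on S) \<longlongrightarrow> (\<integral>x. (norm (g x))\<^sup>2 \<partial>lebesgue_on S)) F"
proof (rule tendstoI)
  fix \<epsilon> :: real assume "\<epsilon> > 0"
  define G where "G = (\<integral>x. (norm (g x))\<^sup>2 \<partial>lebesgue_on S)"
  define \<Delta> where "\<Delta> = (\<lambda>s. \<integral>x. (norm (f s x - g x))\<^sup>2 \<partial>lebesgue_on S)"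
  have "G \<ge> 0" by (simp add: G_def)
  \<comment> \<open>The weight of the fixed norm; \<open>G + 1\<close> avoids division by zero when
    \<open>g\<close> vanishes.\<close>
  define c where "c = \<epsilon> / (2 * (G + 1))"
  have c: "c > 0" "c * G \<le> \<epsilon> / 2" using \<open>\<epsilon> > 0\<close> \<open>G \<ge> 0\<close> by (auto simp: c_def field_simps)
  have "((\<lambda>s. (1 / c + 1) * \<Delta> s) \<longlongrightarrow> (1 / c + 1) * 0) F"
    using lim unfolding \<Delta>_def by (intro tendsto_mult tendsto_const)
  then have "\<forall>\<^sub>F s in F. (1 / c + 1) * \<Delta> s < \<epsilon> / 2"
    using \<open>\<epsilon> > 0\<close> by (intro order_tendstoD(2)[where y = 0]) auto
  then show "\<forall>\<^sub>F s in F. dist (\<integral>x. (norm (f s x))\<^sup>2 \<partial>lebesgue_on S) (\<integral>x. (norm (g x))\<^sup>2 \<partial>lebesgue_on S) < \<epsilon>"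
    using f
  proof eventually_elim
    case (elim s)
    have d: "L2_on S (\<lambda>x. f s x - g x)" using elim g by (intro L2_on_diff)
    define i where "i = (\<integral>x. g x \<bullet> (f s x - g x) \<partial>lebesgue_on S)"
    have "(\<integral>x. (norm (g x + (f s x - g x)))\<^sup>2 \<partial>lebesgue_on S) = G + 2 * i + \<Delta> s"
      unfolding L2_on_norm_add[OF g d] G_def i_def \<Delta>_def ..
    then have eq: "(\<integral>x. (norm (f s x))\<^sup>2 \<partial>lebesgue_on S) = G + 2 * i + \<Delta> s" by simp
    have "2 * \<bar>\<integral>x. (sqrt c *\<^sub>R g x) \<bullet> ((1 / sqrt c) *\<^sub>R (f s x - g x)) \<partial>lebesgue_on S\<bar> \<le>
        (\<integral>x. (norm (sqrt c *\<^sub>R g x))\<^sup>2 \<partial>lebesgue_on S) + (\<integral>x. (norm ((1 / sqrt c) *\<^sub>R (f s x - g x)))\<^sup>2 \<partial>lebesgue_on S)"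
      by (intro L2_on_inner_bound L2_on_scaleR g d)
    then have "2 * \<bar>i\<bar> \<le> c * G + \<Delta> s / c"
      using c(1) by (simp add: i_def G_def \<Delta>_def power_mult_distrib power_divide)
    moreover have "0 \<le> \<Delta> s" by (simp add: \<Delta>_def)
    moreover have "(1 / c + 1) * \<Delta> s = \<Delta> s / c + \<Delta> s" by (simp add: algebra_simps)
    ultimately have "\<bar>2 * i + \<Delta> s\<bar> \<le> c * G + (1 / c + 1) * \<Delta> s" by linarith
    then have "\<bar>2 * i + \<Delta> s\<bar> < \<epsilon>" using elim(1) c(2) by linarith
    then show ?case unfolding eq G_def[symmetric] dist_real_def by simp
  qed
qed

text \<open>Completing the square against a solution \<open>c\<close> of the Riccati equation \<open>c' + c\<^sup>2 = -k\<^sup>2\<close>.\<close>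

lemma poincare_riccati:
  fixes w g :: "real \<Rightarrow> 'b::euclidean_space"
  assumes "a \<le> b" and ac: "abs_cont_on a b w"
    and der: "AE x in lebesgue_on {a..b}. (w has_vector_derivative g x) (at x within {a..b})"
    and g: "L2_on {a..b} g"
    and c: "\<And>x. x \<in> {a..b} \<Longrightarrow> (c has_real_derivative - k\<^sup>2 - (c x)\<^sup>2) (at x within {a..b})"
    and bd: "c a * (norm (w a))\<^sup>2 \<le> c b * (norm (w b))\<^sup>2"
  shows "k\<^sup>2 * integral {a..b} (\<lambda>x. (norm (w x))\<^sup>2) \<le> integral {a..b} (\<lambda>x. (norm (g x))\<^sup>2)"
proof -
  have cw: "continuous_on {a..b} w" using ac by (rule abs_cont_on_imp_continuous_on)
  have cc: "continuous_on {a..b} c" using c by (rule DERIV_continuous_on)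
  have acc: "abs_cont_on a b c"
    by (rule abs_cont_on_C1[OF c]) (auto intro!: continuous_intros cc)
  have acF: "abs_cont_on a b (\<lambda>x. c x * (w x \<bullet> w x))"
    by (intro abs_cont_on_bilinear[OF bounded_bilinear_mult] abs_cont_on_bilinear[OF bounded_bilinear_inner] acc ac)
  have "AE x in lebesgue_on {a..b}. ((\<lambda>x. c x * (w x \<bullet> w x)) has_vector_derivative
      c x * (2 * (w x \<bullet> g x)) + (- k\<^sup>2 - (c x)\<^sup>2) * (w x \<bullet> w x)) (at x within {a..b})"
  proof (rule lebesgue_on_mono[OF der])
    fix x assume x: "x \<in> {a..b}" and d: "(w has_vector_derivative g x) (at x within {a..b})"
    have "((\<lambda>x. w x \<bullet> w x) has_vector_derivative (w x \<bullet> g x + g x \<bullet> w x)) (at x within {a..b})"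
      by (rule bounded_bilinear.has_vector_derivative[OF bounded_bilinear_inner d d])
    then have "((\<lambda>x. w x \<bullet> w x) has_vector_derivative (2 * (w x \<bullet> g x))) (at x within {a..b})"
      by (simp add: inner_commute)
    from has_vector_derivative_mult[OF c[OF x, unfolded has_real_derivative_iff_has_vector_derivative] this]
    show "((\<lambda>x. c x * (w x \<bullet> w x)) has_vector_derivative
      c x * (2 * (w x \<bullet> g x)) + (- k\<^sup>2 - (c x)\<^sup>2) * (w x \<bullet> w x)) (at x within {a..b})" .
  qed
  from abs_cont_on_fundamental[OF \<open>a \<le> b\<close> acF this]
  have F: "((\<lambda>x. c x * (2 * (w x \<bullet> g x)) + (- k\<^sup>2 - (c x)\<^sup>2) * (w x \<bullet> w x)) has_integral
      (c b * (w b \<bullet> w b) - c a * (w a \<bullet> w a))) {a..b}" .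
  have g2: "(\<lambda>x. (norm (g x))\<^sup>2) integrable_on {a..b}" using L2_on_Icc(4)[OF g] by auto
  have kw2: "(\<lambda>x. k\<^sup>2 * (norm (w x))\<^sup>2) integrable_on {a..b}"
    by (intro integrable_continuous_real continuous_intros cw)
  have i: "(\<lambda>x. (norm (g x))\<^sup>2 - k\<^sup>2 * (norm (w x))\<^sup>2) integrable_on {a..b}"
    by (rule integrable_diff[OF g2 kw2])
  have "c b * (w b \<bullet> w b) - c a * (w a \<bullet> w a) \<le> integral {a..b} (\<lambda>x. (norm (g x))\<^sup>2 - k\<^sup>2 * (norm (w x))\<^sup>2)"
  proof (rule has_integral_le[OF F integrable_integral[OF i]])
    fix x
    \<comment> \<open>This square is exactly the difference of the two sides.\<close>
    have "0 \<le> (g x - c x *\<^sub>R w x) \<bullet> (g x - c x *\<^sub>R w x)" by simp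
    then show "c x * (2 * (w x \<bullet> g x)) + (- k\<^sup>2 - (c x)\<^sup>2) * (w x \<bullet> w x) \<le> (norm (g x))\<^sup>2 - k\<^sup>2 * (norm (w x))\<^sup>2"
      unfolding power2_norm_eq_inner
      by (simp add: inner_diff_left inner_diff_right inner_commute power2_eq_square algebra_simps)
  qed
  also have "\<dots> = integral {a..b} (\<lambda>x. (norm (g x))\<^sup>2) - k\<^sup>2 * integral {a..b} (\<lambda>x. (norm (w x))\<^sup>2)"
    by (subst integral_diff[OF g2 kw2]) simp
  finally show ?thesis using bd by (simp add: power2_norm_eq_inner)
qed

text \<open>Split at \<open>pi\<close>: each half is an interval of length \<open>pi\<close> with
  the function zero at one end and free at the other. The lowest eigenvalue of that mixed problem is
  \<open>1 / 4\<close>, whence the factor \<open>4\<close>. The Riccati solution is a cotangent of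
  the distance from \<open>pi\<close>, which for \<open>k = 1 / 2\<close> would be singular at
  \<open>pi\<close>; hence \<open>k < 1 / 2\<close> first and a limit afterwards.\<close>

lemma poincare_midpoint:
  fixes w :: "real \<Rightarrow> 'b::euclidean_space"
  assumes w: "H1_on 0 (2*pi) w"
  shows "(\<integral>x. (norm (w x - w pi))\<^sup>2 \<partial>lebesgue_on {0..2*pi}) \<le>
    4 * (\<integral>x. (norm (vector_derivative w (at x within {0..2*pi})))\<^sup>2 \<partial>lebesgue_on {0..2*pi})"
proof -
  let ?S = "{0..2*pi}"
  let ?g = "\<lambda>x. vector_derivative w (at x within ?S)"
  define f where "f = (\<lambda>x. w x - w pi)"
  have acw: "abs_cont_on 0 (2*pi) w" and g: "L2_on ?S ?g" using w by (auto simp: H1_on_def)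
  have ac: "abs_cont_on 0 (2*pi) f" unfolding f_def by (intro abs_cont_on_diff acw abs_cont_on_const)
  have der: "AE x in lebesgue_on ?S. (f has_vector_derivative ?g x) (at x within ?S)"
    using H1_on_has_vector_derivative[OF w]
    by eventually_elim (auto simp: f_def has_vector_derivative_diff_const)
  have sub: "abs_cont_on a b f" "L2_on {a..b} ?g"
      "AE x in lebesgue_on {a..b}. (f has_vector_derivative ?g x) (at x within {a..b})"
    if "0 \<le> a" "b \<le> 2 * pi" for a b
  proof -
    have s: "{a..b} \<subseteq> ?S" using that by auto
    show "abs_cont_on a b f" by (rule abs_cont_on_subinterval[OF ac s])
    show "L2_on {a..b} ?g" by (rule L2_on_subset[OF g s]) auto
    show "AE x in lebesgue_on {a..b}. (f has_vector_derivative ?g x) (at x within {a..b})"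
      using der s by (auto simp: AE_lebesgue_on_iff elim!: eventually_mono intro: has_vector_derivative_within_subset)
  qed
  have cf: "continuous_on ?S f" using ac by (rule abs_cont_on_imp_continuous_on)
  have if2: "(\<lambda>x. (norm (f x))\<^sup>2) integrable_on {a..b}" if "0 \<le> a" "b \<le> 2 * pi" for a b
    using that by (intro integrable_continuous_real continuous_intros continuous_on_subset[OF cf]) auto
  have ig2: "(\<lambda>x. (norm (?g x))\<^sup>2) integrable_on {a..b}" if "0 \<le> a" "b \<le> 2 * pi" for a b
    using L2_on_Icc(4)[OF g] that by auto
  have main: "k\<^sup>2 * integral ?S (\<lambda>x. (norm (f x))\<^sup>2) \<le> integral ?S (\<lambda>x. (norm (?g x))\<^sup>2)"
    if k: "0 < k" "k < 1 / 2" for k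
  proof -
    \<comment> \<open>The phase moves the pole of the cotangent off the interval and places its zero
      at the free end, where the argument is \<open>pi / 2\<close>.\<close>
    define \<theta> where "\<theta> = pi / 2 - k * pi"
    have "k * pi < 1 / 2 * pi" using k by (intro mult_strict_right_mono) auto
    then have \<theta>: "\<theta> > 0" by (simp add: \<theta>_def)
    have rng: "0 < k * z + \<theta>" "k * z + \<theta> \<le> pi / 2" if "0 \<le> z" "z \<le> pi" for z
    proof -
      have "0 \<le> k * z" "k * z \<le> k * pi" using that k by auto
      then show "0 < k * z + \<theta>" using \<theta> by linarith
      show "k * z + \<theta> \<le> pi / 2" unfolding \<theta>_def using \<open>k * z \<le> k * pi\<close> by linarith
    qed
    have sinp: "sin (k * z + \<theta>) > 0" if "0 \<le> z" "z \<le> pi" for z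
      using rng[OF that] by (intro sin_gt_zero) auto
    have cotp: "cot (k * z + \<theta>) \<ge> 0" if "0 \<le> z" "z \<le> pi" for z
      using rng[OF that] sinp[OF that] by (auto simp: cot_def intro!: divide_nonneg_pos cos_ge_zero)
    have csc: "inverse ((sin y)\<^sup>2) = 1 + (cot y)\<^sup>2" if "sin y > 0" for y :: real
      using that sin_cos_squared_add[of y] by (simp add: cot_def power_divide field_simps)
    have sum_le: "q * C \<le> d" if "q * A \<le> b" "q * B \<le> c" "A + B = C" "b + c = d" for q A B C b c d :: real
    proof -
      have "q * C = q * A + q * B" using that(3) by (simp add: distrib_left[symmetric])
      then show ?thesis using that by linarith
    qed
    have "k\<^sup>2 * integral {0..pi} (\<lambda>x. (norm (f x))\<^sup>2) \<le> integral {0..pi} (\<lambda>x. (norm (?g x))\<^sup>2)"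
    proof (rule poincare_riccati[where c = "\<lambda>x. - k * cot (k * (pi - x) + \<theta>)"])
      fix x assume "x \<in> {0..pi}"
      then have s: "sin (k * (pi - x) + \<theta>) > 0" by (intro sinp) auto
      have d: "((\<lambda>x. k * (pi - x) + \<theta>) has_real_derivative - k) (at x within {0..pi})"
        by (auto intro!: derivative_eq_intros)
      have "- k\<^sup>2 - (- k * cot (k * (pi - x) + \<theta>))\<^sup>2 = - k * (- inverse ((sin (k * (pi - x) + \<theta>))\<^sup>2) * - k)"
        unfolding csc[OF s] by (simp add: power2_eq_square algebra_simps)
      then show "((\<lambda>x. - k * cot (k * (pi - x) + \<theta>)) has_real_derivative - k\<^sup>2 - (- k * cot (k * (pi - x) + \<theta>))\<^sup>2) (at x within {0..pi})"
        using DERIV_cmult[OF DERIV_chain2[OF DERIV_cot[OF less_imp_neq[OF s, symmetric]] d], of "- k"] by (simp only:)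
    next
      have "0 \<le> k * cot (k * pi + \<theta>) * (norm (f 0))\<^sup>2" using cotp[of pi] k by simp
      then show "- k * cot (k * (pi - 0) + \<theta>) * (norm (f 0))\<^sup>2 \<le> - k * cot (k * (pi - pi) + \<theta>) * (norm (f pi))\<^sup>2"
        by (simp add: f_def)
    qed (use sub[of 0 pi] in auto)
    moreover have "k\<^sup>2 * integral {pi..2*pi} (\<lambda>x. (norm (f x))\<^sup>2) \<le> integral {pi..2*pi} (\<lambda>x. (norm (?g x))\<^sup>2)"
    proof (rule poincare_riccati[where c = "\<lambda>x. k * cot (k * (x - pi) + \<theta>)"])
      fix x assume "x \<in> {pi..2*pi}"
      then have s: "sin (k * (x - pi) + \<theta>) > 0" by (intro sinp) auto
      have d: "((\<lambda>x. k * (x - pi) + \<theta>) has_real_derivative k) (at x within {pi..2*pi})"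
        by (auto intro!: derivative_eq_intros)
      have "- k\<^sup>2 - (k * cot (k * (x - pi) + \<theta>))\<^sup>2 = k * (- inverse ((sin (k * (x - pi) + \<theta>))\<^sup>2) * k)"
        unfolding csc[OF s] by (simp add: power2_eq_square algebra_simps)
      then show "((\<lambda>x. k * cot (k * (x - pi) + \<theta>)) has_real_derivative - k\<^sup>2 - (k * cot (k * (x - pi) + \<theta>))\<^sup>2) (at x within {pi..2*pi})"
        using DERIV_cmult[OF DERIV_chain2[OF DERIV_cot[OF less_imp_neq[OF s, symmetric]] d], of "k"] by (simp only:)
    next
      have "0 \<le> k * cot (k * pi + \<theta>) * (norm (f (2*pi)))\<^sup>2" using cotp[of pi] k by simp
      then show "k * cot (k * (pi - pi) + \<theta>) * (norm (f pi))\<^sup>2 \<le> k * cot (k * (2*pi - pi) + \<theta>) * (norm (f (2*pi)))\<^sup>2"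
        by (simp add: f_def)
    qed (use sub[of pi "2*pi"] in auto)
    moreover have "integral {0..pi} (\<lambda>x. (norm (f x))\<^sup>2) + integral {pi..2*pi} (\<lambda>x. (norm (f x))\<^sup>2) = integral ?S (\<lambda>x. (norm (f x))\<^sup>2)"
      by (intro Henstock_Kurzweil_Integration.integral_combine if2) auto
    moreover have "integral {0..pi} (\<lambda>x. (norm (?g x))\<^sup>2) + integral {pi..2*pi} (\<lambda>x. (norm (?g x))\<^sup>2) = integral ?S (\<lambda>x. (norm (?g x))\<^sup>2)"
      by (intro Henstock_Kurzweil_Integration.integral_combine ig2) auto
    ultimately show ?thesis by (rule sum_le)
  qed
  have "integral ?S (\<lambda>x. (norm (f x))\<^sup>2) \<le> 4 * integral ?S (\<lambda>x. (norm (?g x))\<^sup>2)"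
  \<comment> \<open>The limit \<open>k\<close> to \<open>1 / 2\<close>, taken through
    \<open>k = sqrt z / 2\<close> with \<open>z\<close> below \<open>1\<close>.\<close>
  proof (rule field_le_mult_one_interval)
    fix z :: real assume z: "0 < z" "z < 1"
    have "(sqrt z / 2)\<^sup>2 * integral ?S (\<lambda>x. (norm (f x))\<^sup>2) \<le> integral ?S (\<lambda>x. (norm (?g x))\<^sup>2)"
      using z by (intro main) auto
    then show "z * integral ?S (\<lambda>x. (norm (f x))\<^sup>2) \<le> 4 * integral ?S (\<lambda>x. (norm (?g x))\<^sup>2)"
      using z by (simp add: power_divide)
  qed
  moreover have "(\<integral>x. (norm (f x))\<^sup>2 \<partial>lebesgue_on ?S) = integral ?S (\<lambda>x. (norm (f x))\<^sup>2)"
    using L2_on_continuous[OF _ cf] by (intro lebesgue_integral_eq_integral) (auto simp: L2_on_def)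
  moreover have "(\<integral>x. (norm (?g x))\<^sup>2 \<partial>lebesgue_on ?S) = integral ?S (\<lambda>x. (norm (?g x))\<^sup>2)"
    using g by (intro lebesgue_integral_eq_integral) (auto simp: L2_on_def)
  ultimately show ?thesis by (simp add: f_def)
qed

section \<open>Strong solutions\<close>

text \<open>Integration by parts makes \<open>\<phi>\<close> the gradient of \<open>N\<close> at
  \<open>y\<close> on periodic functions. The first inequality has slack equal to \<open>N\<close>
  of \<open>y - k z\<close>; the second claim is Euler's identity for a quadratic form. The factor
  \<open>k\<close> lets the comparison be made after exponential weighting in time.\<close>

lemma H1_energy_convex:
  fixes y z :: "real \<Rightarrow> 'b::euclidean_space"
  assumes y: "H1_on l u y" and y': "H1_on l u y'" and z: "H1_on l u z" and lu: "l \<le> u"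
    and y'_def: "y' = (\<lambda>x. vector_derivative y (at x within {l..u}))"
    and per: "y l = y u" "y' l = y' u" "z l = z u" and pos: "\<alpha> \<ge> 0" "\<beta> \<ge> 0"
  defines "N \<equiv> \<lambda>w. \<alpha> * (\<integral>x. (norm (w x))\<^sup>2 \<partial>lebesgue_on {l..u}) +
      \<beta> * (\<integral>x. (norm (vector_derivative w (at x within {l..u})))\<^sup>2 \<partial>lebesgue_on {l..u})"
    and "\<phi> \<equiv> \<lambda>x. (2 * \<alpha>) *\<^sub>R y x - (2 * \<beta>) *\<^sub>R vector_derivative y' (at x within {l..u})"
  shows "N y - k\<^sup>2 * N z \<le> (\<integral>x. \<phi> x \<bullet> (y x - k *\<^sub>R z x) \<partial>lebesgue_on {l..u})"
    and "(\<integral>x. \<phi> x \<bullet> y x \<partial>lebesgue_on {l..u}) = 2 * N y"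
proof -
  let ?M = "lebesgue_on {l..u}"
  define z' where "z' = (\<lambda>x. vector_derivative z (at x within {l..u}))"
  define y'' where "y'' = (\<lambda>x. vector_derivative y' (at x within {l..u}))"
  have L2: "L2_on {l..u} y" "L2_on {l..u} y'" "L2_on {l..u} y''" "L2_on {l..u} z" "L2_on {l..u} z'"
    using y y' z by (auto simp: z'_def y''_def intro: H1_on_L2 H1_on_L2_deriv)
  have \<phi>w: "(\<integral>x. \<phi> x \<bullet> w x \<partial>?M) = 2 * \<alpha> * (\<integral>x. y x \<bullet> w x \<partial>?M) + 2 * \<beta> * (\<integral>x. y' x \<bullet> w' x \<partial>?M)"
    if w: "H1_on l u w" "w l = w u" and w': "w' = (\<lambda>x. vector_derivative w (at x within {l..u}))" for w w'
  proof -
    have "(\<integral>x. w' x \<bullet> y' x \<partial>?M) = - (\<integral>x. w x \<bullet> y'' x \<partial>?M)"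
      unfolding w' y''_def using w y' lu per by (intro H1_on_integral_by_parts) auto
    then have parts: "(\<integral>x. y' x \<bullet> w' x \<partial>?M) = - (\<integral>x. y'' x \<bullet> w x \<partial>?M)" by (simp add: inner_commute)
    have "(\<integral>x. \<phi> x \<bullet> w x \<partial>?M) = (\<integral>x. (2 * \<alpha>) * (y x \<bullet> w x) - (2 * \<beta>) * (y'' x \<bullet> w x) \<partial>?M)"
      by (simp add: \<phi>_def y''_def inner_diff_left)
    also have "\<dots> = 2 * \<alpha> * (\<integral>x. y x \<bullet> w x \<partial>?M) - 2 * \<beta> * (\<integral>x. y'' x \<bullet> w x \<partial>?M)"
      using L2_on_inner[OF L2(1) H1_on_L2[OF w(1)]] L2_on_inner[OF L2(3) H1_on_L2[OF w(1)]] by simp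
    finally show ?thesis using parts by simp
  qed
  have Ny: "N y = \<alpha> * (\<integral>x. (norm (y x))\<^sup>2 \<partial>?M) + \<beta> * (\<integral>x. (norm (y' x))\<^sup>2 \<partial>?M)"
    by (simp add: N_def y'_def)
  have Nz: "N z = \<alpha> * (\<integral>x. (norm (z x))\<^sup>2 \<partial>?M) + \<beta> * (\<integral>x. (norm (z' x))\<^sup>2 \<partial>?M)"
    by (simp add: N_def z'_def)
  have \<phi>y: "(\<integral>x. \<phi> x \<bullet> y x \<partial>?M) = 2 * N y"
    unfolding \<phi>w[OF y per(1) y'_def] Ny by (simp add: power2_norm_eq_inner algebra_simps)
  then show "(\<integral>x. \<phi> x \<bullet> y x \<partial>?M) = 2 * N y" .
  have \<phi>L2: "L2_on {l..u} \<phi>"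
  proof -
    have "\<phi> = (\<lambda>x. (2 * \<alpha>) *\<^sub>R y x - (2 * \<beta>) *\<^sub>R y'' x)" by (simp add: \<phi>_def y''_def)
    then show ?thesis using L2 by (auto intro: L2_on_diff L2_on_scaleR)
  qed
  have sq: "0 \<le> (\<integral>x. (norm (f x))\<^sup>2 \<partial>?M) - 2 * k * (\<integral>x. f x \<bullet> g x \<partial>?M) + k\<^sup>2 * (\<integral>x. (norm (g x))\<^sup>2 \<partial>?M)"
    if "L2_on {l..u} f" "L2_on {l..u} g" for f g :: "real \<Rightarrow> 'b"
  proof -
    have "0 \<le> (\<integral>x. (norm (f x + (- k) *\<^sub>R g x))\<^sup>2 \<partial>?M)" by simp
    also have "\<dots> = (\<integral>x. (norm (f x))\<^sup>2 \<partial>?M) - 2 * k * (\<integral>x. f x \<bullet> g x \<partial>?M) + k\<^sup>2 * (\<integral>x. (norm (g x))\<^sup>2 \<partial>?M)"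
      unfolding L2_on_norm_add[OF that(1) L2_on_scaleR[OF that(2)]] by (simp add: power_mult_distrib)
    finally show ?thesis .
  qed
  have "(\<integral>x. \<phi> x \<bullet> (y x - k *\<^sub>R z x) \<partial>?M) = (\<integral>x. \<phi> x \<bullet> y x - k * (\<phi> x \<bullet> z x) \<partial>?M)"
    by (simp add: inner_diff_right)
  also have "\<dots> = 2 * N y - k * (\<integral>x. \<phi> x \<bullet> z x \<partial>?M)"
    using L2_on_inner[OF \<phi>L2 L2(1)] L2_on_inner[OF \<phi>L2 L2(4)] \<phi>y by simp
  finally have "(\<integral>x. \<phi> x \<bullet> (y x - k *\<^sub>R z x) \<partial>?M) - (N y - k\<^sup>2 * N z) =
      \<alpha> * ((\<integral>x. (norm (y x))\<^sup>2 \<partial>?M) - 2 * k * (\<integral>x. y x \<bullet> z x \<partial>?M) + k\<^sup>2 * (\<integral>x. (norm (z x))\<^sup>2 \<partial>?M)) +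
      \<beta> * ((\<integral>x. (norm (y' x))\<^sup>2 \<partial>?M) - 2 * k * (\<integral>x. y' x \<bullet> z' x \<partial>?M) + k\<^sup>2 * (\<integral>x. (norm (z' x))\<^sup>2 \<partial>?M))"
    unfolding \<phi>w[OF z per(3) z'_def] Ny Nz by (simp add: algebra_simps)
  also have "\<dots> \<ge> 0" using pos sq[OF L2(1,4)] sq[OF L2(2,5)] by simp
  finally show "N y - k\<^sup>2 * N z \<le> (\<integral>x. \<phi> x \<bullet> (y x - k *\<^sub>R z x) \<partial>?M)" by simp
qed

section \<open>Regularity of the error in space and time\<close>

locale solution =
  fixes a K :: real and \<tau> :: "real \<Rightarrow> real" and e :: "real \<Rightarrow> real \<Rightarrow> real^3"
  assumes sol: "strong_solution a K \<tau> e"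
begin

abbreviation "\<Omega> \<equiv> {0..2*pi}"

definition "E t = (\<integral>x. (norm (e x t))\<^sup>2 \<partial>lebesgue_on \<Omega>)"
definition "D t = (\<integral>x. (norm (dx e x t))\<^sup>2 \<partial>lebesgue_on \<Omega>)"
definition "F t = (\<integral>x. (norm (dt e x t))\<^sup>2 \<partial>lebesgue_on \<Omega>)"

lemma E_nonneg [simp]: "E t \<ge> 0" and D_nonneg [simp]: "D t \<ge> 0" and F_nonneg [simp]: "F t \<ge> 0"
  by (simp_all add: E_def D_def F_def)

lemma e_clip: "x \<in> \<Omega> \<Longrightarrow> e x t = e x (max 0 t)"
  using sol by (cases "t < 0") (auto simp: strong_solution_def)

lemma H1_slice: "t \<ge> 0 \<Longrightarrow> H1_on 0 (2*pi) (\<lambda>x. e x t)"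
  and periodic: "t \<ge> 0 \<Longrightarrow> e 0 t = e (2*pi) t"
  using sol by (auto simp: strong_solution_def X_space_def)

lemma slice_L2: "t \<ge> 0 \<Longrightarrow> L2_on \<Omega> (\<lambda>x. e x t)"
  and dx_L2: "t \<ge> 0 \<Longrightarrow> L2_on \<Omega> (\<lambda>x. dx e x t)"
  using H1_on_L2[OF H1_slice] H1_on_L2_deriv[OF H1_slice] by (auto simp: dx_def)

lemma H1_norm_slice: "(H1_norm (\<lambda>x. e x t))\<^sup>2 = E t + D t"
  by (simp add: H1_norm_squared E_def D_def dx_def)

lemma H1_norm_tendsto: "t \<ge> 0 \<Longrightarrow> ((\<lambda>s. (H1_norm (\<lambda>x. e x s - e x t))\<^sup>2) \<longlongrightarrow> 0) (at t within {0..})"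
  using sol tendsto_power[of "\<lambda>s. H1_norm (\<lambda>x. e x s - e x t)" 0 "at t within {0..}" 2]
  by (auto simp: strong_solution_def)

text \<open>The norm of a difference involves the derivative of that difference, which equals the
  difference of the derivatives only almost everywhere; at the level of integrals the two
  agree.\<close>

lemma H1_norm_diff:
  assumes "s \<ge> 0" "t \<ge> 0"
  shows "(H1_norm (\<lambda>x. e x s - e x t))\<^sup>2 =
    (\<integral>x. (norm (e x s - e x t))\<^sup>2 \<partial>lebesgue_on \<Omega>) + (\<integral>x. (norm (dx e x s - dx e x t))\<^sup>2 \<partial>lebesgue_on \<Omega>)"
proof -
  note d = H1_on_diff[OF H1_slice[OF assms(1)] H1_slice[OF assms(2)]]
  have "(\<integral>x. (norm (vector_derivative (\<lambda>x. e x s - e x t) (at x within \<Omega>)))\<^sup>2 \<partial>lebesgue_on \<Omega>) =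
      (\<integral>x. (norm (dx e x s - dx e x t))\<^sup>2 \<partial>lebesgue_on \<Omega>)"
  proof (rule integral_cong_AE)
    show "AE x in lebesgue_on \<Omega>. (norm (vector_derivative (\<lambda>x. e x s - e x t) (at x within \<Omega>)))\<^sup>2 = (norm (dx e x s - dx e x t))\<^sup>2"
      using d(2) by (auto simp: dx_def elim: eventually_mono)
    show "(\<lambda>x. (norm (vector_derivative (\<lambda>x. e x s - e x t) (at x within \<Omega>)))\<^sup>2) \<in> borel_measurable (lebesgue_on \<Omega>)"
      using H1_on_L2_deriv[OF d(1)] by (auto simp: L2_on_def)
    show "(\<lambda>x. (norm (dx e x s - dx e x t))\<^sup>2) \<in> borel_measurable (lebesgue_on \<Omega>)"
      using L2_on_diff[OF dx_L2[OF assms(1)] dx_L2[OF assms(2)]] by (auto simp: L2_on_def)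
  qed
  then show ?thesis by (simp add: H1_norm_squared)
qed

lemma continuous_E: "continuous_on {0..} E" and continuous_D: "continuous_on {0..} D"
proof -
  have nn: "\<forall>\<^sub>F s in at t within {0..}. s \<ge> 0" for t :: real
    by (auto simp: eventually_at_filter)
  have "(E \<longlongrightarrow> E t) (at t within {0..}) \<and> (D \<longlongrightarrow> D t) (at t within {0..})" if t: "t \<ge> 0" for t
  proof
    have le: "\<forall>\<^sub>F s in at t within {0..}. (H1_norm (\<lambda>x. e x s - e x t))\<^sup>2 =
        (\<integral>x. (norm (e x s - e x t))\<^sup>2 \<partial>lebesgue_on \<Omega>) + (\<integral>x. (norm (dx e x s - dx e x t))\<^sup>2 \<partial>lebesgue_on \<Omega>)"
      using nn[of t] by eventually_elim (use H1_norm_diff t in auto)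
    have "((\<lambda>s. \<integral>x. (norm (e x s - e x t))\<^sup>2 \<partial>lebesgue_on \<Omega>) \<longlongrightarrow> 0) (at t within {0..})"
      by (rule tendsto_sandwich[OF _ _ tendsto_const H1_norm_tendsto[OF t]])
        (simp, use le in \<open>eventually_elim, simp\<close>)
    then have "\<forall>\<^sub>F s in at t within {0..}. L2_on \<Omega> (\<lambda>x. e x s) \<Longrightarrow> (E \<longlongrightarrow> E t) (at t within {0..})"
      unfolding E_def by (intro L2_norm_tendsto slice_L2 t)
    moreover have "\<forall>\<^sub>F s in at t within {0..}. L2_on \<Omega> (\<lambda>x. e x s)"
      using nn[of t] by eventually_elim (rule slice_L2)
    ultimately show "(E \<longlongrightarrow> E t) (at t within {0..})" by blast
    have "((\<lambda>s. \<integral>x. (norm (dx e x s - dx e x t))\<^sup>2 \<partial>lebesgue_on \<Omega>) \<longlongrightarrow> 0) (at t within {0..})"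
      by (rule tendsto_sandwich[OF _ _ tendsto_const H1_norm_tendsto[OF t]])
        (simp, use le in \<open>eventually_elim, simp\<close>)
    then have "\<forall>\<^sub>F s in at t within {0..}. L2_on \<Omega> (\<lambda>x. dx e x s) \<Longrightarrow> (D \<longlongrightarrow> D t) (at t within {0..})"
      unfolding D_def by (intro L2_norm_tendsto dx_L2 t)
    moreover have "\<forall>\<^sub>F s in at t within {0..}. L2_on \<Omega> (\<lambda>x. dx e x s)"
      using nn[of t] by eventually_elim (rule dx_L2)
    ultimately show "(D \<longlongrightarrow> D t) (at t within {0..})" by blast
  qed
  then show "continuous_on {0..} E" "continuous_on {0..} D"
    unfolding continuous_on_def by auto
qed

text \<open>Continuity in time is uniform in space by the sup bound, and continuity in space is
  known at the limiting time. The joint statement ensures that time difference quotients are square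
  integrable on the rectangle.\<close>

lemma continuous_e: "continuous_on (\<Omega> \<times> {0..}) (\<lambda>(x, t). e x t)"
  unfolding continuous_on_def
proof (intro ballI)
  fix z assume "z \<in> \<Omega> \<times> {0::real..}"
  then obtain x t where z: "z = (x, t)" and x: "x \<in> \<Omega>" and t: "t \<ge> 0" by auto
  define C where "C = sqrt (1 / pi + 4 * pi)"
  have Cpos: "0 \<le> 1 / pi + 4 * pi" by simp
  have sup: "norm (e y s - e y t) \<le> C * H1_norm (\<lambda>x. e x s - e x t)" if "y \<in> \<Omega>" "s \<ge> 0" for y s
  proof -
    have "(norm (e y s - e y t))\<^sup>2 \<le> (1 / pi + 4 * pi) * (H1_norm (\<lambda>x. e x s - e x t))\<^sup>2"
      using that t by (intro H1_sup_bound H1_on_diff H1_slice) auto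
    then have "(norm (e y s - e y t))\<^sup>2 \<le> (C * H1_norm (\<lambda>x. e x s - e x t))\<^sup>2"
      using Cpos by (simp add: C_def power_mult_distrib)
    moreover have "0 \<le> C * H1_norm (\<lambda>x. e x s - e x t)" by (simp add: C_def H1_norm_def)
    ultimately show ?thesis by (rule power2_le_imp_le)
  qed
  let ?F = "at z within \<Omega> \<times> {0..}"
  have H: "((\<lambda>s. H1_norm (\<lambda>x. e x s - e x t)) \<longlongrightarrow> 0) (at t within {0..})"
    using sol t by (auto simp: strong_solution_def)
  have H0: "H1_norm (\<lambda>x. e x t - e x t) = 0" using H1_norm_diff[OF t t] by simp
  have "continuous (at t within {0..}) (\<lambda>s. H1_norm (\<lambda>x. e x s - e x t))"
    unfolding continuous_within H0 by (rule H)
  have ev: "\<forall>\<^sub>F w in ?F. w \<in> \<Omega> \<times> {0..}" by (simp add: eventually_at_filter)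
  have fs: "(fst \<longlongrightarrow> x) ?F" "(snd \<longlongrightarrow> t) ?F"
    using tendsto_fst[OF tendsto_ident_at[of z]] tendsto_snd[OF tendsto_ident_at[of z]] by (auto simp: z)
  have "\<forall>\<^sub>F w in ?F. snd w \<in> {0..}" using ev by eventually_elim auto
  from continuous_within_tendsto_compose[OF \<open>continuous (at t within {0..}) _\<close> this fs(2)]
  have "((\<lambda>w. H1_norm (\<lambda>x. e x (snd w) - e x t)) \<longlongrightarrow> H1_norm (\<lambda>x. e x t - e x t)) ?F" .
  then have "((\<lambda>w. C * H1_norm (\<lambda>x. e x (snd w) - e x t)) \<longlongrightarrow> C * 0) ?F"
    unfolding H0 by (intro tendsto_mult tendsto_const)
  then have lim0: "((\<lambda>w. C * H1_norm (\<lambda>x. e x (snd w) - e x t)) \<longlongrightarrow> 0) ?F" by simp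
  have "\<forall>\<^sub>F w in ?F. norm (e (fst w) (snd w) - e (fst w) t) \<le> norm (C * H1_norm (\<lambda>x. e x (snd w) - e x t)) * 1"
    using ev
  proof eventually_elim
    case (elim w)
    then have "norm (e (fst w) (snd w) - e (fst w) t) \<le> C * H1_norm (\<lambda>x. e x (snd w) - e x t)" by (intro sup) auto
    then show ?case by simp
  qed
  from tendsto_0_le[OF lim0 this] have lim1: "((\<lambda>w. e (fst w) (snd w) - e (fst w) t) \<longlongrightarrow> 0) ?F" .
  have "continuous_on \<Omega> (\<lambda>x. e x t)" using H1_on_continuous[OF H1_slice[OF t]] .
  then have "continuous (at x within \<Omega>) (\<lambda>x. e x t)" using x by (simp add: continuous_on_eq_continuous_within)
  moreover have "\<forall>\<^sub>F w in ?F. fst w \<in> \<Omega>" using ev by eventually_elim auto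
  ultimately have lim2: "((\<lambda>w. e (fst w) t) \<longlongrightarrow> e x t) ?F"
    by (rule continuous_within_tendsto_compose[OF _ _ fs(1)])
  show "((\<lambda>(x, t). e x t) \<longlongrightarrow> (case z of (x, t) \<Rightarrow> e x t)) ?F"
    using tendsto_add[OF lim1 lim2] by (simp add: z split_def)
qed

lemma e_time_derivative:
  assumes "T > 0"
  shows "AE x in lebesgue_on \<Omega>. abs_cont_on 0 T (e x) \<and>
    (AE t in lebesgue_on {0..T}. (e x has_vector_derivative dt e x t) (at t within {0..T}))"
proof -
  have "AE x in lebesgue_on \<Omega>. H1_on 0 T (\<lambda>t. e x t)"
    using sol assms by (auto simp: strong_solution_def)
  then show ?thesis
  proof eventually_elim
    case (elim x)
    \<comment> \<open>\<open>dt\<close> refers to the half-line; away from the right end point its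
      derivatives coincide with those within \<open>{0..T}\<close>.\<close>
    have "AE t in lebesgue_on {0..T}. t \<noteq> T"
      by (simp add: AE_lebesgue_on_iff) (use AE_lborel_singleton[of T] in \<open>auto elim: eventually_mono\<close>)
    with H1_on_has_vector_derivative[OF elim]
    have "AE t in lebesgue_on {0..T}. t \<in> {0..T} \<longrightarrow> (e x has_vector_derivative dt e x t) (at t within {0..T})"
    proof eventually_elim
      case (elim t)
      show ?case
      proof
        assume "t \<in> {0..T}"
        then have "at t within {0..T} = at t within {0..}"
          using elim by (intro at_within_nhd[of _ "{..<T}"]) auto
        then show "(e x has_vector_derivative dt e x t) (at t within {0..T})"
          using elim by (simp add: dt_def)
      qed
    qed
    then have "AE t in lebesgue_on {0..T}. (e x has_vector_derivative dt e x t) (at t within {0..T})"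
      by (rule lebesgue_on_mono) auto
    then show ?case using elim by (simp add: H1_on_def)
  qed
qed

lemma rect_L2:
  assumes "T > 0"
  shows "L2_on (\<Omega> \<times> {0..T}) (\<lambda>(x, t). e x t)" "L2_on (\<Omega> \<times> {0..T}) (\<lambda>(x, t). dx (dx e) x t)"
    "L2_on (\<Omega> \<times> {0..T}) (\<lambda>(x, t). dt e x t)"
  using sol assms by (auto simp: strong_solution_def)

lemma AE_time_subset:
  "AE t in lebesgue_on {0..}. P t \<Longrightarrow> AE t in lebesgue_on {0..T::real}. P t"
  by (auto simp: AE_lebesgue_on_iff elim: eventually_mono)

lemma AE_H2: "AE t in lebesgue_on {0..T}. H2 (\<lambda>x. e x t) \<and> dx e 0 t = dx e (2*pi) t"
  by (rule AE_time_subset) (use sol in \<open>simp add: strong_solution_def\<close>)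

lemma AE_equation:
  "AE t in lebesgue_on {0..T}. AE x in lebesgue_on \<Omega>.
     dt e x t = a *\<^sub>R dx (dx e) x t - K *\<^sub>R e pi (t - \<tau> t)"
proof (rule AE_time_subset)
  have "AE z in lebesgue_on (\<Omega> \<times> {0..}). case z of (x, t) \<Rightarrow> dt e x t = a *\<^sub>R dx (dx e) x t - K *\<^sub>R e pi (t - \<tau> t)"
    using sol by (simp add: strong_solution_def)
  from AE_lebesgue_on_Times[OF _ _ this]
  show "AE t in lebesgue_on {0..}. AE x in lebesgue_on \<Omega>. dt e x t = a *\<^sub>R dx (dx e) x t - K *\<^sub>R e pi (t - \<tau> t)"
    by simp
qed

text \<open>The weight is put on the solution: the energy of
  \<open>exp (\<kappa> * t) *\<^sub>R e x t\<close> is \<open>exp (2 * \<kappa> * t) * N t\<close>,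
  so the unweighted convexity argument applies to it. The product rule is then needed only for time
  slices, and the extra part of the derivative pairs with \<open>\<phi>\<close> to give
  \<open>2 * \<kappa> * N t\<close> by Euler's identity.\<close>

lemma weighted_energy:
  fixes \<alpha> \<beta> \<kappa> T :: real
  assumes T: "T > 0" and pos: "\<alpha> \<ge> 0" "\<beta> \<ge> 0"
  defines "N \<equiv> \<lambda>t. \<alpha> * E t + \<beta> * D t"
    and "\<phi> \<equiv> \<lambda>x t. (2 * \<alpha>) *\<^sub>R e x t - (2 * \<beta>) *\<^sub>R dx (dx e) x t"
  shows "integrable (lebesgue_on {0..T}) (\<lambda>t. \<integral>x. \<phi> x t \<bullet> dt e x t \<partial>lebesgue_on \<Omega>)"
    and "exp (2 * \<kappa> * T) * N T - N 0 \<le>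
      (\<integral>t. exp (2 * \<kappa> * t) * (2 * \<kappa> * N t + (\<integral>x. \<phi> x t \<bullet> dt e x t \<partial>lebesgue_on \<Omega>)) \<partial>lebesgue_on {0..T})"
proof -
  let ?R = "\<Omega> \<times> {0..T}"
  have comp: "compact ?R" by (intro compact_Times) auto
  then have Rm: "?R \<in> sets lebesgue" by (simp add: compact_imp_closed)
  have ce: "continuous_on ?R (\<lambda>(x, t). e x t)"
    by (rule continuous_on_subset[OF continuous_e]) auto
  have \<phi>: "L2_on ?R (\<lambda>(x, t). \<phi> x t)"
    using L2_on_combination[OF rect_L2(1,2)[OF T], of "2 * \<alpha>" "- (2 * \<beta>)"]
    by (simp add: \<phi>_def split_def)
  show Fub: "integrable (lebesgue_on {0..T}) (\<lambda>t. \<integral>x. \<phi> x t \<bullet> dt e x t \<partial>lebesgue_on \<Omega>)"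
    using lebesgue_Fubini(4)[OF _ _ L2_on_inner[OF \<phi> rect_L2(3)[OF T]]] by simp
  define u where "u = (\<lambda>x t. exp (\<kappa> * t) *\<^sub>R e x t)"
  define v where "v = (\<lambda>x t. exp (\<kappa> * t) *\<^sub>R dt e x t + (\<kappa> * exp (\<kappa> * t)) *\<^sub>R e x t)"
  define \<psi> where "\<psi> = (\<lambda>x t. exp (\<kappa> * t) *\<^sub>R \<phi> x t)"
  define B where "B = (1 + \<bar>\<kappa>\<bar>) * exp (\<bar>\<kappa>\<bar> * T)"
  have expB: "\<bar>exp (\<kappa> * t)\<bar> \<le> B" "\<bar>\<kappa> * exp (\<kappa> * t)\<bar> \<le> B" if "t \<in> {0..T}" for t
  proof -
    have "\<kappa> * t \<le> \<bar>\<kappa>\<bar> * T" using that by (intro mult_mono) auto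
    then have "exp (\<kappa> * t) \<le> exp (\<bar>\<kappa>\<bar> * T)" by simp
    moreover from this have "\<bar>\<kappa>\<bar> * exp (\<kappa> * t) \<le> \<bar>\<kappa>\<bar> * exp (\<bar>\<kappa>\<bar> * T)" by (intro mult_left_mono) auto
    moreover have "0 \<le> exp (\<kappa> * t)" "0 \<le> \<bar>\<kappa>\<bar> * exp (\<kappa> * t)" by auto
    ultimately have "exp (\<kappa> * t) \<le> B" "\<bar>\<kappa>\<bar> * exp (\<kappa> * t) \<le> B"
      unfolding B_def distrib_right mult_1 by linarith+
    then show "\<bar>exp (\<kappa> * t)\<bar> \<le> B" "\<bar>\<kappa> * exp (\<kappa> * t)\<bar> \<le> B" by (auto simp: abs_mult)
  qed
  have meas: "(\<lambda>z. exp (\<kappa> * snd z)) \<in> borel_measurable (lebesgue_on ?R)"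
    "(\<lambda>z. \<kappa> * exp (\<kappa> * snd z)) \<in> borel_measurable (lebesgue_on ?R)"
    using Rm by (auto intro!: continuous_imp_measurable_on_sets_lebesgue continuous_intros)
  have v: "L2_on ?R (\<lambda>(x, t). v x t)"
    using L2_on_bounded_combination[OF rect_L2(3,1)[OF T] meas, of B] expB
    by (auto simp: v_def split_def)
  have \<psi>: "L2_on ?R (\<lambda>(x, t). \<psi> x t)"
  proof -
    have "0 \<le> B" by (simp add: B_def)
    then have "L2_on ?R (\<lambda>z. exp (\<kappa> * snd z) *\<^sub>R (case z of (x, t) \<Rightarrow> \<phi> x t) + 0 *\<^sub>R (case z of (x, t) \<Rightarrow> \<phi> x t))"
      using expB(1) by (intro L2_on_bounded_combination[OF \<phi> \<phi> meas(1) borel_measurable_const[of 0], of B]) auto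
    then show ?thesis by (simp add: \<psi>_def split_def)
  qed
  have cN: "continuous_on {0..T} N"
    unfolding N_def by (intro continuous_intros continuous_on_subset[OF continuous_E] continuous_on_subset[OF continuous_D]) auto
  have ac: "AE x in lebesgue_on \<Omega>. abs_cont_on 0 T (u x) \<and>
      (AE t in lebesgue_on {0..T}. (u x has_vector_derivative v x t) (at t within {0..T}))"
    using e_time_derivative[OF T]
  proof eventually_elim
    case (elim x)
    have "abs_cont_on 0 T (\<lambda>t. exp (\<kappa> * t))"
      by (rule abs_cont_on_C1[where f' = "\<lambda>t. \<kappa> * exp (\<kappa> * t)"]) (auto intro!: derivative_eq_intros continuous_intros)
    then have 1: "abs_cont_on 0 T (u x)"
      unfolding u_def using elim by (intro abs_cont_on_bilinear[OF bounded_bilinear_scaleR]) auto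
    have "AE t in lebesgue_on {0..T}. (e x has_vector_derivative dt e x t) (at t within {0..T})" using elim by blast
    then have "AE t in lebesgue_on {0..T}. (u x has_vector_derivative v x t) (at t within {0..T})"
    proof eventually_elim
      case (elim t)
      have "((\<lambda>t. exp (\<kappa> * t)) has_vector_derivative \<kappa> * exp (\<kappa> * t)) (at t within {0..T})"
        unfolding has_real_derivative_iff_has_vector_derivative[symmetric]
        by (auto intro!: derivative_eq_intros)
      from bounded_bilinear.has_vector_derivative[OF bounded_bilinear_scaleR this elim]
      show ?case by (simp add: u_def v_def)
    qed
    with 1 show ?case by blast
  qed
  have cu: "continuous_on ?R (\<lambda>(x, t). u x t)"
    using ce unfolding u_def split_def by (intro continuous_intros)
  have good: "\<forall>s\<in>{0..t}. exp (2 * \<kappa> * t) * N t - exp (2 * \<kappa> * s) * N s \<le> (\<integral>x. \<psi> x t \<bullet> (u x t - u x s) \<partial>lebesgue_on \<Omega>)"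
      "(\<integral>x. \<phi> x t \<bullet> e x t \<partial>lebesgue_on \<Omega>) = 2 * N t"
    if t: "t \<in> {0..T}" and H: "H2 (\<lambda>x. e x t) \<and> dx e 0 t = dx e (2*pi) t" for t
  proof -
    have tp: "t \<ge> 0" using t by simp
    have H': "H1_on 0 (2*pi) (\<lambda>x. dx e x t)" using H by (simp add: H2_def dx_def)
    have per: "e 0 t = e (2*pi) t" "dx e 0 t = dx e (2*pi) t" using periodic[OF tp] H by auto
    have dxt: "(\<lambda>x. dx e x t) = (\<lambda>x. vector_derivative (\<lambda>x. e x t) (at x within \<Omega>))" by (simp add: dx_def)
    have \<phi>t: "\<phi> x t = (2 * \<alpha>) *\<^sub>R e x t - (2 * \<beta>) *\<^sub>R vector_derivative (\<lambda>x. dx e x t) (at x within \<Omega>)" for x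
      by (simp add: \<phi>_def dx_def)
    have Nt: "N s = \<alpha> * (\<integral>x. (norm (e x s))\<^sup>2 \<partial>lebesgue_on \<Omega>) +
      \<beta> * (\<integral>x. (norm (vector_derivative (\<lambda>x. e x s) (at x within \<Omega>)))\<^sup>2 \<partial>lebesgue_on \<Omega>)" for s
      by (simp add: N_def E_def D_def dx_def)
    show "\<forall>s\<in>{0..t}. exp (2 * \<kappa> * t) * N t - exp (2 * \<kappa> * s) * N s \<le> (\<integral>x. \<psi> x t \<bullet> (u x t - u x s) \<partial>lebesgue_on \<Omega>)"
    proof
      fix s assume "s \<in> {0..t}"
      then have sp: "s \<ge> 0" by simp
      \<comment> \<open>The ratio of the weights at the two times, so that the weighted increment is
        \<open>exp (\<kappa> * t)\<close> times \<open>e x t - k *\<^sub>R e x s\<close>.\<close>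
      define k where "k = exp (\<kappa> * (s - t))"
      have ek: "exp (\<kappa> * t) * k = exp (\<kappa> * s)" by (simp add: k_def exp_add[symmetric] algebra_simps)
      have ee: "exp (2 * \<kappa> * r) = (exp (\<kappa> * r))\<^sup>2" for r by (simp add: exp_double[symmetric] mult.assoc)
      have "N t - k\<^sup>2 * N s \<le> (\<integral>x. \<phi> x t \<bullet> (e x t - k *\<^sub>R e x s) \<partial>lebesgue_on \<Omega>)"
        unfolding \<phi>t Nt
        by (rule H1_energy_convex(1)[OF H1_slice[OF tp] H' H1_slice[OF sp] _ dxt per periodic[OF sp] pos]) simp
      then have "(exp (\<kappa> * t))\<^sup>2 * (N t - k\<^sup>2 * N s) \<le> (exp (\<kappa> * t))\<^sup>2 * (\<integral>x. \<phi> x t \<bullet> (e x t - k *\<^sub>R e x s) \<partial>lebesgue_on \<Omega>)"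
        by (intro mult_left_mono) auto
      also have "(exp (\<kappa> * t))\<^sup>2 * (N t - k\<^sup>2 * N s) = exp (2 * \<kappa> * t) * N t - exp (2 * \<kappa> * s) * N s"
        unfolding ee ek[symmetric] by (simp add: power_mult_distrib algebra_simps)
      also have "(exp (\<kappa> * t))\<^sup>2 * (\<integral>x. \<phi> x t \<bullet> (e x t - k *\<^sub>R e x s) \<partial>lebesgue_on \<Omega>) =
          (\<integral>x. (exp (\<kappa> * t))\<^sup>2 * (\<phi> x t \<bullet> (e x t - k *\<^sub>R e x s)) \<partial>lebesgue_on \<Omega>)" by simp
      also have "\<dots> = (\<integral>x. \<psi> x t \<bullet> (u x t - u x s) \<partial>lebesgue_on \<Omega>)"
        unfolding \<psi>_def u_def ek[symmetric]
        by (intro Bochner_Integration.integral_cong) (auto simp: inner_diff_right power2_eq_square algebra_simps)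
      finally show "exp (2 * \<kappa> * t) * N t - exp (2 * \<kappa> * s) * N s \<le> (\<integral>x. \<psi> x t \<bullet> (u x t - u x s) \<partial>lebesgue_on \<Omega>)" .
    qed
    show "(\<integral>x. \<phi> x t \<bullet> e x t \<partial>lebesgue_on \<Omega>) = 2 * N t"
      unfolding \<phi>t Nt
      by (rule H1_energy_convex(2)[OF H1_slice[OF tp] H' H1_slice[OF tp] _ dxt per per(1) pos]) simp
  qed
  have "exp (2 * \<kappa> * T) * N T - exp (2 * \<kappa> * 0) * N 0 \<le> (\<integral>x. (\<integral>t. \<psi> x t \<bullet> v x t \<partial>lebesgue_on {0..T}) \<partial>lebesgue_on \<Omega>)"
  proof (rule convex_energy_increment[OF T cu ac v \<psi>])
    show "continuous_on {0..T} (\<lambda>t. exp (2 * \<kappa> * t) * N t)" by (intro continuous_intros cN)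
    show "AE t in lebesgue_on {0..T}. \<forall>s\<in>{0..t}.
      exp (2 * \<kappa> * t) * N t - exp (2 * \<kappa> * s) * N s \<le> (\<integral>x. \<psi> x t \<bullet> (u x t - u x s) \<partial>lebesgue_on \<Omega>)"
      by (rule lebesgue_on_mono[OF AE_H2]) (use good(1) in blast)
  qed
  also have "\<dots> = (\<integral>t. (\<integral>x. \<psi> x t \<bullet> v x t \<partial>lebesgue_on \<Omega>) \<partial>lebesgue_on {0..T})"
    using lebesgue_Fubini(5)[OF _ _ L2_on_inner[OF \<psi> v]] by simp
  also have "\<dots> = (\<integral>t. exp (2 * \<kappa> * t) * (2 * \<kappa> * N t + (\<integral>x. \<phi> x t \<bullet> dt e x t \<partial>lebesgue_on \<Omega>)) \<partial>lebesgue_on {0..T})"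
  proof (rule integral_cong_AE)
    show "(\<lambda>t. \<integral>x. \<psi> x t \<bullet> v x t \<partial>lebesgue_on \<Omega>) \<in> borel_measurable (lebesgue_on {0..T})"
      using lebesgue_Fubini(4)[OF _ _ L2_on_inner[OF \<psi> v]] by (auto intro: borel_measurable_integrable)
    have [measurable]: "N \<in> borel_measurable (lebesgue_on {0..T})"
      using cN by (intro continuous_imp_measurable_on_sets_lebesgue) auto
    have [measurable]: "(\<lambda>t. \<integral>x. \<phi> x t \<bullet> dt e x t \<partial>lebesgue_on \<Omega>) \<in> borel_measurable (lebesgue_on {0..T})"
      using Fub by (rule borel_measurable_integrable)
    have [measurable]: "(\<lambda>t. exp (2 * \<kappa> * t)) \<in> borel_measurable (lebesgue_on {0..T})"
      by (intro continuous_imp_measurable_on_sets_lebesgue continuous_intros) auto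
    show "(\<lambda>t. exp (2 * \<kappa> * t) * (2 * \<kappa> * N t + (\<integral>x. \<phi> x t \<bullet> dt e x t \<partial>lebesgue_on \<Omega>))) \<in> borel_measurable (lebesgue_on {0..T})"
      by measurable
    have "AE t in lebesgue_on {0..T}. integrable (lebesgue_on \<Omega>) (\<lambda>x. \<phi> x t \<bullet> dt e x t)"
      using lebesgue_Fubini(2)[OF _ _ L2_on_inner[OF \<phi> rect_L2(3)[OF T]]] by simp
    moreover have "AE t in lebesgue_on {0..T}. integrable (lebesgue_on \<Omega>) (\<lambda>x. \<phi> x t \<bullet> e x t)"
      using lebesgue_Fubini(2)[OF _ _ L2_on_inner[OF \<phi> rect_L2(1)[OF T]]] by simp
    moreover have "AE t in lebesgue_on {0..T}. (\<integral>x. \<phi> x t \<bullet> e x t \<partial>lebesgue_on \<Omega>) = 2 * N t"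
      by (rule lebesgue_on_mono[OF AE_H2]) (use good(2) in blast)
    ultimately show "AE t in lebesgue_on {0..T}. (\<integral>x. \<psi> x t \<bullet> v x t \<partial>lebesgue_on \<Omega>) =
        exp (2 * \<kappa> * t) * (2 * \<kappa> * N t + (\<integral>x. \<phi> x t \<bullet> dt e x t \<partial>lebesgue_on \<Omega>))"
    proof eventually_elim
      case (elim t)
      have ee: "exp (2 * \<kappa> * t) = exp (\<kappa> * t) * exp (\<kappa> * t)" by (simp add: exp_add[symmetric])
      have "(\<integral>x. \<psi> x t \<bullet> v x t \<partial>lebesgue_on \<Omega>) =
          (\<integral>x. exp (2 * \<kappa> * t) * (\<phi> x t \<bullet> dt e x t) + exp (2 * \<kappa> * t) * (\<kappa> * (\<phi> x t \<bullet> e x t)) \<partial>lebesgue_on \<Omega>)"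
        unfolding \<psi>_def v_def ee
        by (intro Bochner_Integration.integral_cong) (simp_all add: inner_add_right algebra_simps)
      also have "\<dots> = exp (2 * \<kappa> * t) * (\<integral>x. \<phi> x t \<bullet> dt e x t \<partial>lebesgue_on \<Omega>) + exp (2 * \<kappa> * t) * (\<kappa> * (\<integral>x. \<phi> x t \<bullet> e x t \<partial>lebesgue_on \<Omega>))"
        using elim(1,2) by simp
      finally show ?case unfolding elim(3) by (simp add: algebra_simps)
    qed
  qed
  finally show "exp (2 * \<kappa> * T) * N T - N 0 \<le>
      (\<integral>t. exp (2 * \<kappa> * t) * (2 * \<kappa> * N t + (\<integral>x. \<phi> x t \<bullet> dt e x t \<partial>lebesgue_on \<Omega>)) \<partial>lebesgue_on {0..T})"
    by simp
qed

end

section \<open>From the matrix inequality to decay of the energy\<close>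

text \<open>For each component, the difference of the two sides is the form of \<open>\<Phi>\<close>
  at \<open>y, v, m, q, f\<close>, once \<open>a * z\<close> is replaced by
  \<open>v + K * q - K * f\<close> from the equation. The term with \<open>p2\<close> is placed on
  both sides of this bookkeeping: it is eliminated inside the form and left on the right for
  integration by parts.\<close>

lemma LMI_pointwise:
  fixes y v m q f z :: "real^3" and a K \<delta>0 \<delta>1 \<tau>M p1 p2 p3 r g s :: real
  defines "\<rho> \<equiv> exp (- 2 * \<delta>0 * \<tau>M)"
  assumes LMI: "neg_semidef (Phi a K \<delta>0 \<delta>1 \<tau>M p1 p2 p3 r g s)"
    and eq: "v = a *\<^sub>R z - K *\<^sub>R (q - f)"
  shows "2 * \<delta>0 * p1 * (y \<bullet> y) + ((2 * p1) *\<^sub>R y - (2 * (p3 * a)) *\<^sub>R z) \<bullet> v \<le>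
    2 * p2 * a * (y \<bullet> z) - g * (y \<bullet> y) + g * \<rho> * (m \<bullet> m) - \<tau>M\<^sup>2 * r * (v \<bullet> v)
    + \<rho> * (r * ((y - q) \<bullet> (y - q)) + r * ((q - m) \<bullet> (q - m)) + 2 * s * ((y - q) \<bullet> (q - m)))
    + \<delta>1 * p1 * (q \<bullet> q) + \<delta>1 * (p3 * a) / 4 * (f \<bullet> f)"
proof -
  define L where "L = (\<lambda>i. 2 * \<delta>0 * p1 * (y$i * y$i) + (2 * p1 * y$i - 2 * (p3 * a) * z$i) * v$i)"
  define R where "R = (\<lambda>i. 2 * p2 * a * (y$i * z$i) - g * (y$i * y$i) + g * \<rho> * (m$i * m$i) - \<tau>M\<^sup>2 * r * (v$i * v$i)
    + \<rho> * (r * ((y$i - q$i) * (y$i - q$i)) + r * ((q$i - m$i) * (q$i - m$i)) + 2 * s * ((y$i - q$i) * (q$i - m$i)))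
    + \<delta>1 * p1 * (q$i * q$i) + \<delta>1 * (p3 * a) / 4 * (f$i * f$i))"
  have "L i \<le> R i" for i
  proof -
    have az: "a * z$i = v$i + K * q$i - K * f$i" by (simp add: eq algebra_simps)
    define w :: "real^5" where "w = vector [y$i, v$i, m$i, q$i, f$i]"
    have w: "w$1 = y$i" "w$2 = v$i" "w$3 = m$i" "w$4 = q$i" "w$5 = f$i" by (simp_all add: w_def vector_5)
    have "L i - R i = 2 * \<delta>0 * p1 * (y$i * y$i) + 2 * p1 * y$i * v$i - 2 * p3 * (a * z$i) * v$i - 2 * p2 * y$i * (a * z$i)
      - (R i - 2 * p2 * a * (y$i * z$i))"
      by (simp add: L_def algebra_simps)
    also have "\<dots> = w \<bullet> (Phi a K \<delta>0 \<delta>1 \<tau>M p1 p2 p3 r g s *v w)"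
      unfolding quadratic_form_Phi \<rho>_def[symmetric] w az R_def
      by (simp add: power2_eq_square algebra_simps)
    also have "\<dots> \<le> 0" using LMI by (simp add: neg_semidef_def)
    finally show ?thesis by simp
  qed
  then have "(\<Sum>i\<in>UNIV. L i) \<le> (\<Sum>i\<in>UNIV. R i)" by (rule sum_mono)
  then show ?thesis by (simp add: L_def R_def sum_3 inner_vec_def algebra_simps)
qed

text \<open>This replaces Jensen's inequality followed by the reciprocally convex combination lemma:
  as \<open>\<bar>s\<bar> \<le> r\<close>, the quadratic form is dominated by \<open>r (\<bar>u\<bar> + \<bar>v\<bar>)\<^sup>2\<close>.\<close>

lemma cross_term_bound:
  fixes u v :: "'a::real_inner"
  assumes "\<bar>s\<bar> \<le> r"
  shows "r * (u \<bullet> u) + r * (v \<bullet> v) + 2 * s * (u \<bullet> v) \<le> r * (norm u + norm v)\<^sup>2"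
proof -
  have "s * (u \<bullet> v) \<le> \<bar>s\<bar> * \<bar>u \<bullet> v\<bar>" by (simp add: abs_mult[symmetric])
  also have "\<dots> \<le> r * (norm u * norm v)"
    using assms by (intro mult_mono Cauchy_Schwarz_ineq2) auto
  finally show ?thesis by (simp add: power2_sum power2_norm_eq_inner algebra_simps)
qed

lemma integrable_continuous_mult:
  fixes f w :: "real \<Rightarrow> real"
  assumes f: "integrable (lebesgue_on {a..b}) f" and w: "continuous_on {a..b} w"
  shows "integrable (lebesgue_on {a..b}) (\<lambda>x. w x * f x)"
proof -
  have "bounded (w ` {a..b})" using w compact_continuous_image compact_imp_bounded by blast
  then obtain B where B: "\<And>x. x \<in> {a..b} \<Longrightarrow> norm (w x) \<le> B" "B > 0"
    unfolding bounded_pos by blast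
  have [measurable]: "w \<in> borel_measurable (lebesgue_on {a..b})"
    using w by (intro continuous_imp_measurable_on_sets_lebesgue) auto
  have [measurable]: "f \<in> borel_measurable (lebesgue_on {a..b})" using f by (rule borel_measurable_integrable)
  show ?thesis
  proof (rule Bochner_Integration.integrable_bound)
    show "integrable (lebesgue_on {a..b}) (\<lambda>x. B * f x)" using f by simp
    show "AE x in lebesgue_on {a..b}. norm (w x * f x) \<le> norm (B * f x)"
      using B by (intro AE_I2) (auto simp: abs_mult intro!: mult_right_mono)
  qed measurable
qed

text \<open>Since the updating times tend to infinity, the least index beyond \<open>t\<close>
  locates its sampling interval. The delayed time thus never lies in the future.\<close>

lemma network_delay_nonneg:
  assumes "network_delay \<tau>" "t \<ge> 0"
  shows "\<tau> t \<ge> 0"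
proof -
  obtain tk :: "nat \<Rightarrow> real" and \<eta> :: "nat \<Rightarrow> real" where tk: "tk 0 = 0" "filterlim tk at_top sequentially"
    and \<eta>: "\<And>k. 0 \<le> \<eta> k" and \<tau>: "\<And>k t. t \<in> {tk k..<tk (Suc k)} \<Longrightarrow> \<tau> t = t - tk k + \<eta> k"
    using assms(1) unfolding network_delay_def by blast
  have "\<exists>n. t < tk n"
    using tk(2) unfolding filterlim_at_top_dense eventually_sequentially by blast
  define n where "n = (LEAST n. t < tk n)"
  have n: "t < tk n" unfolding n_def using \<open>\<exists>n. t < tk n\<close> by (rule LeastI_ex)
  then have "n \<noteq> 0" using tk(1) \<open>t \<ge> 0\<close> by (metis not_less)
  then obtain k where k: "n = Suc k" by (cases n) auto
  have "\<not> t < tk k" using not_less_Least[of k "\<lambda>n. t < tk n"] k by (simp add: n_def)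
  then have "\<tau> t = t - tk k + \<eta> k" "tk k \<le> t" using n k by (auto intro: \<tau>)
  then show ?thesis using \<eta>[of k] by simp
qed

context solution
begin

lemma F_integrable:
  assumes "T > 0"
  shows "integrable (lebesgue_on {0..T}) F"
    and "\<lbrakk>0 \<le> A; B \<le> T\<rbrakk> \<Longrightarrow> AE x in lebesgue_on \<Omega>. L2_on {A..B} (dt e x)"
    and "\<lbrakk>0 \<le> A; B \<le> T\<rbrakk> \<Longrightarrow> integrable (lebesgue_on \<Omega>) (\<lambda>x. \<integral>s. (norm (dt e x s))\<^sup>2 \<partial>lebesgue_on {A..B})"
    and "\<lbrakk>0 \<le> A; B \<le> T\<rbrakk> \<Longrightarrow> (\<integral>x. (\<integral>s. (norm (dt e x s))\<^sup>2 \<partial>lebesgue_on {A..B}) \<partial>lebesgue_on \<Omega>) = integral {A..B} F"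
proof -
  have int: "integrable (lebesgue_on (\<Omega> \<times> {A..B})) (\<lambda>z. (norm (case z of (x, t) \<Rightarrow> dt e x t))\<^sup>2)"
      and L2: "L2_on (\<Omega> \<times> {A..B}) (\<lambda>(x, t). dt e x t)"
    if "0 \<le> A" "B \<le> T" for A B
  proof -
    have m: "\<Omega> \<times> {C..D} \<in> sets lebesgue" for C D :: real
      by (metis cbox_Pair_eq cbox_interval fmeasurableD lmeasurable_cbox)
    show "L2_on (\<Omega> \<times> {A..B}) (\<lambda>(x, t). dt e x t)"
      by (rule L2_on_subset[OF rect_L2(3)[OF assms]]) (use that m in auto)
    then show "integrable (lebesgue_on (\<Omega> \<times> {A..B})) (\<lambda>z. (norm (case z of (x, t) \<Rightarrow> dt e x t))\<^sup>2)"
      by (simp add: L2_on_def)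
  qed
  have FAB: "integrable (lebesgue_on {A..B}) F" if "0 \<le> A" "B \<le> T" for A B
    using lebesgue_Fubini(4)[OF _ _ int[OF that]] by (simp add: F_def[abs_def])
  show "integrable (lebesgue_on {0..T}) F" by (rule FAB) auto
  show "AE x in lebesgue_on \<Omega>. L2_on {A..B} (dt e x)" if "0 \<le> A" "B \<le> T"
    using L2_on_slice[OF L2[OF that]] by simp
  show "integrable (lebesgue_on \<Omega>) (\<lambda>x. \<integral>s. (norm (dt e x s))\<^sup>2 \<partial>lebesgue_on {A..B})" if "0 \<le> A" "B \<le> T"
    using lebesgue_Fubini(3)[OF _ _ int[OF that]] by simp
  show "(\<integral>x. (\<integral>s. (norm (dt e x s))\<^sup>2 \<partial>lebesgue_on {A..B}) \<partial>lebesgue_on \<Omega>) = integral {A..B} F" if "0 \<le> A" "B \<le> T"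
    using lebesgue_Fubini(5)[OF _ _ int[OF that]] lebesgue_integral_eq_integral[OF FAB[OF that]]
    by (simp add: F_def[abs_def])
qed

text \<open>Both increments are bounded by pieces of a single integral over \<open>{A..t}\<close>,
  so one application of Cauchy-Schwarz suffices wherever \<open>c\<close> lies, including at either
  end.\<close>

lemma history_bound:
  assumes "T > 0" "0 \<le> A" "A \<le> c" "c \<le> t" "t \<le> T"
  shows "AE x in lebesgue_on \<Omega>. (norm (e x t - e x c) + norm (e x c - e x A))\<^sup>2 \<le>
    (t - A) * (\<integral>s. (norm (dt e x s))\<^sup>2 \<partial>lebesgue_on {A..t})"
  using e_time_derivative[OF \<open>T > 0\<close>] F_integrable(2)[OF \<open>T > 0\<close> order_refl order_refl]
    F_integrable(2)[OF \<open>T > 0\<close> \<open>0 \<le> A\<close> \<open>t \<le> T\<close>]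
proof eventually_elim
  case (elim x)
  then have ac: "abs_cont_on 0 T (e x)"
    and der: "AE t in lebesgue_on {0..T}. (e x has_vector_derivative dt e x t) (at t within {0..T})"
    and v: "L2_on {0..T} (dt e x)" by auto
  note inc = abs_cont_on_increment[OF ac der v]
  have "norm (e x t - e x c) + norm (e x c - e x A) \<le>
      integral {c..t} (\<lambda>s. norm (dt e x s)) + integral {A..c} (\<lambda>s. norm (dt e x s))"
    using assms by (intro add_mono inc) auto
  also have "\<dots> = integral {A..t} (\<lambda>s. norm (dt e x s))"
    using Henstock_Kurzweil_Integration.integral_combine[OF assms(3,4) L2_on_Icc(3)[OF v assms(2,5)]] by simp
  finally have "(norm (e x t - e x c) + norm (e x c - e x A))\<^sup>2 \<le> (integral {A..t} (\<lambda>s. norm (dt e x s)))\<^sup>2"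
    by (intro power_mono) auto
  also have "\<dots> \<le> (t - A) * integral {A..t} (\<lambda>s. (norm (dt e x s))\<^sup>2)"
    using assms by (intro inc) auto
  also have "integral {A..t} (\<lambda>s. (norm (dt e x s))\<^sup>2) = (\<integral>s. (norm (dt e x s))\<^sup>2 \<partial>lebesgue_on {A..t})"
    using elim(3) by (intro lebesgue_integral_eq_integral[symmetric]) (auto simp: L2_on_def)
  finally show ?case .
qed

text \<open>The pointwise inequality is integrated in space. The surviving \<open>e_xx\<close>
  pairing becomes \<open>- D t\<close>, the deviation from the point value is bounded by the
  midpoint inequality, and the increments by the history integral.\<close>

lemma dissipation:
  fixes \<delta>0 \<delta>1 \<tau>M p1 p2 p3 r g s T :: real
  defines "\<rho> \<equiv> exp (- 2 * \<delta>0 * \<tau>M)"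
    and "N \<equiv> \<lambda>t. p1 * E t + p3 * a * D t"
  assumes T: "T > 0" and a: "a > 0"
    and \<tau>: "\<And>t. t \<ge> 0 \<Longrightarrow> 0 \<le> \<tau> t \<and> \<tau> t \<le> \<tau>M"
    and p: "p1 > 0" "p3 > 0" "\<bar>s\<bar> \<le> r" "\<delta>1 > 0" "\<delta>0 * p3 \<le> p2"
    and LMI: "neg_semidef (Phi a K \<delta>0 \<delta>1 \<tau>M p1 p2 p3 r g s)"
  shows "AE t in lebesgue_on {0..T}. t \<in> {0..T} \<longrightarrow>
    2 * \<delta>0 * N t + (\<integral>x. ((2 * p1) *\<^sub>R e x t - (2 * (p3 * a)) *\<^sub>R dx (dx e) x t) \<bullet> dt e x t \<partial>lebesgue_on \<Omega>) \<le>
    - g * E t + g * \<rho> * E (max 0 (t - \<tau>M)) - \<tau>M\<^sup>2 * r * F t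
    + \<rho> * r * \<tau>M * integral {max 0 (t - \<tau>M)..t} F + \<delta>1 * N (max 0 (t - \<tau> t))"
proof -
  have slice_dt: "AE t in lebesgue_on {0..T}. integrable (lebesgue_on \<Omega>) (\<lambda>x. (norm (dt e x t))\<^sup>2)"
    using lebesgue_Fubini(2)[of \<Omega> "{0..T}" "\<lambda>z. (norm (case z of (x, t) \<Rightarrow> dt e x t))\<^sup>2"] rect_L2(3)[OF T]
    by (simp add: L2_on_def)
  show ?thesis
    using AE_H2 AE_equation slice_dt
  proof eventually_elim
    case (elim t)
    show ?case
    proof
      assume "t \<in> {0..T}"
      then have t: "0 \<le> t" "t \<le> T" by auto
      \<comment> \<open>Delayed times are clipped at \<open>0\<close>, in accordance with the
        constant initial history.\<close>
      define c where "c = max 0 (t - \<tau> t)"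
      define A where "A = max 0 (t - \<tau>M)"
      have cA: "0 \<le> A" "A \<le> c" "c \<le> t" "0 \<le> c" "t - A \<le> \<tau>M" using \<tau>[OF t(1)] t by (auto simp: c_def A_def)
      let ?M = "lebesgue_on \<Omega>"
      define y where "y = (\<lambda>x. e x t)"
      define q where "q = (\<lambda>x. e x c)"
      define m where "m = (\<lambda>x. e x A)"
      define z where "z = (\<lambda>x. dx (dx e) x t)"
      define v where "v = (\<lambda>x. dt e x t)"
      \<comment> \<open>\<open>q x - f x\<close> is then the measured value \<open>e pi c\<close>,
        the same for all \<open>x\<close>.\<close>
      define f where "f = (\<lambda>x. e x c - e pi c)"
      define H where "H = (\<lambda>x. \<integral>s. (norm (dt e x s))\<^sup>2 \<partial>lebesgue_on {A..t})"
      have H2: "H1_on 0 (2*pi) (\<lambda>x. dx e x t)" and per': "dx e 0 t = dx e (2*pi) t"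
        using elim(1) by (auto simp: H2_def dx_def)
      have zL2: "L2_on \<Omega> z" using H1_on_L2_deriv[OF H2] by (simp add: z_def dx_def)
      have yL2: "L2_on \<Omega> y" "L2_on \<Omega> q" "L2_on \<Omega> m"
        using slice_L2 t cA by (auto simp: y_def q_def m_def)
      have cL2: "L2_on \<Omega> (\<lambda>x. k)" for k :: "real^3" by (rule L2_on_continuous) auto
      have fL2: "L2_on \<Omega> f" unfolding f_def using L2_on_diff[OF yL2(2) cL2] by (simp add: q_def)
      have pde: "AE x in ?M. a *\<^sub>R z x - K *\<^sub>R e pi c = v x"
        using elim(2) e_clip[of pi "t - \<tau> t"] by (auto simp: v_def z_def c_def elim!: eventually_mono)
      \<comment> \<open>The equation exhibits this slice of the time derivative as a combination of
        \<open>e_xx\<close> and a constant.\<close>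
      have vL2: "L2_on \<Omega> v"
        by (rule L2_on_cong_AE[OF L2_on_diff[OF L2_on_scaleR[OF zL2] cL2] pde]) auto
      have Hint: "integrable ?M H" and HF: "(\<integral>x. H x \<partial>?M) = integral {A..t} F"
        using F_integrable(3,4)[OF T cA(1) t(2)] by (simp_all add: H_def)
      have \<rho>: "\<rho> > 0" by (simp add: \<rho>_def)
      have r: "r \<ge> 0" using p by linarith
      have \<tau>M: "\<tau>M \<ge> 0" using \<tau>[OF t(1)] by linarith
      have pt: "AE x in ?M. 2 * \<delta>0 * p1 * (y x \<bullet> y x) + ((2 * p1) *\<^sub>R y x - (2 * (p3 * a)) *\<^sub>R z x) \<bullet> v x \<le>
          2 * p2 * a * (y x \<bullet> z x) - g * (y x \<bullet> y x) + g * \<rho> * (m x \<bullet> m x) - \<tau>M\<^sup>2 * r * (v x \<bullet> v x)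
          + \<rho> * r * \<tau>M * H x + \<delta>1 * p1 * (q x \<bullet> q x) + \<delta>1 * (p3 * a) / 4 * (f x \<bullet> f x)"
        using pde history_bound[OF T cA(1,2,3) t(2)]
      proof eventually_elim
        case (elim x)
        have "v x = a *\<^sub>R z x - K *\<^sub>R (q x - f x)" using elim(1) by (simp add: q_def f_def)
        note LMI_pointwise[OF LMI this, of "y x" "m x", folded \<rho>_def]
        moreover have "\<rho> * (r * ((y x - q x) \<bullet> (y x - q x)) + r * ((q x - m x) \<bullet> (q x - m x)) + 2 * s * ((y x - q x) \<bullet> (q x - m x)))
          \<le> \<rho> * r * \<tau>M * H x"
        proof -
          have "r * ((y x - q x) \<bullet> (y x - q x)) + r * ((q x - m x) \<bullet> (q x - m x)) + 2 * s * ((y x - q x) \<bullet> (q x - m x))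
            \<le> r * (norm (y x - q x) + norm (q x - m x))\<^sup>2"
            using p(3) by (rule cross_term_bound)
          also have "\<dots> \<le> r * ((t - A) * H x)"
            using elim(2) r by (intro mult_left_mono) (simp_all add: y_def q_def m_def H_def)
          also have "\<dots> \<le> r * (\<tau>M * H x)"
            using cA(5) r by (intro mult_left_mono mult_right_mono) (simp_all add: H_def)
          finally show ?thesis using \<rho> by simp
        qed
        ultimately show ?case by linarith
      qed
      have sq: "integrable ?M (\<lambda>x. w x \<bullet> w x)" if "L2_on \<Omega> w" for w :: "real \<Rightarrow> real^3"
        using that by (intro L2_on_inner)
      have phiL2: "L2_on \<Omega> (\<lambda>x. (2 * p1) *\<^sub>R y x - (2 * (p3 * a)) *\<^sub>R z x)"
        using yL2 zL2 by (intro L2_on_diff L2_on_scaleR)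
      have "(\<integral>x. 2 * \<delta>0 * p1 * (y x \<bullet> y x) + ((2 * p1) *\<^sub>R y x - (2 * (p3 * a)) *\<^sub>R z x) \<bullet> v x \<partial>?M) \<le>
          (\<integral>x. 2 * p2 * a * (y x \<bullet> z x) - g * (y x \<bullet> y x) + g * \<rho> * (m x \<bullet> m x) - \<tau>M\<^sup>2 * r * (v x \<bullet> v x)
          + \<rho> * r * \<tau>M * H x + \<delta>1 * p1 * (q x \<bullet> q x) + \<delta>1 * (p3 * a) / 4 * (f x \<bullet> f x) \<partial>?M)"
        by (intro integral_mono_AE[OF _ _ pt] Bochner_Integration.integrable_add Bochner_Integration.integrable_diff
            integrable_mult_right sq L2_on_inner[OF phiL2 vL2] L2_on_inner[OF yL2(1) zL2] yL2 vL2 fL2 Hint)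
      also have "\<dots> = 2 * p2 * a * (\<integral>x. y x \<bullet> z x \<partial>?M) - g * (\<integral>x. y x \<bullet> y x \<partial>?M) + g * \<rho> * (\<integral>x. m x \<bullet> m x \<partial>?M)
          - \<tau>M\<^sup>2 * r * (\<integral>x. v x \<bullet> v x \<partial>?M) + \<rho> * r * \<tau>M * (\<integral>x. H x \<partial>?M)
          + \<delta>1 * p1 * (\<integral>x. q x \<bullet> q x \<partial>?M) + \<delta>1 * (p3 * a) / 4 * (\<integral>x. f x \<bullet> f x \<partial>?M)"
        using sq[OF yL2(1)] sq[OF yL2(2)] sq[OF yL2(3)] sq[OF vL2] sq[OF fL2] Hint L2_on_inner[OF yL2(1) zL2]
        by simp
      also have "(\<integral>x. 2 * \<delta>0 * p1 * (y x \<bullet> y x) + ((2 * p1) *\<^sub>R y x - (2 * (p3 * a)) *\<^sub>R z x) \<bullet> v x \<partial>?M) =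
          2 * \<delta>0 * p1 * (\<integral>x. y x \<bullet> y x \<partial>?M) + (\<integral>x. ((2 * p1) *\<^sub>R y x - (2 * (p3 * a)) *\<^sub>R z x) \<bullet> v x \<partial>?M)"
        using sq[OF yL2(1)] L2_on_inner[OF phiL2 vL2] by (subst Bochner_Integration.integral_add) auto
      finally have main: "2 * \<delta>0 * p1 * (\<integral>x. y x \<bullet> y x \<partial>?M) + (\<integral>x. ((2 * p1) *\<^sub>R y x - (2 * (p3 * a)) *\<^sub>R z x) \<bullet> v x \<partial>?M)
        \<le> 2 * p2 * a * (\<integral>x. y x \<bullet> z x \<partial>?M) - g * (\<integral>x. y x \<bullet> y x \<partial>?M) + g * \<rho> * (\<integral>x. m x \<bullet> m x \<partial>?M)
          - \<tau>M\<^sup>2 * r * (\<integral>x. v x \<bullet> v x \<partial>?M) + \<rho> * r * \<tau>M * (\<integral>x. H x \<partial>?M)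
          + \<delta>1 * p1 * (\<integral>x. q x \<bullet> q x \<partial>?M) + \<delta>1 * (p3 * a) / 4 * (\<integral>x. f x \<bullet> f x \<partial>?M)" .
      have ints: "(\<integral>x. y x \<bullet> y x \<partial>?M) = E t" "(\<integral>x. m x \<bullet> m x \<partial>?M) = E A" "(\<integral>x. q x \<bullet> q x \<partial>?M) = E c"
        "(\<integral>x. v x \<bullet> v x \<partial>?M) = F t"
        by (simp_all add: E_def F_def y_def m_def q_def v_def power2_norm_eq_inner)
      have yz: "(\<integral>x. y x \<bullet> z x \<partial>?M) = - D t"
        using H1_on_integral_by_parts[OF H1_slice[OF t(1)] H2 _ periodic[OF t(1)] per']
        by (simp add: D_def dx_def y_def z_def power2_norm_eq_inner)
      have ff: "(\<integral>x. f x \<bullet> f x \<partial>?M) \<le> 4 * D c"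
        using poincare_midpoint[OF H1_slice[OF cA(4)]]
        by (simp add: D_def dx_def f_def power2_norm_eq_inner)
      \<comment> \<open>The \<open>1 / 4\<close> of \<open>\<Phi>55\<close> meets the constant
        \<open>4\<close>, leaving precisely the \<open>D\<close> part of
        \<open>\<delta>1 * N c\<close>.\<close>
      have "\<delta>1 * (p3 * a) / 4 * (\<integral>x. f x \<bullet> f x \<partial>?M) \<le> \<delta>1 * (p3 * a) / 4 * (4 * D c)"
        using ff p a by (intro mult_left_mono) auto
      \<comment> \<open>Here \<open>\<delta>0 * p3 \<le> p2\<close> enters: the dissipation of
        \<open>e_x\<close> covers the \<open>D\<close> part of
        \<open>2 * \<delta>0 * N t\<close>.\<close>
      moreover have "2 * a * (\<delta>0 * p3) * D t \<le> 2 * a * p2 * D t"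
        using p(5) a by (intro mult_right_mono mult_left_mono) auto
      ultimately have "2 * \<delta>0 * p1 * E t + 2 * a * (\<delta>0 * p3) * D t + (\<integral>x. ((2 * p1) *\<^sub>R y x - (2 * (p3 * a)) *\<^sub>R z x) \<bullet> v x \<partial>?M)
        \<le> - g * E t + g * \<rho> * E A - \<tau>M\<^sup>2 * r * F t + \<rho> * r * \<tau>M * integral {A..t} F
          + \<delta>1 * p1 * E c + \<delta>1 * (p3 * a) * D c"
        using main unfolding ints yz HF by (simp add: algebra_simps)
      then show "2 * \<delta>0 * N t + (\<integral>x. ((2 * p1) *\<^sub>R e x t - (2 * (p3 * a)) *\<^sub>R dx (dx e) x t) \<bullet> dt e x t \<partial>?M) \<le>
        - g * E t + g * \<rho> * E (max 0 (t - \<tau>M)) - \<tau>M\<^sup>2 * r * F t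
        + \<rho> * r * \<tau>M * integral {max 0 (t - \<tau>M)..t} F + \<delta>1 * N (max 0 (t - \<tau> t))"
        unfolding N_def c_def[symmetric] A_def[symmetric] y_def z_def v_def by (simp add: algebra_simps)
    qed
  qed
qed

text \<open>With weight \<open>exp (2 * \<delta>0 * t)\<close>, the factor \<open>\<rho>\<close>
  becomes a shift of the weight by \<open>\<tau>M\<close>, so that the \<open>g\<close>-terms
  telescope up to the initial history and the \<open>r\<close>-terms cancel. The continuous majorant
  \<open>b\<close> stands in for the delayed energy, whose argument jumps with the delay; asking for
  it only before \<open>T\<close> suits a first-crossing argument.\<close>

lemma integrated_dissipation:
  fixes \<delta>0 \<delta>1 \<tau>M p1 p2 p3 r g s T :: real
  defines "N \<equiv> \<lambda>t. p1 * E t + p3 * a * D t"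
  assumes T: "T > 0" and a: "a > 0" and \<delta>0: "\<delta>0 > 0" and \<tau>M: "\<tau>M > 0"
    and \<tau>: "\<And>t. t \<ge> 0 \<Longrightarrow> 0 \<le> \<tau> t \<and> \<tau> t \<le> \<tau>M"
    and p: "p1 > 0" "p3 > 0" "\<bar>s\<bar> \<le> r" "\<delta>1 > 0" "\<delta>0 * p3 \<le> p2" "g > 0"
    and LMI: "neg_semidef (Phi a K \<delta>0 \<delta>1 \<tau>M p1 p2 p3 r g s)"
    and b: "continuous_on {0..T} b" "\<And>t. t \<in> {0..<T} \<Longrightarrow> N (max 0 (t - \<tau> t)) \<le> b t"
  shows "exp (2 * \<delta>0 * T) * N T \<le> N 0 + g * \<tau>M * E 0 + integral {0..T} (\<lambda>t. \<delta>1 * (exp (2 * \<delta>0 * t) * b t))"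
proof -
  let ?M = "lebesgue_on {0..T}"
  define w where "w = (\<lambda>t. exp (2 * \<delta>0 * t))"
  define \<rho> where "\<rho> = exp (- 2 * \<delta>0 * \<tau>M)"
  define \<Psi> where "\<Psi> = (\<lambda>t. \<integral>x. ((2 * p1) *\<^sub>R e x t - (2 * (p3 * a)) *\<^sub>R dx (dx e) x t) \<bullet> dt e x t \<partial>lebesgue_on \<Omega>)"
  have r: "r \<ge> 0" using p by linarith
  have w: "w t > 0" "continuous_on X w" for t X by (auto simp: w_def intro!: continuous_intros)
  have w\<rho>: "\<rho> * w t = w (t - \<tau>M)" for t
    by (simp add: w_def \<rho>_def exp_add[symmetric] algebra_simps)
  have wmono: "w s \<le> w t" if "s \<le> t" for s t using that \<delta>0 by (simp add: w_def)
  have cont_int: "integrable ?M f" if "continuous_on {0..T} f" for f :: "real \<Rightarrow> real"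
    using that by (intro L2_on_imp_integrable L2_on_continuous) auto
  have cE: "continuous_on {0..T} E" and cN: "continuous_on {0..T} N"
    unfolding N_def
    by (intro continuous_intros continuous_on_subset[OF continuous_E] continuous_on_subset[OF continuous_D]; simp)+
  have \<Psi>: "integrable ?M \<Psi>" "w T * N T - N 0 \<le> (\<integral>t. w t * (2 * \<delta>0 * N t + \<Psi> t) \<partial>?M)"
    using weighted_energy(1)[OF T, where \<alpha> = p1 and \<beta> = "p3 * a"]
      weighted_energy(2)[OF T, where \<alpha> = p1 and \<beta> = "p3 * a" and \<kappa> = \<delta>0] p a
    unfolding N_def \<Psi>_def w_def by auto
  have F: "integrable ?M F" using F_integrable(1)[OF T] .
  have wF: "integrable ?M (\<lambda>t. w t * F t)" by (rule integrable_continuous_mult[OF F w(2)])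
  have FI: "F integrable_on {0..T}" "(\<lambda>t. w t * F t) integrable_on {0..T}"
    using F wF by (auto intro: integrable_on_lebesgue_on)
  define P where "P = (\<lambda>t. integral {0..t} (\<lambda>t. w t * F t))"
  have sub: "F integrable_on {c..d}" "(\<lambda>t. w t * F t) integrable_on {c..d}" if "0 \<le> c" "d \<le> T" for c d
    using that FI by (auto intro: integrable_subinterval_real)
  have Pdiff: "P t - P c = integral {c..t} (\<lambda>t. w t * F t)" if "0 \<le> c" "c \<le> t" "t \<le> T" for c t
    using Henstock_Kurzweil_Integration.integral_combine[of 0 c t, OF that(1,2) sub(2)] that by (simp add: P_def)
  have wF0: "0 \<le> w t * F t" for t using w(1)[of t] by simp
  have Pmono: "mono_on {0..T} P"
  proof (rule mono_onI)
    fix c t assume "c \<in> {0..T}" "t \<in> {0..T}" "c \<le> t"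
    then have "0 \<le> P t - P c" by (subst Pdiff) (auto intro!: integral_nonneg sub wF0)
    then show "P c \<le> P t" by simp
  qed
  have Pcont: "continuous_on {0..T} P"
    unfolding P_def by (rule indefinite_integral_continuous_1) (rule FI)
  define f where "f = (\<lambda>t. w t * E (max 0 t))"
  have cf: "continuous_on {c..T} f" for c
    unfolding f_def using T by (intro continuous_intros w continuous_on_clip[OF cE]) auto
  define R where "R = (\<lambda>t. (- g * (f t - f (t - \<tau>M)) + r * \<tau>M * (P t - P (max 0 (t - \<tau>M)))) - \<tau>M\<^sup>2 * r * (w t * F t)
      + \<delta>1 * (w t * b t))"
  have cdel: "continuous_on {0..T} (\<lambda>t. f (t - \<tau>M))"
    using \<tau>M by (intro continuous_on_compose2[OF cf[of "- \<tau>M"]] continuous_intros) auto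
  have c1: "continuous_on {0..T} (\<lambda>t. - g * (f t - f (t - \<tau>M)))"
    using cf cdel by (intro continuous_intros)
  have c2: "continuous_on {0..T} (\<lambda>t. r * \<tau>M * (P t - P (max 0 (t - \<tau>M))))"
    using Pcont \<tau>M T by (intro continuous_intros continuous_on_delay) auto
  have c3: "continuous_on {0..T} (\<lambda>t. \<delta>1 * (w t * b t))" using b(1) w by (intro continuous_intros)
  have iR: "integrable ?M R"
    unfolding R_def
    by (intro Bochner_Integration.integrable_add Bochner_Integration.integrable_diff integrable_mult_right wF cont_int c1 c2 c3)
  \<comment> \<open>The majorant is available only strictly before \<open>T\<close>.\<close>
  have "AE t in lborel. t \<noteq> T" by (rule AE_lborel_singleton)
  then have neT: "AE t in ?M. t \<noteq> T" by (auto simp: AE_lebesgue_on_iff elim: eventually_mono)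
  have dis: "AE t in ?M. t \<in> {0..T} \<longrightarrow> 2 * \<delta>0 * N t + \<Psi> t \<le>
      - g * E t + g * \<rho> * E (max 0 (t - \<tau>M)) - \<tau>M\<^sup>2 * r * F t
      + \<rho> * r * \<tau>M * integral {max 0 (t - \<tau>M)..t} F + \<delta>1 * N (max 0 (t - \<tau> t))"
    unfolding N_def \<Psi>_def \<rho>_def by (rule dissipation[OF T a _ p(1-5) LMI]) (rule \<tau>)
  have "AE t in ?M. t \<in> {0..T} \<longrightarrow> w t * (2 * \<delta>0 * N t + \<Psi> t) \<le> R t"
    using dis neT
  proof eventually_elim
    case (elim t)
    show ?case
    proof
      assume t: "t \<in> {0..T}"
      define A where "A = max 0 (t - \<tau>M)"
      have A: "0 \<le> A" "A \<le> t" using t \<tau>M by (auto simp: A_def)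
      have "N (max 0 (t - \<tau> t)) \<le> b t" using b(2)[of t] t elim(2) by auto
      then have "\<delta>1 * N (max 0 (t - \<tau> t)) \<le> \<delta>1 * b t" using p by simp
      with elim(1) t have "2 * \<delta>0 * N t + \<Psi> t \<le> - g * E t + g * \<rho> * E A - \<tau>M\<^sup>2 * r * F t
          + \<rho> * r * \<tau>M * integral {A..t} F + \<delta>1 * b t"
        unfolding A_def by simp
      then have "w t * (2 * \<delta>0 * N t + \<Psi> t) \<le> w t * (- g * E t + g * \<rho> * E A - \<tau>M\<^sup>2 * r * F t
          + \<rho> * r * \<tau>M * integral {A..t} F + \<delta>1 * b t)"
        using w(1)[of t] by (intro mult_left_mono) auto
      also have "\<dots> = - g * (w t * E t - (\<rho> * w t) * E A) + r * \<tau>M * ((\<rho> * w t) * integral {A..t} F) - \<tau>M\<^sup>2 * r * (w t * F t)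
          + \<delta>1 * (w t * b t)"
        by (simp add: algebra_simps)
      also have "\<dots> \<le> R t"
      proof -
        \<comment> \<open>The shifted weight \<open>w (t - \<tau>M)\<close> is at most
          \<open>w s\<close> throughout the window, so the weight can be moved under the integral
          and the history term becomes an increment of \<open>P\<close>.\<close>
        have "(\<rho> * w t) * integral {A..t} F = integral {A..t} (\<lambda>s. w (t - \<tau>M) * F s)"
          by (simp add: w\<rho>)
        also have "\<dots> \<le> integral {A..t} (\<lambda>s. w s * F s)"
          using A t by (intro integral_le sub integrable_on_mult_right mult_right_mono wmono) (auto simp: A_def)
        also have "\<dots> = P t - P A" using A t by (intro Pdiff[symmetric]) auto
        finally have "r * \<tau>M * ((\<rho> * w t) * integral {A..t} F) \<le> r * \<tau>M * (P t - P A)"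
          using r \<tau>M by (intro mult_left_mono) auto
        moreover have "f t = w t * E t" "f (t - \<tau>M) = (\<rho> * w t) * E A"
          using t by (auto simp: f_def A_def w\<rho>)
        ultimately show ?thesis by (simp add: R_def A_def)
      qed
      finally show "w t * (2 * \<delta>0 * N t + \<Psi> t) \<le> R t" .
    qed
  qed
  then have le: "AE t in ?M. w t * (2 * \<delta>0 * N t + \<Psi> t) \<le> R t"
    by (rule lebesgue_on_mono) auto
  have "integrable ?M (\<lambda>t. w t * (2 * \<delta>0 * N t + \<Psi> t))"
    by (intro integrable_continuous_mult[OF _ w(2)] Bochner_Integration.integrable_add \<Psi>(1) cont_int continuous_intros cN)
  from integral_mono_AE[OF this iR le] \<Psi>(2) have "w T * N T - N 0 \<le> (\<integral>t. R t \<partial>?M)" by simp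
  also have "\<dots> = (\<integral>t. - g * (f t - f (t - \<tau>M)) \<partial>?M) + (\<integral>t. r * \<tau>M * (P t - P (max 0 (t - \<tau>M))) \<partial>?M)
      - \<tau>M\<^sup>2 * r * (\<integral>t. w t * F t \<partial>?M) + (\<integral>t. \<delta>1 * (w t * b t) \<partial>?M)"
  proof -
    have "(\<integral>t. R t \<partial>?M) = (\<integral>t. (- g * (f t - f (t - \<tau>M)) + r * \<tau>M * (P t - P (max 0 (t - \<tau>M)))) - \<tau>M\<^sup>2 * r * (w t * F t) \<partial>?M)
        + (\<integral>t. \<delta>1 * (w t * b t) \<partial>?M)"
      unfolding R_def
      by (intro Bochner_Integration.integral_add Bochner_Integration.integrable_add Bochner_Integration.integrable_diff integrable_mult_right wF cont_int c1 c2 c3)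
    also have "(\<integral>t. (- g * (f t - f (t - \<tau>M)) + r * \<tau>M * (P t - P (max 0 (t - \<tau>M)))) - \<tau>M\<^sup>2 * r * (w t * F t) \<partial>?M) =
        (\<integral>t. - g * (f t - f (t - \<tau>M)) + r * \<tau>M * (P t - P (max 0 (t - \<tau>M))) \<partial>?M) - (\<integral>t. \<tau>M\<^sup>2 * r * (w t * F t) \<partial>?M)"
      by (intro Bochner_Integration.integral_diff Bochner_Integration.integrable_add integrable_mult_right wF cont_int c1 c2)
    also have "(\<integral>t. - g * (f t - f (t - \<tau>M)) + r * \<tau>M * (P t - P (max 0 (t - \<tau>M))) \<partial>?M) =
       (\<integral>t. - g * (f t - f (t - \<tau>M)) \<partial>?M) + (\<integral>t. r * \<tau>M * (P t - P (max 0 (t - \<tau>M))) \<partial>?M)"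
      by (intro Bochner_Integration.integral_add cont_int c1 c2)
    finally show ?thesis by simp
  qed
  also have "(\<integral>t. - g * (f t - f (t - \<tau>M)) \<partial>?M) \<le> g * \<tau>M * E 0"
  proof -
    have "(\<integral>t. - g * (f t - f (t - \<tau>M)) \<partial>?M) = - g * integral {0..T} (\<lambda>t. f t - f (t - \<tau>M))"
      using lebesgue_integral_eq_integral[OF cont_int[OF c1]] by simp
    also have "integral {0..T} (\<lambda>t. f t - f (t - \<tau>M)) = integral {T-\<tau>M..T} f - integral {-\<tau>M..0} f"
      using \<tau>M T by (intro integral_minus_delayed cf) auto
    finally have eq: "(\<integral>t. - g * (f t - f (t - \<tau>M)) \<partial>?M) = g * integral {-\<tau>M..0} f - g * integral {T-\<tau>M..T} f"
      by (simp add: algebra_simps)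
    \<comment> \<open>The end piece at \<open>T\<close> has a favourable sign and is dropped; the
      one before \<open>0\<close> sees the constant state \<open>E 0\<close> with weight at most
      \<open>1\<close>.\<close>
    have "0 \<le> integral {T-\<tau>M..T} f"
      by (intro integral_nonneg integrable_continuous_real cf) (use w(1) in \<open>auto simp: f_def less_imp_le\<close>)
    then have 1: "0 \<le> g * integral {T-\<tau>M..T} f" using p(6) by simp
    have "integral {-\<tau>M..0} f \<le> integral {-\<tau>M..0} (\<lambda>s. E 0)"
    proof (rule integral_le)
      show "f integrable_on {- \<tau>M..0}"
        using T by (intro integrable_continuous_real continuous_on_subset[OF cf[of "-\<tau>M"]]) auto
      fix t assume "t \<in> {- \<tau>M..0}"
      then have "w t \<le> w 0" "max 0 t = 0" by (auto intro: wmono)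
      then show "f t \<le> E 0" using mult_right_mono[of "w t" 1 "E 0"] by (simp add: f_def w_def)
    qed auto
    also have "integral {-\<tau>M..0} (\<lambda>s. E 0) = \<tau>M * E 0" using \<tau>M by simp
    finally have "g * integral {-\<tau>M..0} f \<le> g * (\<tau>M * E 0)" using p(6) by simp
    with 1 show ?thesis unfolding eq by simp
  qed
  \<comment> \<open>This is exactly the amount that the \<open>\<tau>M\<^sup>2 * r\<close> of
    \<open>\<Phi>22\<close> provides, so every occurrence of \<open>F\<close> cancels.\<close>
  also have "(\<integral>t. r * \<tau>M * (P t - P (max 0 (t - \<tau>M))) \<partial>?M) \<le> \<tau>M\<^sup>2 * r * (\<integral>t. w t * F t \<partial>?M)"
  proof -
    have "(\<integral>t. r * \<tau>M * (P t - P (max 0 (t - \<tau>M))) \<partial>?M) = r * \<tau>M * integral {0..T} (\<lambda>t. P t - P (max 0 (t - \<tau>M)))"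
      using lebesgue_integral_eq_integral[OF cont_int[OF c2]] by simp
    also have "\<dots> \<le> r * \<tau>M * (\<tau>M * P T)"
      using r \<tau>M T Pcont Pmono by (intro mult_left_mono integral_increment_le) (auto simp: P_def)
    also have "P T = (\<integral>t. w t * F t \<partial>?M)"
      unfolding P_def by (rule lebesgue_integral_eq_integral[OF wF, symmetric]) auto
    finally show ?thesis by (simp add: power2_eq_square algebra_simps)
  qed
  also have "(\<integral>t. \<delta>1 * (w t * b t) \<partial>?M) = integral {0..T} (\<lambda>t. \<delta>1 * (w t * b t))"
    using lebesgue_integral_eq_integral[OF cont_int[OF c3]] by simp
  finally show ?thesis unfolding w_def by simp
qed

text \<open>Halanay's argument by first crossing: if the energy ever meets the barrier
  \<open>V * exp (- 2 * \<delta> * t)\<close>, then before the first such time \<open>T\<close> the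
  delayed energy lies below the barrier shifted by \<open>\<tau>M\<close>. Inserting this into the
  integrated inequality keeps the energy strictly below the barrier at \<open>T\<close>.\<close>

lemma energy_decay:
  fixes \<delta> \<delta>0 \<delta>1 \<tau>M p1 p2 p3 r g s :: real
  defines "N \<equiv> \<lambda>t. p1 * E t + p3 * a * D t"
  assumes a: "a > 0" and \<delta>0: "\<delta>0 > 0" and \<tau>M: "\<tau>M > 0"
    and \<tau>: "\<And>t. t \<ge> 0 \<Longrightarrow> 0 \<le> \<tau> t \<and> \<tau> t \<le> \<tau>M"
    and p: "p1 > 0" "p3 > 0" "\<bar>s\<bar> \<le> r" "\<delta>1 > 0" "\<delta>0 * p3 \<le> p2" "g > 0"
    and LMI: "neg_semidef (Phi a K \<delta>0 \<delta>1 \<tau>M p1 p2 p3 r g s)"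
    and \<delta>: "\<delta> > 0" "\<delta> = \<delta>0 - \<delta>1 * exp (2 * \<delta> * \<tau>M) / 2"
    and t: "t \<ge> 0"
  shows "N t \<le> (1 + g * \<tau>M / p1) * N 0 * exp (- 2 * \<delta> * t)"
proof -
  \<comment> \<open>The factor absorbs the initial history term \<open>g * \<tau>M * E 0\<close> by
    means of \<open>p1 * E 0 \<le> N 0\<close>.\<close>
  define V0 where "V0 = (1 + g * \<tau>M / p1) * N 0"
  have Npos: "N t \<ge> 0" for t using p a by (simp add: N_def)
  have p1E: "p1 * E 0 \<le> N 0" using p a by (simp add: N_def)
  have V0: "N 0 + g * \<tau>M * E 0 \<le> V0"
  proof -
    have "E 0 \<le> N 0 / p1" using p1E p by (simp add: field_simps)
    then have "g * \<tau>M * E 0 \<le> g * \<tau>M * (N 0 / p1)" using p \<tau>M by (intro mult_left_mono) auto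
    then show ?thesis by (simp add: V0_def algebra_simps)
  qed
  have "V0 \<ge> 0" using V0 Npos[of 0] p \<tau>M by (simp add: V0_def)
  have cN: "continuous_on {0..} N"
    unfolding N_def by (intro continuous_intros continuous_E continuous_D)
  \<comment> \<open>A barrier strictly above \<open>V0\<close> makes the contradiction strict;
    \<open>V\<close> descends to \<open>V0\<close> at the end.\<close>
  have strict: "N t < V * exp (- 2 * \<delta> * t)" if V: "V0 < V" and "t \<ge> 0" for V t
  proof (rule ccontr)
    assume "\<not> N t < V * exp (- 2 * \<delta> * t)"
    define S where "S = {u \<in> {0..}. 0 \<le> N u - V * exp (- 2 * \<delta> * u)}"
    have "t \<in> S" using \<open>t \<ge> 0\<close> \<open>\<not> _\<close> by (simp add: S_def)
    have "closed S"
      unfolding S_def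
      by (intro continuous_on_closed_Collect_le continuous_intros cN)
    have "bdd_below S" by (rule bdd_belowI[of _ 0]) (simp add: S_def)
    define T where "T = Inf S"
    have "T \<in> S"
      unfolding T_def using \<open>closed S\<close> \<open>bdd_below S\<close> \<open>t \<in> S\<close> by (intro closed_contains_Inf) auto
    have before: "N u < V * exp (- 2 * \<delta> * u)" if "0 \<le> u" "u < T" for u
    proof -
      have "u \<notin> S" using cInf_lower[OF _ \<open>bdd_below S\<close>, of u] that by (auto simp: T_def)
      then show ?thesis using that by (simp add: S_def)
    qed
    have "0 \<le> g * \<tau>M * E 0" using p \<tau>M by simp
    then have "N 0 \<le> V0" using V0 by linarith
    then have "0 \<notin> S" using V by (simp add: S_def)
    then have T: "T > 0" using \<open>T \<in> S\<close> by (cases "T = 0") (auto simp: S_def)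
    \<comment> \<open>The barrier at the oldest admissible time. It decreases, so it bounds the
      energy at every less delayed time as well, and also at the clipped time.\<close>
    define b where "b = (\<lambda>u. V * exp (- 2 * \<delta> * (u - \<tau>M)))"
    have Vpos: "V > 0" using V \<open>V0 \<ge> 0\<close> by simp
    have "exp (2 * \<delta>0 * T) * N T \<le> N 0 + g * \<tau>M * E 0 + integral {0..T} (\<lambda>t. \<delta>1 * (exp (2 * \<delta>0 * t) * b t))"
      unfolding N_def
    proof (rule integrated_dissipation[OF T a \<delta>0 \<tau>M \<tau> p LMI])
      show "continuous_on {0..T} b" unfolding b_def by (intro continuous_intros)
      fix u assume u: "u \<in> {0..<T}"
      define c where "c = max 0 (u - \<tau> u)"
      have "0 \<le> c" "c < T" "u - \<tau>M \<le> c" using u \<tau>[of u] by (auto simp: c_def)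
      then have "N c \<le> V * exp (- 2 * \<delta> * c)" using before[of c] by simp
      also have "\<dots> \<le> b u"
        unfolding b_def using Vpos \<delta>(1) \<open>u - \<tau>M \<le> c\<close> by (intro mult_left_mono) auto
      finally show "p1 * E (max 0 (u - \<tau> u)) + p3 * a * D (max 0 (u - \<tau> u)) \<le> b u" by (simp add: N_def c_def)
    qed
    also have "integral {0..T} (\<lambda>t. \<delta>1 * (exp (2 * \<delta>0 * t) * b t)) = V * exp (2 * (\<delta>0 - \<delta>) * T) - V * exp (2 * (\<delta>0 - \<delta>) * 0)"
    proof (rule integral_unique, rule fundamental_theorem_of_calculus)
      fix u
      \<comment> \<open>The equation for \<open>\<delta>\<close> makes the integrand an exact
        derivative; its lower end contributes \<open>- V\<close>, which outweighs the initial terms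
        bounded by \<open>V0\<close>.\<close>
      have "z = 2 * (y - x)" if "x = y - z / 2" for x y z :: real using that by simp
      from this[OF \<delta>(2)] have "\<delta>1 * exp (2 * \<delta> * \<tau>M) = 2 * (\<delta>0 - \<delta>)" .
      moreover have "\<delta>1 * (exp (2 * \<delta>0 * u) * b u) = V * ((\<delta>1 * exp (2 * \<delta> * \<tau>M)) * exp (2 * (\<delta>0 - \<delta>) * u))"
        by (simp add: b_def exp_add[symmetric] exp_diff[symmetric] algebra_simps)
      ultimately have eq: "\<delta>1 * (exp (2 * \<delta>0 * u) * b u) = V * (2 * (\<delta>0 - \<delta>) * exp (2 * (\<delta>0 - \<delta>) * u))" by simp
      show "((\<lambda>t. V * exp (2 * (\<delta>0 - \<delta>) * t)) has_vector_derivative \<delta>1 * (exp (2 * \<delta>0 * u) * b u)) (at u within {0..T})"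
        unfolding eq has_real_derivative_iff_has_vector_derivative[symmetric]
        by (auto intro!: derivative_eq_intros)
    qed (use T in simp)
    finally have "exp (2 * \<delta>0 * T) * N T < V * exp (2 * (\<delta>0 - \<delta>) * T)" using V0 V by simp
    moreover have "exp (2 * \<delta>0 * T) * N T \<ge> exp (2 * \<delta>0 * T) * (V * exp (- 2 * \<delta> * T))"
      using \<open>T \<in> S\<close> by (intro mult_left_mono) (auto simp: S_def)
    moreover have "exp (2 * \<delta>0 * T) * (V * exp (- 2 * \<delta> * T)) = V * exp (2 * (\<delta>0 - \<delta>) * T)"
      by (simp add: exp_add[symmetric] algebra_simps)
    ultimately show False by linarith
  qed
  have "N t / exp (- 2 * \<delta> * t) \<le> V0"
  proof (rule dense_ge)
    fix V assume "V0 < V"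
    from strict[OF this t] show "N t / exp (- 2 * \<delta> * t) \<le> V" by (simp add: field_simps)
  qed
  then show ?thesis unfolding V0_def[symmetric] by (simp add: pos_divide_le_eq)
qed

end

text \<open>The energy is equivalent to the squared H1 norm with constants \<open>lo\<close> and
  \<open>up\<close>, and the square root halves the rate \<open>2 * \<delta>\<close>. The constant
  \<open>C\<close> is built from the gains, the delay bound and the multipliers alone, so it serves
  all solutions at once.\<close>

lemma exponential_stability:
  fixes \<delta> \<delta>0 \<delta>1 \<tau>M a K :: real
  assumes a: "a > 0" and \<delta>0: "\<delta>0 > 0" and \<delta>1: "\<delta>1 > 0" and \<tau>M: "\<tau>M > 0"
    and \<tau>: "network_delay \<tau>" "\<And>t. t \<ge> 0 \<Longrightarrow> \<tau> t \<le> \<tau>M"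
    and LMI: "LMIs_feasible a K \<delta>0 \<delta>1 \<tau>M"
    and \<delta>: "\<delta> > 0" "\<delta> = \<delta>0 - \<delta>1 * exp (2 * \<delta> * \<tau>M) / 2"
  shows "\<exists>C>0. \<forall>e. strong_solution a K \<tau> e \<longrightarrow>
    (\<forall>t\<ge>0. H1_norm (\<lambda>x. e x t) \<le> C * exp (- \<delta> * t) * H1_norm (\<lambda>x. e x 0))"
proof -
  obtain p1 p2 p3 r g s where p: "p1 > 0" "p3 > 0" "g > 0" "\<delta>0 * p3 \<le> p2"
    and Phi: "neg_semidef (Phi a K \<delta>0 \<delta>1 \<tau>M p1 p2 p3 r g s)"
    and "pos_semidef (vector [vector [r, s], vector [s, r]] :: real^2^2)"
    using LMI unfolding LMIs_feasible_def by blast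
  then have rs: "\<bar>s\<bar> \<le> r" by (simp add: pos_semidef_2)
  define lo where "lo = min p1 (p3 * a)"
  define up where "up = max p1 (p3 * a)"
  have lo: "lo > 0" "up > 0" using p a by (auto simp: lo_def up_def)
  define B where "B = (1 + g * \<tau>M / p1) * up / lo"
  have B: "B > 0" unfolding B_def using p lo \<tau>M by (intro divide_pos_pos mult_pos_pos add_pos_pos) auto
  show ?thesis
  proof (intro exI[of _ "sqrt B"] conjI allI impI)
    show "sqrt B > 0" using B by simp
    fix e and t :: real assume "strong_solution a K \<tau> e" and t: "t \<ge> 0"
    then interpret solution a K \<tau> e by unfold_locales
    have "lo * (E t + D t) \<le> p1 * E t + p3 * a * D t"
      unfolding distrib_left by (intro add_mono mult_right_mono) (auto simp: lo_def)
    also have "\<dots> \<le> (1 + g * \<tau>M / p1) * (p1 * E 0 + p3 * a * D 0) * exp (- 2 * \<delta> * t)"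
      using network_delay_nonneg[OF \<tau>(1)] \<tau>(2) by (intro energy_decay[OF a \<delta>0 \<tau>M _ p(1,2) rs \<delta>1 p(4,3) Phi \<delta> t]) auto
    also have "\<dots> \<le> (1 + g * \<tau>M / p1) * (up * (E 0 + D 0)) * exp (- 2 * \<delta> * t)"
    proof -
      have "p1 * E 0 + p3 * a * D 0 \<le> up * (E 0 + D 0)"
        unfolding distrib_left by (intro add_mono mult_right_mono) (auto simp: up_def)
      then show ?thesis using p \<tau>M by (intro mult_right_mono mult_left_mono add_nonneg_nonneg) auto
    qed
    finally have "E t + D t \<le> (1 + g * \<tau>M / p1) * (up * (E 0 + D 0)) * exp (- 2 * \<delta> * t) / lo"
      using lo by (simp add: pos_le_divide_eq mult.commute)
    also have "\<dots> = B * exp (- 2 * \<delta> * t) * (E 0 + D 0)" by (simp add: B_def)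
    finally have "E t + D t \<le> B * exp (- 2 * \<delta> * t) * (E 0 + D 0)" .
    then have "(H1_norm (\<lambda>x. e x t))\<^sup>2 \<le> B * exp (- 2 * \<delta> * t) * (H1_norm (\<lambda>x. e x 0))\<^sup>2"
      unfolding H1_norm_slice .
    also have "\<dots> = (sqrt B * exp (- \<delta> * t) * H1_norm (\<lambda>x. e x 0))\<^sup>2"
      using B by (simp add: power_mult_distrib exp_double[symmetric])
    finally show "H1_norm (\<lambda>x. e x t) \<le> sqrt B * exp (- \<delta> * t) * H1_norm (\<lambda>x. e x 0)"
      by (rule power2_le_imp_le) (use B in \<open>simp add: H1_norm_def\<close>)
  qed
qed

text \<open>In the feasibility part, \<open>\<tau>0\<close> depends on \<open>\<delta>0\<close> and
  \<open>K\<close> only, whereas the threshold for \<open>a\<close> grows like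
  \<open>1 / \<delta>1\<close>, because \<open>\<Phi>55\<close> offers just
  \<open>\<delta>1 * a / 4\<close> when \<open>p3 = 1\<close>.\<close>

theorem theorem4:
  shows
    "(\<forall>a K \<delta>0 \<delta>1 \<tau>M :: real. \<forall>\<tau> :: real \<Rightarrow> real.
        a > 0 \<and> K > 0 \<and> \<delta>0 > 0 \<and> \<delta>1 > 0 \<and> \<tau>M > 0 \<and> \<delta>1 < 2 * \<delta>0 \<and>
        network_delay \<tau> \<and> (\<forall>t\<ge>0. \<tau> t \<le> \<tau>M) \<and>
        LMIs_feasible a K \<delta>0 \<delta>1 \<tau>M
        \<longrightarrow>
        (\<exists>!\<delta>. \<delta> > 0 \<and> \<delta> = \<delta>0 - \<delta>1 * exp (2 * \<delta> * \<tau>M) / 2) \<and>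
        (\<forall>\<delta>. \<delta> > 0 \<and> \<delta> = \<delta>0 - \<delta>1 * exp (2 * \<delta> * \<tau>M) / 2 \<longrightarrow>
           (\<exists>C>0. \<forall>e. (\<lambda>x. e x 0) \<in> X_space \<and> strong_solution a K \<tau> e \<longrightarrow>
              (\<forall>t\<ge>0. H1_norm (\<lambda>x. e x t) \<le> C * exp (- \<delta> * t) * H1_norm (\<lambda>x. e x 0)))))
     \<and>
     (\<forall>\<delta>0 K :: real. \<delta>0 > 0 \<and> K > \<delta>0 \<longrightarrow>
        (\<exists>\<tau>0>0. \<forall>\<tau>M \<delta> \<delta>1 :: real.
           0 < \<tau>M \<and> \<tau>M \<le> \<tau>0 \<and> \<delta> > 0 \<and> 0 < \<delta>1 \<and> \<delta>1 < 2 * \<delta>0 \<and>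
           \<delta> = \<delta>0 - \<delta>1 * exp (2 * \<delta> * \<tau>M) / 2
           \<longrightarrow> (\<forall>\<^sub>F a in at_top. LMIs_feasible a K \<delta>0 \<delta>1 \<tau>M)))"
proof (intro conjI allI impI; (elim conjE)?)
  fix a K \<delta>0 \<delta>1 \<tau>M :: real and \<tau> :: "real \<Rightarrow> real"
  assume A: "a > 0" "K > 0" "\<delta>0 > 0" "\<delta>1 > 0" "\<tau>M > 0" "\<delta>1 < 2 * \<delta>0"
    "network_delay \<tau>" "\<forall>t\<ge>0. \<tau> t \<le> \<tau>M" "LMIs_feasible a K \<delta>0 \<delta>1 \<tau>M"
  show "\<exists>!\<delta>. \<delta> > 0 \<and> \<delta> = \<delta>0 - \<delta>1 * exp (2 * \<delta> * \<tau>M) / 2"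
    using A(3,4,5,6) by (rule decay_rate_unique)
  fix \<delta> assume "\<delta> > 0" "\<delta> = \<delta>0 - \<delta>1 * exp (2 * \<delta> * \<tau>M) / 2"
  note \<delta> = this
  have "\<tau> t \<le> \<tau>M" if "t \<ge> 0" for t using A(8) that by blast
  from exponential_stability[OF A(1,3,4,5,7) this A(9) \<delta>]
  show "\<exists>C>0. \<forall>e. (\<lambda>x. e x 0) \<in> X_space \<and> strong_solution a K \<tau> e \<longrightarrow>
      (\<forall>t\<ge>0. H1_norm (\<lambda>x. e x t) \<le> C * exp (- \<delta> * t) * H1_norm (\<lambda>x. e x 0))"
    by meson
next
  fix \<delta>0 K :: real assume "\<delta>0 > 0" "K > \<delta>0"
  from LMIs_feasible_eventually[OF this] obtain \<tau>0 where "\<tau>0 > 0"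
    and feas: "\<And>\<tau>M \<delta>1. 0 < \<tau>M \<and> \<tau>M \<le> \<tau>0 \<and> 0 < \<delta>1 \<Longrightarrow> \<forall>\<^sub>F a in at_top. LMIs_feasible a K \<delta>0 \<delta>1 \<tau>M"
    by blast
  show "\<exists>\<tau>0>0. \<forall>\<tau>M \<delta> \<delta>1 :: real.
         0 < \<tau>M \<and> \<tau>M \<le> \<tau>0 \<and> \<delta> > 0 \<and> 0 < \<delta>1 \<and> \<delta>1 < 2 * \<delta>0 \<and>
         \<delta> = \<delta>0 - \<delta>1 * exp (2 * \<delta> * \<tau>M) / 2
         \<longrightarrow> (\<forall>\<^sub>F a in at_top. LMIs_feasible a K \<delta>0 \<delta>1 \<tau>M)"
  proof (intro exI[of _ \<tau>0] conjI allI impI; (elim conjE)?)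
    show "\<tau>0 > 0" by fact
    fix \<tau>M \<delta>1 :: real
    assume "0 < \<tau>M" "\<tau>M \<le> \<tau>0" "0 < \<delta>1"
    then show "\<forall>\<^sub>F a in at_top. LMIs_feasible a K \<delta>0 \<delta>1 \<tau>M" by (intro feas conjI)
  qed
qed

end
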